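(* Let $X=(X_t,P^x)$ and $Y=(Y_t,Q^x)$ be conservative Borel right Markov processes with càdlàg paths on the same state space $E$, each satisfying the duality hypothesis (D) and the transition density hypothesis (T) of the context, with reference measures $m^X,m^Y$, dual processes $\hat X=(\hat X_t,\hat P^x)$, $\hat Y=(\hat Y_t,\hat Q^x)$ and bridge laws $P^{x,y}_t$, $Q^{x,y}_t$. Suppose there exists $t_0>0$ such that $Q^{x,x}_{t_0}=P^{x,x}_{t_0}$ for all $x\in E$. Then: (a) $P^x|_{\mathcal F_t}\sim Q^x|_{\mathcal F_t}$ and $\hat P^y|_{\mathcal F_t}\sim\hat Q^y|_{\mathcal F_t}$ (mutual absolute continuity) for all $x\in E$, $y\in E$ and $t>0$. (b) There exist a constant $\lambda\in\mathbb R$, a Borel finely continuous function $\psi:E\to(0,\infty)$, and a Borel co-finely continuous function $\hat\psi:E\to(0,\infty)$ such that for all $t>0$ and all $x\in E$, $$P_t\psi(x)=e^{\lambda t}\psi(x),\qquad \hat P_t\hat\psi(x)=e^{\lambda t}\hat\psi(x),$$ $$Q^x|_{\mathcal F_t}=e^{-\lambda t}\frac{\psi(X_t)}{\psi(X_0)}\,P^x|_{\mathcal F_t},\qquad \hat Q^x|_{\mathcal F_t}=e^{-\lambda t}\frac{\hat\psi(X_t)}{\hat\psi(X_0)}\,\hat P^x|_{\mathcal F_t},$$ and the function $\psi\hat\psi$ is a Borel version of the Radon–Nikodym derivative $dm^Y/dm^X$. (c) $Q^{x,y}_t=P^{x,y}_t$ for all $(x,t,y)\in E\times(0,\infty)\times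 E$.
   Context: Setting. $E$ is a space homeomorphic to a Borel subset of a compact metric space, with Borel $\sigma$-algebra $\mathcal E$. $\Omega$ is the set of all càdlàg paths $\omega:[0,\infty)\to E$, $X_t(\omega)=\omega(t)$ is the coordinate process, $\mathcal F_t=\sigma(X_s:0\le s\le t)$ (uncompleted), $\mathcal F_{t-}=\sigma(X_s:0\le s<t)$, and $\theta_t$ are the shifts, $X_s\circ\theta_t=X_{s+t}$. All processes considered (including the dual processes) are realized as the coordinate process on $\Omega$ (so $Y_t$, $\hat X_t$, $\hat Y_t$ are also the coordinate maps), under different families of laws. A conservative Borel right process with càdlàg paths, $X=(X_t,P^x)$, is a time-homogeneous strong Markov process given by probability laws $P^x$, $x\in E$, on $\Omega$ with $P^x(X_0=x)=1$ (no branch points), infinite lifetime, and transition semigroup $P_tf(x)=P^x(f(X_t))$ mapping bounded Borel functions to Borel functions. (Here $P^x(\cdot)$ applied to a function denotes expectation.) Hypothesis (D) (duality) for $X$: there are a $\sigma$-finite measure $m^X$ on $(E,\mathcal E)$ and a second $E$-valued conservative Borel right process $\hat X$ with càdlàg paths, with laws $\hat P^x$ and semigroup $(\hat P_t)$, such that $\int_E f\,P_tg\,dm^X=\int_E(\hat P_tf)\,g\,dm^X$ for all $t>0$ and all positive $\mathcal E$-measurable $f,g$. Hypothesis (T) (transition densities) for $X$: there is a jointly Borel measurable function $(x,t,y)\mapsto p_t(x,y)\in(0,\infty)$ on $E\times(0,\infty)\times E$ such that for all $t>0$, $x\in E$ and bounded Borel $f$, $P_tf(x)=\int_E p_t(x,y)f(y)\,m^X(dy)$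 and $\hat P_tf(x)=\int_E p_t(y,x)f(y)\,m^X(dy)$, and $p_{t+s}(x,y)=\int_E p_t(x,z)p_s(z,y)\,m^X(dz)$ for all $s,t>0$, $x,y\in E$. $Y$ satisfies the same conditions, with laws $Q^x$, semigroup $(Q_t)$, reference measure $m^Y$, density $q_t(x,y)$ (with respect to $m^Y$), dual process $\hat Y$ and dual laws $\hat Q^x$. Bridge laws: for $(x,t,y)\in E\times(0,\infty)\times E$, $P^{x,y}_t$ is the unique probability measure on $(\Omega,\mathcal F_{t-})$ such that $P^{x,y}_t(F)=P^x\!\left(F\,\frac{p_{t-s}(X_s,y)}{p_t(x,y)}\right)$ for all $0\le s<t$ and all positive $\mathcal F_s$-measurable $F$ (its existence and uniqueness are known; it is a regular version of the law of $(X_s)_{0\le s<t}$ under $P^x$ conditioned on $X_t=y$). $Q^{x,y}_t$ is defined in the same way from $Q^x$ and $q_t$. A Borel function $f$ on $E$ is finely continuous (for $X$) if $t\mapsto f(X_t)$ is right-continuous $P^x$-a.s. for every $x\in E$; co-finely continuous means finely continuous for the dual process $\hat X$ (that is, with $\hat P^x$ in place of $P^x$). *)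

theory Defs
  imports "HOL-Probability.Probability"
begin

section \<open>Path space\<close>

text \<open>
  The state space is a whole type \<open>'a\<close>. A path is a function on \<open>[0,\<infinity>)\<close>, represented as a function
  on the reals that is \<open>undefined\<close> at negative times.
\<close>

definition cadlag_paths :: "(real \<Rightarrow> 'a::topological_space) set" where
  "cadlag_paths = {\<omega> \<in> extensional {0..}.
     (\<forall>t\<ge>0. (\<omega> \<longlongrightarrow> \<omega> t) (at_right t)) \<and> (\<forall>t>0. \<exists>l. (\<omega> \<longlongrightarrow> l) (at_left t))}"

text \<open>
  \<open>path_sigma I\<close> is \<open>\<sigma>(X\<^sub>s : s \<in> I)\<close> on the path space: \<open>I = {0..t}\<close> gives \<open>\<F>\<^sub>t\<close>, \<open>I = {0..<t}\<close> gives
  \<open>\<F>\<^sub>t\<^sub>-\<close>, and \<open>I = {0..}\<close> gives the full \<open>\<sigma>\<close>-algebra. Nothing is completed.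
\<close>

definition path_sigma :: "real set \<Rightarrow> (real \<Rightarrow> 'a::topological_space) measure" where
  "path_sigma I = sigma cadlag_paths {{\<omega> \<in> cadlag_paths. \<omega> s \<in> A} | s A. s \<in> I \<and> A \<in> sets borel}"

definition shift :: "real \<Rightarrow> (real \<Rightarrow> 'a) \<Rightarrow> real \<Rightarrow> 'a" where
  "shift t \<omega> = (\<lambda>s\<in>{0..}. \<omega> (t + s))"

text \<open>
  The right-continuous filtration \<open>\<F>\<^sub>u\<^sub>+\<close>, indexed by \<open>[0,\<infinity>]\<close> so that stopping times may be infinite.
  The index \<open>top\<close> only matters for \<open>u = top\<close>, where it makes \<open>\<F>\<^sub>u\<^sub>+\<close> the full \<open>\<sigma>\<close>-algebra.
\<close>

definition path_filtration :: "ennreal \<Rightarrow> (real \<Rightarrow> 'a::topological_space) measure" where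
  "path_filtration u =
     sigma cadlag_paths (\<Inter>v\<in>{u<..} \<union> {top}. sets (path_sigma {s. 0 \<le> s \<and> ennreal s \<le> v}))"

lemma space_path_sigma [simp]: "space (path_sigma I) = cadlag_paths"
  unfolding path_sigma_def by (rule space_measure_of) auto

lemma sets_path_sigma:
  "sets (path_sigma I) =
     sigma_sets cadlag_paths {{\<omega> \<in> cadlag_paths. \<omega> s \<in> A} | s A. s \<in> I \<and> A \<in> sets borel}"
  unfolding path_sigma_def by (rule sets_measure_of) auto

lemma sets_path_sigma_mono: "I \<subseteq> J \<Longrightarrow> sets (path_sigma I) \<subseteq> sets (path_sigma J)"
  unfolding sets_path_sigma by (rule sigma_sets_mono') blast

lemma sets_path_filtration:
  "sets (path_filtration u) =
     (\<Inter>v\<in>{u<..} \<union> {top}. sets (path_sigma {s. 0 \<le> s \<and> ennreal s \<le> v}))"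
proof -
  let ?S = "\<Inter>v\<in>{u<..} \<union> {top}. sets (path_sigma {s. 0 \<le> s \<and> ennreal s \<le> v})"
  have "sigma_algebra cadlag_paths ?S"
    unfolding sigma_algebra_iff2
  proof (intro conjI ballI allI impI)
    show "?S \<subseteq> Pow cadlag_paths"
      using sets.space_closed[of "path_sigma {s. 0 \<le> s \<and> ennreal s \<le> top}"] by auto
    show "cadlag_paths - A \<in> ?S" if "A \<in> ?S" for A
      using that sets.compl_sets[of A "path_sigma _"] by auto
    show "(\<Union>i::nat. A i) \<in> ?S" if "range A \<subseteq> ?S" for A
      using that by (intro INT_I sets.countable_UN) blast
  qed auto
  then show ?thesis
    unfolding path_filtration_def by (rule sigma_algebra.sets_measure_of_eq)
qed

lemma space_path_filtration: "space (path_filtration u) = cadlag_paths"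
proof -
  have "(\<Inter>v\<in>{u<..} \<union> {top}. sets (path_sigma {s. 0 \<le> s \<and> ennreal s \<le> v})) \<subseteq> Pow cadlag_paths"
    using sets.space_closed[of "path_sigma {s. 0 \<le> s \<and> ennreal s \<le> top}"] by auto
  then show ?thesis
    unfolding path_filtration_def by (rule space_measure_of)
qed

lemma filtration_path_filtration: "filtration cadlag_paths path_filtration"
proof
  show "sets (path_filtration u) \<subseteq> sets (path_filtration v)" if "u \<le> v" for u v
    unfolding sets_path_filtration using that by (intro INF_superset_mono) auto
qed (rule space_path_filtration)

section \<open>Right processes, duality, transition densities, bridges\<close>

text \<open>
  A conservative Borel right process with cadlag paths, given by its laws \<open>P x\<close>. The last conjunct
  is the strong Markov property \<open>P\<^sup>x(G \<circ> \<theta>\<^sub>T | \<F>\<^sub>T\<^sub>+) = P\<^bsup>X\<^sub>T\<^esup>(G)\<close> on \<open>{T < \<infinity>}\<close> at all stopping times of the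
  right-continuous filtration; constant \<open>T\<close> gives the time-homogeneous Markov property.
\<close>

definition borel_right_process :: "('a::topological_space \<Rightarrow> (real \<Rightarrow> 'a) measure) \<Rightarrow> bool" where
  "borel_right_process P \<longleftrightarrow>
     (\<forall>x. prob_space (P x) \<and> sets (P x) = sets (path_sigma {0..})) \<and>
     (\<forall>x. AE \<omega> in P x. \<omega> 0 = x) \<and>
     (\<forall>t\<ge>0. \<forall>f::'a \<Rightarrow> real. f \<in> borel_measurable borel \<and> bounded (range f) \<longrightarrow>
        (\<lambda>x. \<integral>\<omega>. f (\<omega> t) \<partial>P x) \<in> borel_measurable borel) \<and>
     (\<forall>x T A G. stopping_time path_filtration T \<and>
        A \<in> sets (filtration.pre_sigma cadlag_paths path_filtration T) \<and>
        G \<in> sets (path_sigma {0..}) \<longrightarrow>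
        emeasure (P x) {\<omega> \<in> A. T \<omega> < top \<and> shift (enn2real (T \<omega>)) \<omega> \<in> G} =
        (\<integral>\<^sup>+\<omega>\<in>{\<omega> \<in> A. T \<omega> < top}. emeasure (P (\<omega> (enn2real (T \<omega>)))) G \<partial>P x))"

text \<open>The semigroup \<open>P\<^sub>t f(x) = P\<^sup>x(f(X\<^sub>t))\<close> on positive functions.\<close>

definition transition_semigroup ::
  "('a \<Rightarrow> (real \<Rightarrow> 'a) measure) \<Rightarrow> real \<Rightarrow> ('a \<Rightarrow> ennreal) \<Rightarrow> 'a \<Rightarrow> ennreal" where
  "transition_semigroup P t f x = (\<integral>\<^sup>+\<omega>. f (\<omega> t) \<partial>P x)"

text \<open>\<open>P'\<close> are the laws of the dual process.\<close>

definition duality_hypothesis ::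
  "('a::topological_space \<Rightarrow> (real \<Rightarrow> 'a) measure) \<Rightarrow> ('a \<Rightarrow> (real \<Rightarrow> 'a) measure) \<Rightarrow> 'a measure \<Rightarrow> bool"
where
  "duality_hypothesis P P' m \<longleftrightarrow>
     sets m = sets borel \<and> sigma_finite_measure m \<and> borel_right_process P' \<and>
     (\<forall>t>0. \<forall>f\<in>borel_measurable borel. \<forall>g\<in>borel_measurable borel.
        (\<integral>\<^sup>+x. f x * transition_semigroup P t g x \<partial>m) = (\<integral>\<^sup>+x. transition_semigroup P' t f x * g x \<partial>m))"

definition transition_density_hypothesis ::
  "('a::topological_space \<Rightarrow> (real \<Rightarrow> 'a) measure) \<Rightarrow> ('a \<Rightarrow> (real \<Rightarrow> 'a) measure) \<Rightarrow> 'a measure \<Rightarrow>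
   ('a \<Rightarrow> real \<Rightarrow> 'a \<Rightarrow> real) \<Rightarrow> bool"
where
  "transition_density_hypothesis P P' m p \<longleftrightarrow>
     (\<lambda>(x, t, y). p x t y) \<in>
       borel_measurable (borel \<Otimes>\<^sub>M (restrict_space borel {0<..} \<Otimes>\<^sub>M borel)) \<and>
     (\<forall>x y. \<forall>t>0. 0 < p x t y) \<and>
     (\<forall>t>0. \<forall>x. \<forall>f::'a \<Rightarrow> real. f \<in> borel_measurable borel \<and> bounded (range f) \<longrightarrow>
        (\<integral>\<omega>. f (\<omega> t) \<partial>P x) = (\<integral>y. p x t y * f y \<partial>m) \<and>
        (\<integral>\<omega>. f (\<omega> t) \<partial>P' x) = (\<integral>y. p y t x * f y \<partial>m)) \<and>
     (\<forall>s>0. \<forall>t>0. \<forall>x y.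
        ennreal (p x (t + s) y) = (\<integral>\<^sup>+z. ennreal (p x t z * p z s y) \<partial>m))"

text \<open>\<open>\<mu>\<close> is the law on \<open>\<F>\<^sub>t\<^sub>-\<close> of the bridge of length \<open>t\<close> from \<open>x\<close> to \<open>y\<close>.\<close>

definition bridge_law ::
  "('a::topological_space \<Rightarrow> (real \<Rightarrow> 'a) measure) \<Rightarrow> ('a \<Rightarrow> real \<Rightarrow> 'a \<Rightarrow> real) \<Rightarrow>
   'a \<Rightarrow> real \<Rightarrow> 'a \<Rightarrow> (real \<Rightarrow> 'a) measure \<Rightarrow> bool"
where
  "bridge_law P p x t y \<mu> \<longleftrightarrow>
     prob_space \<mu> \<and> sets \<mu> = sets (path_sigma {0..<t}) \<and>
     (\<forall>s\<in>{0..<t}. \<forall>F\<in>borel_measurable (path_sigma {0..s}).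
        (\<integral>\<^sup>+\<omega>. F \<omega> \<partial>\<mu>) = (\<integral>\<^sup>+\<omega>. F \<omega> * ennreal (p (\<omega> s) (t - s) y / p x t y) \<partial>P x))"

lemma bridge_law_unique:
  fixes P :: "'a::topological_space \<Rightarrow> (real \<Rightarrow> 'a) measure"
  assumes "bridge_law P p x t y \<mu>" and "bridge_law P p x t y \<nu>" and "t > 0"
  shows "\<mu> = \<nu>"
proof -
  let ?E = "\<Union>s\<in>{0..<t}. sets (path_sigma {0..s} :: (real \<Rightarrow> 'a) measure)"
  have mu: "prob_space \<mu>" "sets \<mu> = sets (path_sigma {0..<t})"
    and nu: "sets \<nu> = sets (path_sigma {0..<t})"
    using assms(1,2) by (auto simp: bridge_law_def)
  have em: "emeasure \<mu> A = emeasure \<nu> A" if A: "A \<in> ?E" for A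
  proof -
    from A obtain s where s: "s \<in> {0..<t}" "A \<in> sets (path_sigma {0..s})" by blast
    have "sets (path_sigma {0..s} :: (real \<Rightarrow> 'a) measure) \<subseteq> sets (path_sigma {0..<t})"
      using s(1) by (intro sets_path_sigma_mono) auto
    then have AS: "A \<in> sets \<mu>" "A \<in> sets \<nu>" using s(2) mu(2) nu by auto
    have F: "(indicator A :: (real \<Rightarrow> 'a) \<Rightarrow> ennreal) \<in> borel_measurable (path_sigma {0..s})"
      using s(2) by simp
    have "(\<integral>\<^sup>+\<omega>. indicator A \<omega> \<partial>\<mu>) = (\<integral>\<^sup>+\<omega>. indicator A \<omega> \<partial>\<nu>)"
      using assms(1,2) s(1) F by (simp add: bridge_law_def)
    then show ?thesis using AS by simp
  qed
  have stable: "Int_stable ?E"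
  proof (rule Int_stableI)
    fix A B assume "A \<in> ?E" "B \<in> ?E"
    then obtain r s where rs: "r \<in> {0..<t}" "A \<in> sets (path_sigma {0..r})"
      "s \<in> {0..<t}" "B \<in> sets (path_sigma {0..s})" by blast
    have "A \<in> sets (path_sigma {0..max r s})" "B \<in> sets (path_sigma {0..max r s})"
      using rs sets_path_sigma_mono[of "{0..r}" "{0..max r s}"]
        sets_path_sigma_mono[of "{0..s}" "{0..max r s}"] by auto
    then show "A \<inter> B \<in> ?E" using rs by (intro UN_I[of "max r s"]) auto
  qed
  have gen: "sets (path_sigma {0..<t}) = sigma_sets cadlag_paths ?E"
  proof
    show "sets (path_sigma {0..<t}) \<subseteq> sigma_sets cadlag_paths ?E"
      unfolding sets_path_sigma[of "{0..<t}"]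
    proof (rule sigma_sets_mono', rule subsetI)
      fix X :: "(real \<Rightarrow> 'a) set"
      assume "X \<in> {{\<omega> \<in> cadlag_paths. \<omega> s \<in> A} | s A. s \<in> {0..<t} \<and> A \<in> sets borel}"
      then obtain s A where "X = {\<omega> \<in> cadlag_paths. \<omega> s \<in> A}" "s \<in> {0..<t}" "A \<in> sets borel"
        by blast
      then show "X \<in> ?E"
        by (intro UN_I[of s]) (auto simp: sets_path_sigma intro!: sigma_sets.Basic)
    qed
    have "?E \<subseteq> sets (path_sigma {0..<t})"
      by (intro UN_least sets_path_sigma_mono) auto
    then show "sigma_sets cadlag_paths ?E \<subseteq> sets (path_sigma {0..<t})"
      using sets.sigma_sets_subset[of ?E "path_sigma {0..<t}"] by simp
  qed
  show ?thesis
  proof (rule measure_eqI_generator_eq[OF stable, where \<Omega> = cadlag_paths and A = "\<lambda>_. cadlag_paths"])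
    show "?E \<subseteq> Pow cadlag_paths"
      using sets.sets_into_space[of _ "path_sigma _"] by fastforce
    show "range (\<lambda>_::nat. cadlag_paths) \<subseteq> ?E"
      using \<open>t > 0\<close> sets.top[of "path_sigma {0..0}"] by force
    show "emeasure \<mu> cadlag_paths \<noteq> \<infinity>"
      using mu(1) by (metis ennreal_top_neq_one prob_space.emeasure_space_1 mu(2) infinity_ennreal_def
          sets_eq_imp_space_eq space_path_sigma)
  qed (use em mu nu gen in auto)
qed

definition finely_continuous ::
  "('a::topological_space \<Rightarrow> (real \<Rightarrow> 'a) measure) \<Rightarrow> ('a \<Rightarrow> real) \<Rightarrow> bool" where
  "finely_continuous P f \<longleftrightarrow>
     (\<forall>x. AE \<omega> in P x. \<forall>t\<ge>0. ((\<lambda>s. f (\<omega> s)) \<longlongrightarrow> f (\<omega> t)) (at_right t))"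

definition equivalent_measures :: "'b measure \<Rightarrow> 'b measure \<Rightarrow> bool" where
  "equivalent_measures M N \<longleftrightarrow> absolutely_continuous M N \<and> absolutely_continuous N M"

end

theory Submission
  imports Defs
begin

text \<open>
  Equality of the diagonal bridges of length \<open>t0\<close> says that on \<open>\<F>\<^sub>s\<close>, \<open>s < t0\<close>, the law \<open>Q\<^sup>x\<close>
  has a density \<open>r\<^sub>s(x, X\<^sub>s)\<close> with respect to \<open>P\<^sup>x\<close>. Comparing the two-time laws of both processes
  shows that \<open>r\<^bsub>s+u\<^esub>(x, z)\<close> splits into factors depending on \<open>x\<close>, on \<open>(s, u)\<close> and on \<open>z\<close> alone: two
  functions of different variables which agree almost everywhere are constant. This yields \<open>\<psi>\<close>
  with \<open>Q\<^sub>t f = b(t) P\<^sub>t(\<psi> f) / \<psi>\<close>, where \<open>b\<close> is measurable and multiplicative, hence exponential.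
  The explicit form of \<open>r\<close> then gives \<open>q\<^sub>t(x, y) = e\<^sup>-\<^sup>c\<^sup>t p\<^sub>t(x, y) / (\<psi>(x) \<psi>'(y))\<close> for almost all \<open>x\<close>,
  and the Chapman-Kolmogorov equations remove the exceptional sets. The dual semigroups, the
  measures and the bridges are read off from this identity.

  For the fine continuity of \<open>\<psi>\<close> suppose that the martingale \<open>e\<^sup>-\<^sup>c\<^sup>t \<psi>(X\<^sub>t)\<close> jumps with positive
  probability between its value at some \<open>t\<close> and its values at rationals decreasing to \<open>t\<close>. Measurable
  selection and closed regularity reduce this to times with \<open>X\<^sub>t\<close> in a closed set; there a stopping
  time exhibits the jump, against the strong Markov property.
\<close>

section \<open>Measurable selection\<close>

text \<open>Almost every identity drawn from the bridges carries an exceptional null set that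
  depends on the starting point. Ratios are therefore compared with those of one reference point
  \<open>undefined\<close>, the values \<open>\<phi> x\<close> are picked by choice for each x, and
  measurability is recovered afterwards by integrating out the second variable.

  In the argument for fine continuity, the paths with a bad time form a projection along uncountably
  many times, and such a set need not be measurable. Writing measurable sets as results of the
  Suslin operation allows bad times to be selected up to a null set. A selected time need not be a
  stopping time; it only carries mass to the state space, where a closed set receiving some of it is
  found. Closedness lets right-continuity of the path conclude that a limit from the right of times
  spent near the set is spent in the set, so a stopping time at a bad time exists. Optional stopping
  is used at rational times, because right-continuity of \<open>\<psi> (\<omega> t)\<close> in t is
  what has to be shown.\<close>

definition suslin :: "'a set set \<Rightarrow> 'a set set" where
  "suslin \<C> = {A. \<exists>C::nat list \<Rightarrow> 'a set.
     range C \<subseteq> \<C> \<and> A = {x. \<exists>\<sigma>::nat \<Rightarrow> nat. \<forall>k. x \<in> C (map \<sigma> [0..<k])}}"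

lemma suslin_basic: "A \<in> \<C> \<Longrightarrow> A \<in> suslin \<C>"
  unfolding suslin_def by (intro CollectI exI[of _ "\<lambda>_. A"]) auto

lemma forall_nat_split: "(\<forall>k. P k) \<longleftrightarrow> P 0 \<and> (\<forall>k. P (Suc k))"
  using not0_implies_Suc by metis

text \<open>The first entry of a branch names the set, and the remaining entries form a branch of
  the scheme of that set. The root of the joint scheme must contain every \<open>A n\<close>, whence
  the common superset \<open>S\<close> in the class.\<close>

lemma suslin_UN:
  fixes A :: "nat \<Rightarrow> 'a set"
  assumes A: "\<And>n. A n \<in> suslin \<C>" and S: "S \<in> \<C>" and AS: "\<And>n. A n \<subseteq> S"
  shows "(\<Union>n. A n) \<in> suslin \<C>"
proof -
  have "\<exists>C. \<forall>n. range (C n :: nat list \<Rightarrow> 'a set) \<subseteq> \<C> \<and>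
      A n = {x. \<exists>\<sigma>::nat \<Rightarrow> nat. \<forall>k. x \<in> C n (map \<sigma> [0..<k])}"
    using A unfolding suslin_def by (intro choice) auto
  then obtain C where "\<forall>n. range (C n :: nat list \<Rightarrow> 'a set) \<subseteq> \<C> \<and>
      A n = {x. \<exists>\<sigma>::nat \<Rightarrow> nat. \<forall>k. x \<in> C n (map \<sigma> [0..<k])}" ..
  then have C: "C n s \<in> \<C>"
    "A n = {x. \<exists>\<sigma>::nat \<Rightarrow> nat. \<forall>k. x \<in> C n (map \<sigma> [0..<k])}" for n s
    by (auto simp: image_subset_iff)
  define D where "D s = (case s of [] \<Rightarrow> S | n # s' \<Rightarrow> C n s')" for s
  have "(\<forall>k. x \<in> D (map \<sigma> [0..<k])) \<longleftrightarrow> x \<in> S \<and> (\<forall>k. x \<in> C (\<sigma> 0) (map (\<lambda>i. \<sigma> (Suc i)) [0..<k]))"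
    for x and \<sigma> :: "nat \<Rightarrow> nat"
  proof -
    have "(\<forall>k. x \<in> D (map \<sigma> [0..<k])) \<longleftrightarrow>
        x \<in> D (map \<sigma> [0..<0]) \<and> (\<forall>k. x \<in> D (map \<sigma> [0..<Suc k]))"
      by (rule forall_nat_split)
    then show ?thesis
      unfolding map_upt_Suc by (simp add: D_def)
  qed
  then have eq: "{x. \<exists>\<sigma>. \<forall>k. x \<in> D (map \<sigma> [0..<k])} =
      {x\<in>S. \<exists>\<sigma>::nat \<Rightarrow> nat. \<forall>k. x \<in> C (\<sigma> 0) (map (\<lambda>i. \<sigma> (Suc i)) [0..<k])}"
    by auto
  have "(\<Union>n. A n) = {x\<in>S. \<exists>\<sigma>::nat \<Rightarrow> nat. \<forall>k. x \<in> C (\<sigma> 0) (map (\<lambda>i. \<sigma> (Suc i)) [0..<k])}"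
  proof safe
    fix x n assume x: "x \<in> A n"
    then show "x \<in> S" using AS by auto
    from x obtain \<sigma> :: "nat \<Rightarrow> nat" where "\<forall>k. x \<in> C n (map \<sigma> [0..<k])"
      using C(2)[of n] by auto
    then show "\<exists>\<sigma>. \<forall>k. x \<in> C (\<sigma> 0) (map (\<lambda>i. \<sigma> (Suc i)) [0..<k])"
      by (intro exI[of _ "case_nat n \<sigma>"]) auto
  next
    fix x and \<sigma> :: "nat \<Rightarrow> nat"
    assume "\<forall>k. x \<in> C (\<sigma> 0) (map (\<lambda>i. \<sigma> (Suc i)) [0..<k])"
    then have "x \<in> A (\<sigma> 0)" using C(2)[of "\<sigma> 0"] by auto
    then show "x \<in> (\<Union>n. A n)" by auto
  qed
  with eq have "(\<Union>n. A n) = {x. \<exists>\<sigma>. \<forall>k. x \<in> D (map \<sigma> [0..<k])}" by simp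
  moreover have "range D \<subseteq> \<C>"
    using C(1) S by (auto simp: D_def split: list.split)
  ultimately show ?thesis unfolding suslin_def by blast
qed

text \<open>Guarantees that a prefix of length \<open>prod_encode (n, j)\<close> already contains
  the first j terms of the n-th coded sequence, whose positions are
  \<open>prod_encode (n, i)\<close> for i < j.\<close>

lemma strict_mono_prod_encode: "i < j \<Longrightarrow> prod_encode (n, i) < prod_encode (n, j)"
proof (induction j rule: less_Suc_induct)
  case (1 i) then show ?case by (simp add: prod_encode_def)
qed simp

lemma suslin_INT:
  fixes A :: "nat \<Rightarrow> 'a set"
  assumes A: "\<And>n. A n \<in> suslin \<C>"
  shows "(\<Inter>n. A n) \<in> suslin \<C>"
proof -
  have "\<exists>C. \<forall>n. range (C n :: nat list \<Rightarrow> 'a set) \<subseteq> \<C> \<and>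
      A n = {x. \<exists>\<sigma>::nat \<Rightarrow> nat. \<forall>k. x \<in> C n (map \<sigma> [0..<k])}"
    using A unfolding suslin_def by (intro choice) auto
  then obtain C where "\<forall>n. range (C n :: nat list \<Rightarrow> 'a set) \<subseteq> \<C> \<and>
      A n = {x. \<exists>\<sigma>::nat \<Rightarrow> nat. \<forall>k. x \<in> C n (map \<sigma> [0..<k])}" ..
  then have C: "C n s \<in> \<C>"
    "A n = {x. \<exists>\<sigma>::nat \<Rightarrow> nat. \<forall>k. x \<in> C n (map \<sigma> [0..<k])}" for n s
    by (auto simp: image_subset_iff)
  \<comment> \<open>One sequence codes countably many: the \<open>n\<close>-th one is \<open>i \<mapsto> \<sigma> (prod_encode (n, i))\<close>.\<close>
  define D where "D s = (case prod_decode (length s) of (n, j) \<Rightarrow>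
      C n (map (\<lambda>i. s ! prod_encode (n, i)) [0..<j]))" for s
  have D: "D (map \<sigma> [0..<prod_encode (n, j)]) = C n (map (\<lambda>i. \<sigma> (prod_encode (n, i))) [0..<j])"
    for \<sigma> n j
    using strict_mono_prod_encode by (auto simp: D_def intro!: arg_cong[where f="C n"])
  \<comment> \<open>Every length k is \<open>prod_encode (n, j)\<close> for exactly one pair, so
    running over the prefixes of one sequence means running over the prefixes of all coded
    ones.\<close>
  have D': "(\<forall>k. x \<in> D (map \<sigma> [0..<k])) \<longleftrightarrow>
      (\<forall>n j. x \<in> C n (map (\<lambda>i. \<sigma> (prod_encode (n, i))) [0..<j]))" for x \<sigma>
  proof (intro iffI allI)
    fix k assume "\<forall>n j. x \<in> C n (map (\<lambda>i. \<sigma> (prod_encode (n, i))) [0..<j])"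
    then show "x \<in> D (map \<sigma> [0..<k])"
      unfolding D[symmetric] using prod_decode_inverse[of k] by (cases "prod_decode k") auto
  qed (simp add: D[symmetric])
  have "(\<Inter>n. A n) = {x. \<exists>\<sigma>. \<forall>k. x \<in> D (map \<sigma> [0..<k])}"
  proof safe
    fix x assume "x \<in> (\<Inter>n. A n)"
    then have "\<forall>n. \<exists>\<sigma>::nat \<Rightarrow> nat. \<forall>k. x \<in> C n (map \<sigma> [0..<k])"
      using C(2) by auto
    then obtain \<tau> where \<tau>: "\<And>n k. x \<in> C n (map (\<tau> n) [0..<k])" by metis
    define \<sigma> where "\<sigma> m = case_prod \<tau> (prod_decode m)" for m
    have "\<forall>k. x \<in> D (map \<sigma> [0..<k])"
      unfolding D' using \<tau> by (simp add: \<sigma>_def)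
    then show "\<exists>\<sigma>. \<forall>k. x \<in> D (map \<sigma> [0..<k])" by blast
  next
    fix x \<sigma> n assume "\<forall>k. x \<in> D (map \<sigma> [0..<k])"
    then show "x \<in> A n" using C(2)[of n] unfolding D' by auto
  qed
  moreover have "range D \<subseteq> \<C>"
    using C(1) by (auto simp: D_def split: prod.split)
  ultimately show ?thesis unfolding suslin_def by blast
qed

text \<open>The Suslin operation does not preserve complements, so the induction carries a set
  together with its complement; for a union, the complement is an intersection and
  \<open>suslin_INT\<close> applies.\<close>

lemma sigma_sets_subset_suslin:
  assumes \<C>: "\<C> \<subseteq> Pow S" "S \<in> \<C>" and compl: "\<And>A. A \<in> \<C> \<Longrightarrow> S - A \<in> suslin \<C>"
    and A: "A \<in> sigma_sets S \<C>"
  shows "A \<in> suslin \<C>"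
proof -
  have "A \<subseteq> S \<and> A \<in> suslin \<C> \<and> S - A \<in> suslin \<C>"
    using A
  proof induction
    case (Basic a)
    then show ?case using suslin_basic compl \<C> by auto
  next
    case Empty
    then show ?case using compl[OF \<C>(2)] suslin_basic[OF \<C>(2)] by simp
  next
    case (Compl a)
    then have "S - (S - a) = a" by auto
    with Compl show ?case by auto
  next
    case (Union a)
    then have "S - (\<Union>i. a i) = (\<Inter>i. S - a i)" by auto
    with Union show ?case
      using suslin_UN[of a \<C> S] suslin_INT[of "\<lambda>i. S - a i" \<C>] \<C>(2) by auto
  qed
  then show ?thesis by simp
qed

section \<open>Measurable subsets of a time strip as Suslin sets\<close>

abbreviation strip_rectangles :: "real \<Rightarrow> 'w measure \<Rightarrow> (real \<times> 'w) set set" where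
  "strip_rectangles N M \<equiv> {({c..d} \<inter> {0..N}) \<times> B | c d B. B \<in> sets M}"

text \<open>The complement of a rectangle in the strip consists of times before c, times after d and
  points outside B. Each piece is a countable union of rectangles whose time side is compact, and
  this compactness is what the selection relies on.\<close>

lemma measurable_strip_suslin:
  fixes A :: "(real \<times> 'w) set"
  assumes A: "A \<in> sets (borel \<Otimes>\<^sub>M M)" "A \<subseteq> {0..N} \<times> space M"
  shows "A \<in> suslin (strip_rectangles N M)"
proof -
  let ?C = "strip_rectangles N M" and ?S = "{0..N} \<times> space M"
  have sub: "?C \<subseteq> Pow ?S" using sets.sets_into_space by blast
  have rect: "({c..d} \<inter> {0..N}) \<times> B \<in> ?C" if "B \<in> sets M" for c d B using that by blast
  have S: "?S \<in> ?C" using rect[of "space M" 0 N] by simp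
  have compl: "?S - R \<in> suslin ?C" if "R \<in> ?C" for R
  proof -
    from that obtain c d B where R: "R = ({c..d} \<inter> {0..N}) \<times> B" and B: "B \<in> sets M" by blast
    \<comment> \<open>The strict inequality t < c becomes a countable union of closed conditions,
      cutting off 1 / (n + 1); likewise for t > d.\<close>
    define l where "l n = ({0..c - 1 / real (Suc n)} \<inter> {0..N}) \<times> space M" for n
    define r where "r n = ({d + 1 / real (Suc n)..N} \<inter> {0..N}) \<times> space M" for n
    define o' where "o' = ({0..N} \<inter> {0..N}) \<times> (space M - B)"
    have C: "l n \<in> ?C" "r n \<in> ?C" "o' \<in> ?C" for n
      unfolding l_def r_def o'_def by (rule rect, use B in simp)+
    have lt: "(\<exists>n. a \<le> b - 1 / real (Suc n)) \<longleftrightarrow> a < b" for a b :: real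
    proof
      assume "a < b"
      then obtain n where "1 / real (Suc n) < b - a"
        using nat_approx_posE[of "b - a"] by auto
      then show "\<exists>n. a \<le> b - 1 / real (Suc n)" by (intro exI[of _ n]) simp
    next
      assume "\<exists>n. a \<le> b - 1 / real (Suc n)"
      then obtain n where "a \<le> b - 1 / real (Suc n)" by blast
      then show "a < b"
        by (smt (verit) divide_pos_pos of_nat_0_less_iff zero_less_Suc)
    qed
    have L: "x \<in> (\<Union>n. l n) \<longleftrightarrow> x \<in> ?S \<and> fst x < c" for x
      using lt[of "fst x" c] by (cases x) (auto simp: l_def)
    have Rr: "x \<in> (\<Union>n. r n) \<longleftrightarrow> x \<in> ?S \<and> d < fst x" for x
      using lt[of d "fst x"] by (cases x) (auto simp: r_def algebra_simps)
    have "?S - R = (\<Union>n. l n) \<union> (\<Union>n. r n) \<union> o'"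
    proof (intro set_eqI)
      fix x show "x \<in> ?S - R \<longleftrightarrow> x \<in> (\<Union>n. l n) \<union> (\<Union>n. r n) \<union> o'"
        unfolding Un_iff L Rr using sets.sets_into_space[OF B]
        by (cases x) (auto simp: R o'_def)
    qed
    also have "\<dots> = (\<Union>n. l n \<union> r n \<union> o')" by auto
    \<comment> \<open>All indices above 1 repeat \<open>o'\<close>, which turns the three sets into
      a sequence as \<open>suslin_UN\<close> expects.\<close>
    also have "\<dots> = (\<Union>n. \<Union>k. if k = 0 then l n else if k = (1::nat) then r n else o')"
      by (auto split: if_splits)
    also have "\<dots> \<in> suslin ?C"
    proof (intro suslin_UN[where S="?S"])
      show "?S \<in> ?C" by (rule S)
      show "?S \<in> ?C" by (rule S)
      show "(if k = 0 then l n else if k = (1::nat) then r n else o') \<in> suslin ?C" for n k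
        using C by (auto intro: suslin_basic)
      show "(if k = 0 then l n else if k = (1::nat) then r n else o') \<subseteq> ?S" for n k
        by (auto simp: l_def r_def o'_def)
      then show "(\<Union>k. if k = 0 then l n else if k = (1::nat) then r n else o') \<subseteq> ?S" for n
        by blast
    qed
    finally show ?thesis .
  qed
  interpret S: sigma_algebra ?S "sigma_sets ?S ?C"
    using sub by (rule sigma_algebra_sigma_sets)
  have strip: "(a \<inter> {0..N}) \<times> b \<in> sigma_sets ?S ?C"
    if a: "a \<in> sets (borel :: real measure)" and b: "b \<in> sets M" for a b
  proof -
    have "a \<in> sigma_sets UNIV (range (\<lambda>(a, b). {a..b::real}))"
      using a by (simp add: borel_eq_atLeastAtMost)
    then show ?thesis
    proof induction
      case (Basic a) then show ?case using b rect by (auto intro!: sigma_sets.Basic)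
    next
      case Empty then show ?case by (simp only: Int_empty_left Sigma_empty1 S.empty_sets)
    next
      case (Compl a)
      have "({0..N} \<inter> {0..N}) \<times> b - (a \<inter> {0..N}) \<times> b \<in> sigma_sets ?S ?C"
        using Compl b rect[of b 0 N] by (intro S.Diff) (auto intro: sigma_sets.Basic)
      also have "({0..N} \<inter> {0..N}) \<times> b - (a \<inter> {0..N}) \<times> b = ((UNIV - a) \<inter> {0..N}) \<times> b" by auto
      finally show ?case .
    next
      case (Union a)
      have "(\<Union>i. (a i \<inter> {0..N}) \<times> b) \<in> sigma_sets ?S ?C" using Union by blast
      also have "(\<Union>i. (a i \<inter> {0..N}) \<times> b) = ((\<Union>i. a i) \<inter> {0..N}) \<times> b" by auto
      finally show ?case .
    qed
  qed
  have "A \<inter> ?S \<in> sigma_sets ?S ?C"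
    using A(1) unfolding sets_pair_measure
  proof induction
    case (Basic x)
    then obtain a b where x: "x = a \<times> b" and ab: "a \<in> sets borel" "b \<in> sets M" by blast
    have "x \<inter> ?S = (a \<inter> {0..N}) \<times> b" using sets.sets_into_space[OF ab(2)] by (auto simp: x)
    with strip[OF ab] show ?case by simp
  next
    case Empty then show ?case by (simp only: Int_empty_left S.empty_sets)
  next
    case (Compl a)
    have "?S - (a \<inter> ?S) \<in> sigma_sets ?S ?C" by (rule S.Diff[OF S.top Compl.IH])
    also have "?S - (a \<inter> ?S) = (space borel \<times> space M - a) \<inter> ?S" by auto
    finally show ?case .
  next
    case (Union a)
    have "(\<Union>i. a i \<inter> ?S) \<in> sigma_sets ?S ?C" using Union by blast
    also have "(\<Union>i. a i \<inter> ?S) = (\<Union>i. a i) \<inter> ?S" by auto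
    finally show ?case .
  qed
  then have "A \<in> sigma_sets ?S ?C" using A(2) by (simp add: Int_absorb2)
  with sub S compl show ?thesis by (rule sigma_sets_subset_suslin)
qed

text \<open>
  Along the branch \<open>s k \<omega>\<close> the envelopes are chosen so that all the finite intersections of the
  intervals of the scheme are nonempty over \<open>\<omega>\<close>; the supremum of their left endpoints is the selection.
\<close>

theorem measurable_selection:
  fixes A :: "(real \<times> 'w) set" and M :: "'w measure"
  assumes M: "finite_measure M"
    and A: "A \<in> sets (borel \<Otimes>\<^sub>M M)" "A \<subseteq> {0..N} \<times> space M"
  obtains T G Z where "T \<in> borel_measurable M" "G \<in> sets M" "\<And>\<omega>. \<omega> \<in> G \<Longrightarrow> (T \<omega>, \<omega>) \<in> A"
    "Z \<in> null_sets M" "snd ` A \<subseteq> G \<union> Z"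
proof -
  interpret finite_measure M by fact
  obtain C where C: "\<And>s. C s \<in> strip_rectangles N M"
    and AC: "A = {x. \<exists>\<sigma>::nat \<Rightarrow> nat. \<forall>k. x \<in> C (map \<sigma> [0..<k])}"
    using measurable_strip_suslin[OF A] unfolding suslin_def by (auto simp: image_subset_iff)
  have "\<exists>c d B. C s = ({c..d} \<inter> {0..N}) \<times> B \<and> B \<in> sets M" for s
    using C[of s] by blast
  then obtain c d B where CB: "\<And>s. C s = ({c s..d s} \<inter> {0..N}) \<times> B s" and B: "\<And>s. B s \<in> sets M"
    by metis
  \<comment> \<open>Clipping to [0, N] keeps the supremum \<open>T\<close> well defined even along a
    branch whose intervals do not meet.\<close>
  define l where "l s = max 0 (min N (c s))" for s
  \<comment> \<open>The points above which some branch extending \<open>s\<close> has a time in all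
    its sets: a projection, hence possibly not measurable.\<close>
  define H where "H s = {\<omega>. \<exists>t \<sigma>. map \<sigma> [0..<length s] = s \<and> (\<forall>k. (t, \<omega>) \<in> C (map \<sigma> [0..<k]))}" for s
  have H_sub: "H s \<subseteq> space M" for s
    using B sets.sets_into_space by (fastforce simp: H_def CB)
  have H_Nil: "H [] = snd ` A" by (force simp: H_def AC)
  have H_step: "H s \<subseteq> (\<Union>n. H (s @ [n]))" for s
  proof
    fix \<omega> assume "\<omega> \<in> H s"
    then obtain t \<sigma> where "map \<sigma> [0..<length s] = s" "\<forall>k. (t, \<omega>) \<in> C (map \<sigma> [0..<k])"
      unfolding H_def by blast
    then have "\<omega> \<in> H (s @ [\<sigma> (length s)])"
      unfolding H_def by (intro CollectI exI[of _ t] exI[of _ \<sigma>]) simp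
    then show "\<omega> \<in> (\<Union>n. H (s @ [n]))" by blast
  qed
  \<comment> \<open>The outer measure is attained by a measurable cover, and finiteness of the
    measure makes such a cover minimal up to null sets.\<close>
  have "\<exists>E. measurable_envelope M (H s) E" for s
  proof -
    obtain E where "E \<in> sets M" "H s \<subseteq> E" "outer_measure_of M (H s) = emeasure M E"
      using outer_measure_of_attain[OF H_sub] by metis
    moreover have "emeasure M E < \<infinity>"
      using emeasure_finite[of E] by (metis infinity_ennreal_def top.not_eq_extremum)
    ultimately show ?thesis
      using measurable_envelope_eq2[of "H s" E M] by auto
  qed
  then obtain E where E: "\<And>s. measurable_envelope M (H s) (E s)" by metis
  note Emeas[measurable] = measurable_envelopeD(2)[OF E] and HE = measurable_envelopeD(1)[OF E]
  \<comment> \<open>Whether the intervals along \<open>s\<close> have a common point does not depend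
    on \<omega>. So this is a measurable superset of \<open>H s\<close>, and membership in it says
    that these intervals do meet.\<close>
  define D where "D s = (if \<exists>t\<in>{0..N}. \<forall>j\<le>length s. t \<in> {c (take j s)..d (take j s)}
      then \<Inter>j\<in>{..length s}. B (take j s) else {})" for s
  have Dmeas[measurable]: "D s \<in> sets M" for s
    unfolding D_def using B by (auto intro!: sets.finite_INT)
  have HD: "H s \<subseteq> D s" for s
  proof
    fix \<omega> assume "\<omega> \<in> H s"
    then obtain t \<sigma> where s: "map \<sigma> [0..<length s] = s" and t: "\<And>k. (t, \<omega>) \<in> C (map \<sigma> [0..<k])"
      unfolding H_def by blast
    have "(t, \<omega>) \<in> C (take j s)" if "j \<le> length s" for j
    proof -
      have "take j s = map \<sigma> (take j [0..<length s])" using s by (metis take_map)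
      then have "take j s = map \<sigma> [0..<j]" using that by simp
      with t show ?thesis by simp
    qed
    then have in_C: "t \<in> {c (take j s)..d (take j s)} \<and> \<omega> \<in> B (take j s)" if "j \<le> length s" for j
      using that by (auto simp: CB)
    moreover have "t \<in> {0..N}" using t[of 0] by (auto simp: CB)
    ultimately have "\<exists>t\<in>{0..N}. \<forall>j\<le>length s. t \<in> {c (take j s)..d (take j s)}" by blast
    with in_C show "\<omega> \<in> D s" by (auto simp: D_def)
  qed
  \<comment> \<open>An envelope of \<open>H s\<close> minus any measurable superset of
    \<open>H s\<close> is null. The union of the child envelopes and \<open>D s\<close> are such
    supersets, and there are countably many lists.\<close>
  define Z where "Z = (\<Union>s. (E s - (\<Union>n. E (s @ [n]))) \<union> (E s - D s))"
  have "E s - (\<Union>n. E (s @ [n])) \<in> null_sets M" for s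
  proof (rule null_setsI)
    show "emeasure M (E s - (\<Union>n. E (s @ [n]))) = 0"
      using HE H_step by (intro measurable_envelopeD1[OF E[of s]]) fastforce+
  qed measurable
  moreover have "E s - D s \<in> null_sets M" for s
  proof (rule null_setsI)
    show "emeasure M (E s - D s) = 0"
      using HD by (intro measurable_envelopeD1[OF E[of s]]) auto
  qed measurable
  ultimately have Z: "Z \<in> null_sets M" unfolding Z_def by blast
  \<comment> \<open>Greedy descent: off \<open>Z\<close>, a point of an envelope lies in the
    envelope of some child, and taking the least such child keeps the branch measurable.\<close>
  define s where "s = rec_nat (\<lambda>_. []) (\<lambda>k r \<omega>. r \<omega> @ [LEAST n. \<omega> \<in> E (r \<omega> @ [n])])"
  have s0: "s 0 \<omega> = []" and sSuc: "s (Suc k) \<omega> = s k \<omega> @ [LEAST n. \<omega> \<in> E (s k \<omega> @ [n])]" for k \<omega>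
    by (simp_all add: s_def)
  have smeas[measurable]: "s k \<in> M \<rightarrow>\<^sub>M count_space UNIV" for k
  proof (induction k)
    case 0 then show ?case by (simp add: s0[abs_def] cong: measurable_cong)
  next
    case (Suc k)
    note Suc[measurable]
    have "(\<lambda>\<omega>. r @ [LEAST n. \<omega> \<in> E (r @ [n])]) \<in> M \<rightarrow>\<^sub>M count_space UNIV" for r
      by measurable
    then have "(\<lambda>\<omega>. (\<lambda>r \<omega>. r @ [LEAST n. \<omega> \<in> E (r @ [n])]) (s k \<omega>) \<omega>) \<in> M \<rightarrow>\<^sub>M count_space UNIV"
      by (rule measurable_compose_countable[OF _ Suc])
    then show ?case by (simp add: sSuc cong: measurable_cong)
  qed
  have len: "length (s k \<omega>) = k" for k \<omega> by (induction k) (auto simp: s0 sSuc)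
  have take_s: "take j (s k \<omega>) = s j \<omega>" if "j \<le> k" for j k \<omega>
    using that by (induction k) (auto simp: s0 sSuc len le_Suc_eq)
  define T where "T \<omega> = (SUP k. l (s k \<omega>))" for \<omega>
  have N: "A = {}" if "N < 0" using that A(2) by auto
  show thesis
  proof (cases "N < 0")
    case True
    show thesis by (rule that[of "\<lambda>_. 0" "{}" "{}"]) (auto simp: N[OF True])
  next
    case False
    have bdd: "bdd_above (range (\<lambda>k. l (s k \<omega>)))" for \<omega>
      using False by (auto simp: l_def bdd_above_def intro!: exI[of _ N])
    have Tmeas: "T \<in> borel_measurable M"
    proof -
      have "(\<lambda>\<omega>. l (s k \<omega>)) \<in> borel_measurable M" for k
        by (rule measurable_compose[OF smeas]) simp
      then have "(\<lambda>\<omega>. SUP k\<in>UNIV. l (s k \<omega>)) \<in> borel_measurable M"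
        by (intro borel_measurable_cSUP) (use bdd in auto)
      then show ?thesis by (simp add: T_def[abs_def])
    qed
    have sel: "(T \<omega>, \<omega>) \<in> A" if \<omega>: "\<omega> \<in> E [] - Z" for \<omega>
    proof -
      have inE: "\<omega> \<in> E (s k \<omega>)" for k
      proof (induction k)
        case 0 then show ?case using \<omega> by (simp add: s0)
      next
        case (Suc k)
        then have "\<exists>n. \<omega> \<in> E (s k \<omega> @ [n])" using \<omega> unfolding Z_def by blast
        then show ?case unfolding sSuc by (rule LeastI_ex)
      qed
      then have D: "\<omega> \<in> D (s k \<omega>)" for k using \<omega> unfolding Z_def by blast
      have fin: "\<exists>t\<in>{0..N}. \<forall>j\<le>k. t \<in> {c (s j \<omega>)..d (s j \<omega>)}" for k
        using D[of k] unfolding D_def by (auto simp: len take_s split: if_splits)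
      have inB: "\<omega> \<in> B (s k \<omega>)" for k
        using D[of k] unfolding D_def by (auto simp: len take_s split: if_splits)
      \<comment> \<open>At depth \<open>max i j\<close> the intervals of both stages share a point
        of [0, N], so every left endpoint is below every right endpoint, and the supremum of the
        left ones lies in all intervals.\<close>
      have "l (s i \<omega>) \<le> min N (d (s j \<omega>)) \<and> c (s i \<omega>) \<le> l (s i \<omega>)" for i j
      proof -
        obtain t where "t \<in> {0..N}" "\<forall>k\<le>max i j. t \<in> {c (s k \<omega>)..d (s k \<omega>)}"
          using fin by blast
        then have "t \<in> {0..N}" "t \<in> {c (s i \<omega>)..d (s i \<omega>)}" "t \<in> {c (s j \<omega>)..d (s j \<omega>)}"
          by (auto simp: max_def)
        then show ?thesis by (auto simp: l_def)
      qed
      then have T1: "T \<omega> \<le> min N (d (s j \<omega>))" and cl: "c (s j \<omega>) \<le> l (s j \<omega>)" for j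
        unfolding T_def by (auto intro!: cSUP_least)
      have T2: "l (s j \<omega>) \<le> T \<omega>" for j
        unfolding T_def by (rule cSUP_upper[OF _ bdd]) simp
      have inC: "(T \<omega>, \<omega>) \<in> C (s k \<omega>)" for k
        using T1[of k] T2[of k] cl[of k] inB[of k] unfolding CB by (auto simp: l_def)
      have "map (\<lambda>i. s (Suc i) \<omega> ! i) [0..<k] = s k \<omega>" for k
      proof (induction k)
        case (Suc k)
        then show ?case by (simp add: sSuc[of k] nth_append len)
      qed (simp add: s0)
      then show ?thesis unfolding AC using inC by (intro CollectI exI[of _ "\<lambda>i. s (Suc i) \<omega> ! i"]) simp
    qed
    show thesis
    proof (rule that[OF Tmeas _ sel Z])
      show "E [] - Z \<in> sets M" using Z by auto
      show "snd ` A \<subseteq> (E [] - Z) \<union> Z" using HE[of "[]"] H_Nil by auto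
    qed
  qed
qed

section \<open>Measurability on the path space\<close>

lemma measurable_coordinate [measurable]: "s \<in> I \<Longrightarrow> (\<lambda>\<omega>. \<omega> s) \<in> path_sigma I \<rightarrow>\<^sub>M borel"
proof (rule measurableI)
  fix A :: "'a set" assume s: "s \<in> I" and A: "A \<in> sets borel"
  have "(\<lambda>\<omega>. \<omega> s) -` A \<inter> space (path_sigma I) = {\<omega> \<in> cadlag_paths. \<omega> s \<in> A}" by auto
  then show "(\<lambda>\<omega>. \<omega> s) -` A \<inter> space (path_sigma I) \<in> sets (path_sigma I)"
    unfolding sets_path_sigma using s A by (auto intro: sigma_sets.Basic)
qed simp

lemma measurable_into_path_sigma:
  fixes f :: "'w \<Rightarrow> real \<Rightarrow> 'a::topological_space"
  assumes "\<And>x. x \<in> space M \<Longrightarrow> f x \<in> cadlag_paths"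
    and "\<And>s. s \<in> I \<Longrightarrow> (\<lambda>x. f x s) \<in> M \<rightarrow>\<^sub>M borel"
  shows "f \<in> M \<rightarrow>\<^sub>M path_sigma I"
  unfolding path_sigma_def
proof (rule measurable_measure_of)
  fix y :: "(real \<Rightarrow> 'a) set"
  assume "y \<in> {{\<omega> \<in> cadlag_paths. \<omega> s \<in> A} | s A. s \<in> I \<and> A \<in> sets borel}"
  then obtain s A where y: "y = {\<omega> \<in> cadlag_paths. \<omega> s \<in> A}" "s \<in> I" "A \<in> sets borel" by blast
  have "f -` y \<inter> space M = (\<lambda>x. f x s) -` A \<inter> space M" using assms(1) y(1) by auto
  then show "f -` y \<inter> space M \<in> sets M" using assms(2) y by (auto intro: measurable_sets)
qed (use assms(1) in auto)

lemma shift_cadlag: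
  assumes "\<omega> \<in> cadlag_paths" "0 \<le> t"
  shows "shift t \<omega> \<in> cadlag_paths"
proof -
  have left_limit: "\<exists>l. (\<omega> \<longlongrightarrow> l) (at_left u)" if "u > 0" for u
    using assms(1) that by (simp add: cadlag_paths_def)
  have r: "(shift t \<omega> \<longlongrightarrow> shift t \<omega> s) (at_right s)" if "s \<ge> 0" for s
  proof -
    have "(\<omega> \<longlongrightarrow> \<omega> (s + t)) (at_right (s + t))"
      using assms that by (auto simp: cadlag_paths_def)
    then have "((\<lambda>s. \<omega> (s + t)) \<longlongrightarrow> \<omega> (s + t)) (at_right s)"
      unfolding filterlim_at_right_to_0[of _ _ "s + t"] filterlim_at_right_to_0[of _ _ s]
      by (simp add: algebra_simps)
    moreover have "\<forall>\<^sub>F u in at_right s. \<omega> (u + t) = shift t \<omega> u"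
      using that by (auto simp: eventually_at_right_field shift_def algebra_simps intro!: exI[of _
          "s + 1"])
    ultimately have "(shift t \<omega> \<longlongrightarrow> \<omega> (s + t)) (at_right s)"
      by (rule Lim_transform_eventually)
    then show ?thesis using that by (simp add: shift_def algebra_simps)
  qed
  have l: "\<exists>l. (shift t \<omega> \<longlongrightarrow> l) (at_left s)" if "s > 0" for s
  proof -
    have "s + t > 0" using that assms(2) by simp
    then obtain l where "(\<omega> \<longlongrightarrow> l) (at_left (s + t))" using left_limit by blast
    then have "((\<lambda>s. \<omega> (s + t)) \<longlongrightarrow> l) (at_left s)"
      unfolding filterlim_at_left_to_right[of _ _ "s + t"] filterlim_at_left_to_right[of _ _ s]
        filterlim_at_right_to_0[of _ _ "- (s + t)"] filterlim_at_right_to_0[of _ _ "- s"]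
      by (simp add: algebra_simps)
    moreover have "\<forall>\<^sub>F u in at_left s. \<omega> (u + t) = shift t \<omega> u"
      using that by (auto simp: eventually_at_left_field shift_def algebra_simps intro!: exI[of _ 0])
    ultimately have "(shift t \<omega> \<longlongrightarrow> l) (at_left s)"
      by (rule Lim_transform_eventually)
    then show ?thesis by blast
  qed
  show ?thesis using r l by (auto simp: cadlag_paths_def shift_def)
qed

lemma shift_apply: "0 \<le> s \<Longrightarrow> shift t \<omega> s = \<omega> (t + s)"
  by (simp add: shift_def)

section \<open>Evaluating and shifting a path at a measurable time\<close>

text \<open>Together the two assumptions say that the topology of \<open>'a\<close> is pulled back
  along \<open>h\<close>. Metric arguments, such as limits of measurable maps and distances to
  closed sets, are run after composing with \<open>h\<close>.\<close>

locale metrized =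
  fixes h :: "'a::topological_space \<Rightarrow> 'b::metric_space"
  assumes continuous_h: "continuous_on UNIV h"
    and open_vimage_h: "\<And>U. open U \<Longrightarrow> \<exists>V. open V \<and> U = h -` V"
begin

lemma measurable_h [measurable]: "h \<in> borel_measurable borel"
  using continuous_h by (rule borel_measurable_continuous_onI)

lemma borel_vimage_h:
  assumes "A \<in> sets (borel :: 'a measure)"
  shows "\<exists>W\<in>sets borel. A = h -` W"
proof -
  have "A \<in> sigma_sets UNIV {S :: 'a set. open S}" using assms by (simp add: borel_def)
  then show ?thesis
  proof induction
    case (Basic a) then show ?case using open_vimage_h by (auto intro: borel_open)
  next
    case Empty show ?case by (rule bexI[of _ "{}"]) auto
  next
    case (Compl a)
    then obtain W where "W \<in> sets borel" "a = h -` W" by blast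
    then show ?case by (intro bexI[of _ "UNIV - W"]) auto
  next
    case (Union a)
    then obtain W where "\<And>i. W i \<in> sets borel" "\<And>i. a i = h -` W i" by metis
    then show ?case by (intro bexI[of _ "\<Union>i. W i"]) auto
  qed
qed

lemma measurable_h_compose:
  assumes "(\<lambda>x. h (f x)) \<in> borel_measurable M"
  shows "f \<in> borel_measurable M"
proof (rule measurableI)
  fix A :: "'a set" assume "A \<in> sets borel"
  then obtain W where W: "W \<in> sets borel" "A = h -` W" using borel_vimage_h by blast
  then have "f -` A \<inter> space M = (\<lambda>x. h (f x)) -` W \<inter> space M" by auto
  then show "f -` A \<inter> space M \<in> sets M" using assms W by (auto intro: measurable_sets)
qed simp

text \<open>The time \<open>f x\<close> is approached from the right by grid times, where only
  countably many coordinates of the path occur; right-continuity gives the limit.\<close>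

lemma measurable_path_eval:
  assumes f[measurable]: "f \<in> borel_measurable M" and f0: "\<And>x. x \<in> space M \<Longrightarrow> 0 \<le> f x"
    and g[measurable]: "g \<in> M \<rightarrow>\<^sub>M path_sigma {0..}"
  shows "(\<lambda>x. g x (f x) :: 'a) \<in> borel_measurable M"
proof (rule measurable_h_compose)
  \<comment> \<open>The summand 1 makes the grid time strictly later than \<open>f x\<close>. The
    \<open>max 0\<close> in \<open>u\<close> keeps the coordinate index nonnegative for every
    integer value of \<open>k\<close>.\<close>
  define k where "k n x = \<lfloor>f x * real (Suc n)\<rfloor> + 1" for n x
  define u where "u n x = max 0 (real_of_int (k n x) / real (Suc n))" for n x
  show "(\<lambda>x. h (g x (f x))) \<in> borel_measurable M"
  proof (rule borel_measurable_LIMSEQ_metric[where f="\<lambda>n x. h (g x (u n x))"])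
    fix n
    have [measurable]: "k n \<in> M \<rightarrow>\<^sub>M count_space UNIV" unfolding k_def by measurable
    have "(\<lambda>x. (\<lambda>i x. h (g x (max 0 (real_of_int i / real (Suc n))))) (k n x) x) \<in> borel_measurable M"
    proof (rule measurable_compose_countable[where f="\<lambda>i x. h (g x (max 0 (real_of_int i / real
        (Suc n))))"])
      fix i :: int
      have "max 0 (real_of_int i / real (Suc n)) \<in> {0..}" by simp
      note measurable_coordinate[OF this, measurable]
      show "(\<lambda>x. h (g x (max 0 (real_of_int i / real (Suc n))))) \<in> borel_measurable M"
        by measurable
    qed measurable
    then show "(\<lambda>x. h (g x (u n x))) \<in> borel_measurable M" by (simp add: u_def)
  next
    fix x assume x: "x \<in> space M"
    have gx: "g x \<in> cadlag_paths" using measurable_space[OF g x] by simp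
    have u_gt: "f x < u n x" for n
    proof -
      have "f x * real (Suc n) < real_of_int (k n x)" unfolding k_def by linarith
      then have "f x < real_of_int (k n x) / real (Suc n)" by (simp add: pos_less_divide_eq)
      then show ?thesis by (simp add: u_def)
    qed
    have u_le: "u n x \<le> f x + 1 / real (Suc n)" for n
    proof -
      have "real_of_int (k n x) \<le> f x * real (Suc n) + 1" unfolding k_def by linarith
      then have "real_of_int (k n x) / real (Suc n) \<le> f x + 1 / real (Suc n)"
        by (subst pos_divide_le_eq) (simp_all add: distrib_right)
      then show ?thesis using f0[OF x] by (simp add: u_def)
    qed
    have "(\<lambda>n. u n x) \<longlonglongrightarrow> f x"
    proof (rule tendsto_sandwich[OF _ _ tendsto_const])
      show "(\<lambda>n. f x + 1 / real (Suc n)) \<longlonglongrightarrow> f x"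
        using tendsto_add[OF tendsto_const[of "f x"] LIMSEQ_inverse_real_of_nat]
        by (simp add: inverse_eq_divide)
      show "\<forall>\<^sub>F n in sequentially. f x \<le> u n x" using u_gt by (simp add: less_imp_le)
      show "\<forall>\<^sub>F n in sequentially. u n x \<le> f x + 1 / real (Suc n)" using u_le by simp
    qed
    then have "filterlim (\<lambda>n. u n x) (at_right (f x)) sequentially"
      using u_gt by (intro tendsto_imp_filterlim_at_right) auto
    moreover have "(g x \<longlongrightarrow> g x (f x)) (at_right (f x))"
      using gx f0[OF x] by (auto simp: cadlag_paths_def)
    ultimately have "(\<lambda>n. g x (u n x)) \<longlonglongrightarrow> g x (f x)" by (rule filterlim_compose[rotated])
    then show "(\<lambda>n. h (g x (u n x))) \<longlonglongrightarrow> h (g x (f x))"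
      by (rule continuous_on_tendsto_compose[OF continuous_h]) auto
  qed
qed

lemma measurable_shift:
  assumes f: "f \<in> borel_measurable M" and f0: "\<And>x. x \<in> space M \<Longrightarrow> 0 \<le> f x"
    and g: "g \<in> M \<rightarrow>\<^sub>M path_sigma {0..}"
  shows "(\<lambda>x. shift (f x) (g x) :: real \<Rightarrow> 'a) \<in> M \<rightarrow>\<^sub>M path_sigma {0..}"
proof (rule measurable_into_path_sigma)
  show "shift (f x) (g x) \<in> cadlag_paths" if "x \<in> space M" for x
    using measurable_space[OF g that] f0[OF that] by (auto intro: shift_cadlag)
  fix s :: real assume s: "s \<in> {0..}"
  have "(\<lambda>x. g x (f x + s)) \<in> borel_measurable M"
    using f f0 g s by (intro measurable_path_eval) auto
  then show "(\<lambda>x. shift (f x) (g x) s) \<in> borel_measurable M" using s by (simp add: shift_apply)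
qed

end

section \<open>Finite-dimensional cylinders\<close>

definition cylinder :: "real set \<Rightarrow> (real \<Rightarrow> 'a::topological_space set) \<Rightarrow> (real \<Rightarrow> 'a) set" where
  "cylinder J A = {\<omega> \<in> cadlag_paths. \<forall>s\<in>J. \<omega> s \<in> A s}"

abbreviation cylinders :: "real set \<Rightarrow> (real \<Rightarrow> 'a::topological_space) set set" where
  "cylinders I \<equiv> {cylinder J A | J A. finite J \<and> J \<subseteq> I \<and> (\<forall>s. A s \<in> sets borel)}"

lemma cylinder_sets:
  assumes "finite J" "J \<subseteq> I" "\<forall>s. A s \<in> sets borel"
  shows "cylinder J A \<in> sets (path_sigma I)"
proof -
  have "cylinder J A = {\<omega> \<in> space (path_sigma I). \<forall>s\<in>J. \<omega> s \<in> A s}" by (auto simp: cylinder_def)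
  also have "\<dots> \<in> sets (path_sigma I)"
  proof (rule sets.sets_Collect_finite_All[OF _ assms(1)])
    fix s assume "s \<in> J"
    then show "{\<omega> \<in> space (path_sigma I). \<omega> s \<in> A s} \<in> sets (path_sigma I)"
      using measurable_sets[OF measurable_coordinate[of s I], of "A s"] assms(2,3)
      by (auto simp: vimage_def Int_def conj_commute)
  qed
  finally show ?thesis .
qed

lemma Int_stable_cylinders: "Int_stable (cylinders I)"
proof (rule Int_stableI)
  fix a b :: "(real \<Rightarrow> 'a) set" assume "a \<in> cylinders I" "b \<in> cylinders I"
  then obtain J A L B where a: "a = cylinder J A" "finite J" "J \<subseteq> I" "\<forall>s. A s \<in> sets borel"
    and b: "b = cylinder L B" "finite L" "L \<subseteq> I" "\<forall>s. B s \<in> sets borel" by blast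
  let ?C = "\<lambda>s. (if s \<in> J then A s else UNIV) \<inter> (if s \<in> L then B s else UNIV)"
  have "a \<inter> b = cylinder (J \<union> L) ?C"
    by (auto simp: a b cylinder_def split: if_splits)
  moreover have "finite (J \<union> L)" "J \<union> L \<subseteq> I" "\<forall>s. ?C s \<in> sets borel"
    using a b by auto
  ultimately show "a \<inter> b \<in> cylinders I" by blast
qed

lemma sets_path_sigma_cylinders: "sets (path_sigma I :: (real \<Rightarrow> 'a::topological_space) measure) =
    sigma_sets cadlag_paths (cylinders I)"
  (is "?S = ?C")
proof
  show "?S \<subseteq> ?C"
    unfolding sets_path_sigma
  proof (rule sigma_sets_mono', rule subsetI)
    fix X :: "(real \<Rightarrow> 'a) set"
    assume "X \<in> {{\<omega> \<in> cadlag_paths. \<omega> s \<in> A} | s A. s \<in> I \<and> A \<in> sets borel}"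
    then obtain s A where X: "X = {\<omega> \<in> cadlag_paths. \<omega> s \<in> A}" "s \<in> I" "A \<in> sets borel" by blast
    have "X = cylinder {s} (\<lambda>_. A)" by (simp add: X(1) cylinder_def)
    with X(2,3) show "X \<in> cylinders I" by blast
  qed
  have "cylinders I \<subseteq> ?S" using cylinder_sets by blast
  then show "?C \<subseteq> ?S"
    using sets.sigma_sets_subset[of "cylinders I :: (real \<Rightarrow> 'a) set set" "path_sigma I"] by simp
qed

lemma cylinder_empty [simp]: "cylinder {} A = cadlag_paths"
  by (simp add: cylinder_def)

lemma cadlag_paths_in_cylinders: "cadlag_paths \<in> cylinders I"
  by (intro CollectI exI[of _ "{}"] exI[of _ "\<lambda>_. {}"]) simp

text \<open>Splits off the earliest time: what remains is a cylinder of the shifted path with fewer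
  times. Inductions on \<open>card J\<close> combine this with the Markov property at
  \<open>Min J\<close>.\<close>

lemma cylinder_Min:
  assumes J: "finite J" "J \<noteq> {}" "J \<subseteq> {0..t}"
  defines "s \<equiv> Min J"
  defines "J' \<equiv> (\<lambda>r. r - s) ` (J - {s})"
  shows "cylinder J A = {\<omega> \<in> cylinder {s} A. shift s \<omega> \<in> cylinder J' (\<lambda>r. A (s + r))}"
    and "finite J'" "card J' < card J" "J' \<subseteq> {0..t - s}" "0 \<le> s" "s \<le> t"
proof -
  have s: "s \<in> J" "\<And>r. r \<in> J \<Longrightarrow> s \<le> r" using J by (auto simp: s_def)
  show "0 \<le> s" "s \<le> t" using s(1) J(3) by auto
  show "finite J'" using J(1) by (simp add: J'_def)
  have "card J' \<le> card (J - {s})" unfolding J'_def using J(1) by (intro card_image_le) auto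
  then show "card J' < card J" using card_Diff1_less[OF J(1) s(1)] by simp
  show "J' \<subseteq> {0..t - s}" using s(2) J(3) by (auto simp: J'_def)
  have sh: "(\<forall>r\<in>J'. shift s \<omega> r \<in> A (s + r)) \<longleftrightarrow> (\<forall>r\<in>J - {s}. \<omega> r \<in> A r)" for \<omega>
  proof -
    have "(\<forall>r\<in>J'. shift s \<omega> r \<in> A (s + r)) \<longleftrightarrow>
        (\<forall>r\<in>J - {s}. shift s \<omega> (r - s) \<in> A (s + (r - s)))"
      unfolding J'_def by blast
    then show ?thesis using s(2) by (simp add: shift_apply)
  qed
  show "cylinder J A = {\<omega> \<in> cylinder {s} A. shift s \<omega> \<in> cylinder J' (\<lambda>r. A (s + r))}"
    using s(1) \<open>0 \<le> s\<close> by (auto simp: cylinder_def sh shift_cadlag)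
qed

section \<open>Stopping times and the strong Markov property\<close>

text \<open>
  Real-valued stopping times of the right-continuous filtration, characterised by \<open>{T < r} \<in> \<F>\<^sub>r\<close>,
  and their \<open>\<sigma>\<close>-algebra \<open>\<F>\<^sub>T\<^sub>+\<close>.
\<close>

definition optional_time :: "((real \<Rightarrow> 'a::topological_space) \<Rightarrow> real) \<Rightarrow> bool" where
  "optional_time T \<longleftrightarrow> (\<forall>\<omega>\<in>cadlag_paths. 0 \<le> T \<omega>) \<and>
     (\<forall>r>0. {\<omega> \<in> cadlag_paths. T \<omega> < r} \<in> sets (path_sigma {0..r}))"

definition prior_events :: "((real \<Rightarrow> 'a::topological_space) \<Rightarrow> real) \<Rightarrow> (real \<Rightarrow> 'a) set set" where
  "prior_events T = {A. A \<subseteq> cadlag_paths \<and> (\<forall>r>0. {\<omega> \<in> A. T \<omega> < r} \<in> sets (path_sigma {0..r}))}"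

lemma path_sigma_mono: "A \<in> sets (path_sigma I) \<Longrightarrow> I \<subseteq> J \<Longrightarrow> A \<in> sets (path_sigma J)"
  using sets_path_sigma_mono by blast

lemma cadlag_paths_sets [simp]: "cadlag_paths \<in> sets (path_sigma I)"
  using sets.top[of "path_sigma I"] by simp

lemma optional_time_measurable:
  assumes "optional_time T" shows "T \<in> borel_measurable (path_sigma {0..})"
proof (rule borel_measurableI_less)
  fix r
  show "{x \<in> space (path_sigma {0..}). T x < r} \<in> sets (path_sigma {0..})"
  proof (cases "r > 0")
    case True
    then have "{\<omega> \<in> cadlag_paths. T \<omega> < r} \<in> sets (path_sigma {0..r})"
      using assms by (simp add: optional_time_def)
    then show ?thesis using path_sigma_mono[of _ "{0..r}" "{0..}"] by auto
  next
    case False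
    then have "{x \<in> space (path_sigma {0..}). T x < r} = {}"
      using assms by (force simp: optional_time_def)
    then show ?thesis by (metis sets.empty_sets)
  qed
qed

lemma prior_events_measurable:
  assumes A: "A \<in> prior_events T" shows "A \<in> sets (path_sigma {0..})"
proof -
  have "{\<omega> \<in> A. T \<omega> < real (Suc n)} \<in> sets (path_sigma {0..})" for n
  proof (rule path_sigma_mono)
    show "{\<omega> \<in> A. T \<omega> < real (Suc n)} \<in> sets (path_sigma {0..real (Suc n)})"
      using A by (simp add: prior_events_def del: of_nat_Suc)
  qed auto
  then have "(\<Union>n. {\<omega> \<in> A. T \<omega> < real (Suc n)}) \<in> sets (path_sigma {0..})" by blast
  also have "(\<Union>n. {\<omega> \<in> A. T \<omega> < real (Suc n)}) = A"
  proof safe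
    fix \<omega> assume "\<omega> \<in> A"
    moreover obtain n where "T \<omega> < real n" using reals_Archimedean2 by blast
    then have "T \<omega> < real (Suc n)" by simp
    ultimately show "\<omega> \<in> (\<Union>n. {\<omega> \<in> A. T \<omega> < real (Suc n)})" by blast
  qed
  finally show ?thesis .
qed

lemma cadlag_paths_prior: "optional_time T \<Longrightarrow> cadlag_paths \<in> prior_events T"
  by (simp add: prior_events_def optional_time_def)

text \<open>For v > u, the event \<open>T \<le> u\<close> is the intersection of the events
  \<open>T < r n\<close> with \<open>r n\<close> decreasing to u and not exceeding v. Here the
  strict inequalities of \<open>prior_events\<close> meet the right-continuous filtration.\<close>

lemma prior_events_path_filtration:
  assumes A: "A \<in> prior_events T"
  shows "{\<omega> \<in> A. ennreal (T \<omega>) \<le> u} \<in> sets (path_filtration u)"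
  unfolding sets_path_filtration
proof (rule INT_I)
  fix v assume v: "v \<in> {u<..} \<union> {top}"
  let ?I = "{s. 0 \<le> s \<and> ennreal s \<le> v}"
  show "{\<omega> \<in> A. ennreal (T \<omega>) \<le> u} \<in> sets (path_sigma ?I)"
  proof (cases "u = top")
    case True
    then have "v = top" using v by auto
    then show ?thesis
      using prior_events_measurable[OF A] True by (simp add: atLeast_def)
  next
    case False
    then obtain a where a: "u = ennreal a" "0 \<le> a" by (cases u) auto
    have "\<exists>b>a. ennreal b \<le> v"
    proof (cases "v = top")
      case True then show ?thesis by (intro exI[of _ "a + 1"]) auto
    next
      case False
      then obtain b where "v = ennreal b" "0 \<le> b" by (cases v) auto
      then show ?thesis using v a by (intro exI[of _ b]) (auto simp: ennreal_less_iff)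
    qed
    then obtain b where b: "a < b" "ennreal b \<le> v" by blast
    define r where "r n = a + (b - a) / real (Suc n)" for n
    have r: "a < r n" "r n \<le> b" for n
    proof -
      show "a < r n" using b by (simp add: r_def)
      have "(b - a) / real (Suc n) \<le> (b - a) / 1" using b(1) by (intro divide_left_mono) auto
      then show "r n \<le> b" by (simp add: r_def)
    qed
    have lim: "r \<longlonglongrightarrow> a"
      unfolding r_def using tendsto_add[OF tendsto_const[of a]
          tendsto_mult[OF tendsto_const[of "b - a"] LIMSEQ_inverse_real_of_nat]]
      by (simp add: divide_inverse)
    have "{\<omega> \<in> A. T \<omega> < r n} \<in> sets (path_sigma ?I)" for n
    proof (rule path_sigma_mono)
      show "{\<omega> \<in> A. T \<omega> < r n} \<in> sets (path_sigma {0..r n})"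
        using A r(1)[of n] a(2) by (auto simp: prior_events_def)
      show "{0..r n} \<subseteq> ?I"
        using r(2)[of n] b(2) by (auto intro: order_trans[OF ennreal_leI])
    qed
    then have "(\<Inter>n. {\<omega> \<in> A. T \<omega> < r n}) \<in> sets (path_sigma ?I)" by blast
    also have "(\<Inter>n. {\<omega> \<in> A. T \<omega> < r n}) = {\<omega> \<in> A. ennreal (T \<omega>) \<le> u}"
    proof -
      have "(\<forall>n. T \<omega> < r n) \<longleftrightarrow> T \<omega> \<le> a" for \<omega>
      proof
        assume "\<forall>n. T \<omega> < r n"
        then show "T \<omega> \<le> a" by (intro LIMSEQ_le_const[OF lim]) (auto intro: less_imp_le)
      qed (auto intro: le_less_trans[OF _ r(1)])
      then show ?thesis using a by auto
    qed
    finally show ?thesis .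
  qed
qed

text \<open>On \<open>T < r\<close> the time coincides with \<open>min (T \<omega>) r\<close>. That
  minimum is measurable at time r: its sublevel events are those of T up to level r and the whole
  space above it.\<close>

lemma prior_events_Int_time:
  assumes T: "optional_time T" and A: "A \<in> prior_events T" and a: "a \<in> sets borel"
  shows "{\<omega> \<in> A. T \<omega> \<in> a} \<in> prior_events T"
  unfolding prior_events_def
proof (intro CollectI conjI allI impI)
  have A_sub: "A \<subseteq> cadlag_paths" using A by (simp add: prior_events_def)
  then show "{\<omega> \<in> A. T \<omega> \<in> a} \<subseteq> cadlag_paths" by auto
  fix r :: real assume r: "0 < r"
  have "(\<lambda>\<omega>. min (T \<omega>) r) \<in> borel_measurable (path_sigma {0..r})"
  proof (rule borel_measurableI_less)
    fix c
    consider "c \<le> 0" | "0 < c" "c \<le> r" | "r < c" by linarith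
    then show "{x \<in> space (path_sigma {0..r}). min (T x) r < c} \<in> sets (path_sigma {0..r})"
    proof cases
      case 1
      then have "{x \<in> space (path_sigma {0..r}). min (T x) r < c} = {}"
        using T r by (force simp: optional_time_def)
      then show ?thesis by (metis sets.empty_sets)
    next
      case 2
      then have "{x \<in> space (path_sigma {0..r}). min (T x) r < c} = {x \<in> cadlag_paths. T x < c}"
        by auto
      moreover have "{x \<in> cadlag_paths. T x < c} \<in> sets (path_sigma {0..c})"
        using T 2 by (simp add: optional_time_def)
      ultimately show ?thesis using path_sigma_mono[of _ "{0..c}" "{0..r}"] 2 by auto
    next
      case 3
      then have "{x \<in> space (path_sigma {0..r}). min (T x) r < c} = space (path_sigma {0..r})"
        by auto
      then show ?thesis by (metis sets.top)
    qed
  qed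
  moreover have "{\<omega> \<in> A. T \<omega> < r} \<in> sets (path_sigma {0..r})"
    using A r by (simp add: prior_events_def)
  ultimately have "(\<lambda>\<omega>. min (T \<omega>) r) -` a \<inter> space (path_sigma {0..r}) \<inter> {\<omega> \<in> A. T \<omega> < r} \<in>
      sets (path_sigma {0..r})"
    using a by (intro sets.Int measurable_sets)
  also have "(\<lambda>\<omega>. min (T \<omega>) r) -` a \<inter> space (path_sigma {0..r}) \<inter> {\<omega> \<in> A. T \<omega> < r} =
      {\<omega> \<in> {\<omega> \<in> A. T \<omega> \<in> a}. T \<omega> < r}"
    using A_sub by auto
  finally show "{\<omega> \<in> {\<omega> \<in> A. T \<omega> \<in> a}. T \<omega> < r} \<in> sets (path_sigma {0..r})" .
qed

lemma optional_time_const: "0 \<le> s \<Longrightarrow> optional_time (\<lambda>\<omega>. s)"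
  unfolding optional_time_def
proof (intro conjI ballI allI impI)
  fix r :: real
  have eq: "{\<omega> \<in> cadlag_paths. s < r} = (if s < r then cadlag_paths else {})" by auto
  show "{\<omega> \<in> cadlag_paths. s < r} \<in> sets (path_sigma {0..r})" unfolding eq by simp
qed

lemma prior_events_const:
  assumes "A \<in> sets (path_sigma {0..s})" shows "A \<in> prior_events (\<lambda>\<omega>. s)"
  unfolding prior_events_def
proof (intro CollectI conjI allI impI)
  show "A \<subseteq> cadlag_paths" using sets.sets_into_space[OF assms] by simp
  fix r :: real
  have eq: "{\<omega> \<in> A. s < r} = (if s < r then A else {})" by auto
  have "A \<in> sets (path_sigma {0..r})" if "s < r"
    using that by (intro path_sigma_mono[OF assms]) auto
  then show "{\<omega> \<in> A. s < r} \<in> sets (path_sigma {0..r})" unfolding eq by simp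
qed

section \<open>The kernel of laws and the strong Markov property for functionals\<close>

locale right_process = metrized h for h :: "'a::topological_space \<Rightarrow> 'b::metric_space" +
  fixes P :: "'a \<Rightarrow> (real \<Rightarrow> 'a) measure"
  assumes right_process: "borel_right_process P"
begin

lemma prob_space_P: "prob_space (P x)"
  and sets_P [measurable_cong]: "sets (P x) = sets (path_sigma {0..})"
  and start: "AE \<omega> in P x. \<omega> 0 = x"
  using right_process unfolding borel_right_process_def by blast+

sublocale P: prob_space "P x" for x by (rule prob_space_P)

lemma space_P [simp]: "space (P x) = cadlag_paths"
  using sets_eq_imp_space_eq[OF sets_P] by simp

text \<open>The defining property speaks of times with values in \<open>ennreal\<close>; for a time
  that is finite on every path the conditions \<open>T < top\<close> disappear.\<close>

lemma strong_markov_event: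
  assumes T: "optional_time T" and A: "A \<in> prior_events T" and G: "G \<in> sets (path_sigma {0..})"
  shows "emeasure (P x) {\<omega> \<in> A. shift (T \<omega>) \<omega> \<in> G} =
    (\<integral>\<^sup>+\<omega>\<in>A. emeasure (P (\<omega> (T \<omega>))) G \<partial>P x)"
proof -
  let ?T = "\<lambda>\<omega>. ennreal (T \<omega>)"
  interpret F: filtration cadlag_paths path_filtration
    by (rule filtration_path_filtration)
  have st: "stopping_time path_filtration ?T"
    unfolding stopping_time_def pred_def
    using prior_events_path_filtration[OF cadlag_paths_prior[OF T]] by (simp add: space_path_filtration)
  have pre: "A \<in> sets (F.pre_sigma ?T)"
    using F.sets_pre_sigmaI[OF st] prior_events_path_filtration[OF A] by blast
  have A_sub: "A \<subseteq> cadlag_paths" using A by (simp add: prior_events_def)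
  have T0: "enn2real (?T \<omega>) = T \<omega>" if "\<omega> \<in> cadlag_paths" for \<omega>
    using T that by (simp add: optional_time_def)
  have "emeasure (P x) {\<omega> \<in> A. ?T \<omega> < top \<and> shift (enn2real (?T \<omega>)) \<omega> \<in> G} =
      (\<integral>\<^sup>+\<omega>\<in>{\<omega> \<in> A. ?T \<omega> < top}. emeasure (P (\<omega> (enn2real (?T \<omega>)))) G \<partial>P x)"
    using right_process st pre G unfolding borel_right_process_def by blast
  also have "{\<omega> \<in> A. ?T \<omega> < top \<and> shift (enn2real (?T \<omega>)) \<omega> \<in> G} = {\<omega> \<in> A. shift (T \<omega>) \<omega> \<in> G}"
    using A_sub T0 by auto
  also have "{\<omega> \<in> A. ?T \<omega> < top} = A" by auto
  also have "(\<integral>\<^sup>+\<omega>\<in>A. emeasure (P (\<omega> (enn2real (?T \<omega>)))) G \<partial>P x) =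
      (\<integral>\<^sup>+\<omega>\<in>A. emeasure (P (\<omega> (T \<omega>))) G \<partial>P x)"
    using T0 by (intro nn_integral_cong) simp
  finally show ?thesis .
qed

text \<open>The defining property covers bounded real functions; indicators are among them, and sums
  and monotone limits reach all nonnegative ones.\<close>

lemma measurable_semigroup:
  assumes t: "0 \<le> t" and f: "f \<in> borel_measurable borel"
  shows "(\<lambda>x. \<integral>\<^sup>+\<omega>. f (\<omega> t) \<partial>P x) \<in> borel_measurable borel"
proof -
  have co: "(\<lambda>\<omega>. \<omega> t) \<in> P x \<rightarrow>\<^sub>M borel" for x
    using measurable_coordinate[of t "{0..}"] t by (simp cong: measurable_cong_sets add: sets_P)
  show ?thesis
    using f
  proof (induction rule: borel_measurable_induct)
    case (cong f g)
    then have "f = g" by auto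
    with cong show ?case by simp
  next
    case (set A)
    have "(\<lambda>x. \<integral>\<omega>. g (\<omega> t) \<partial>P x) \<in> borel_measurable borel"
      if "g \<in> borel_measurable borel" "bounded (range g)" for g :: "'a \<Rightarrow> real"
      using right_process t that unfolding borel_right_process_def by blast
    moreover have "bounded (range (indicator A :: 'a \<Rightarrow> real))"
      by (rule boundedI[where B=1]) (auto simp: indicator_def)
    moreover have "(indicator A :: 'a \<Rightarrow> real) \<in> borel_measurable borel"
      using set by simp
    ultimately have "(\<lambda>x. \<integral>\<omega>. indicator A (\<omega> t) \<partial>P x :: real) \<in> borel_measurable borel"
      by blast
    then have "(\<lambda>x. ennreal (\<integral>\<omega>. indicator A (\<omega> t) \<partial>P x)) \<in> borel_measurable borel"
      by (rule measurable_compose[OF _ measurable_ennreal])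
    moreover have "(\<integral>\<^sup>+\<omega>. indicator A (\<omega> t) \<partial>P x) = ennreal (\<integral>\<omega>. indicator A (\<omega> t) \<partial>P x)" for x
    proof -
      have "(\<lambda>\<omega>. indicator A (\<omega> t) :: real) \<in> borel_measurable (P x)"
        using set by (intro measurable_compose[OF co]) simp
      then have "(\<integral>\<^sup>+\<omega>. ennreal (indicator A (\<omega> t)) \<partial>P x) = ennreal (\<integral>\<omega>. indicator A (\<omega> t) \<partial>P x)"
        by (intro nn_integral_eq_integral P.integrable_const_bound[where B=1]) (auto simp: indicator_def)
      then show ?thesis by (simp add: ennreal_indicator)
    qed
    ultimately show ?case by simp
  next
    case (mult u c)
    have "(\<integral>\<^sup>+\<omega>. c * u (\<omega> t) \<partial>P x) = c * (\<integral>\<^sup>+\<omega>. u (\<omega> t) \<partial>P x)" for x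
      by (rule nn_integral_cmult[OF measurable_compose[OF co mult(2)]])
    with mult show ?case by simp
  next
    case (add u v)
    have "(\<integral>\<^sup>+\<omega>. v (\<omega> t) + u (\<omega> t) \<partial>P x) = (\<integral>\<^sup>+\<omega>. v (\<omega> t) \<partial>P x) + (\<integral>\<^sup>+\<omega>. u (\<omega> t) \<partial>P x)" for x
      using add by (intro nn_integral_add measurable_compose[OF co])
    with add show ?case by simp
  next
    case (seq U)
    have eq: "(\<integral>\<^sup>+\<omega>. (SUP i. U i) (\<omega> t) \<partial>P x) = (SUP i. \<integral>\<^sup>+\<omega>. U i (\<omega> t) \<partial>P x)" for x
      unfolding SUP_apply
      using seq(3) by (intro nn_integral_monotone_convergence_SUP measurable_compose[OF co seq(1)])
        (auto simp: incseq_def le_fun_def)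
    show ?case unfolding eq by (rule borel_measurable_SUP[OF _ seq.IH]) simp
  qed
qed

text \<open>The Markov property at the earliest time writes the probability as a semigroup operator
  applied to a function that is Borel by induction on the number of times.\<close>

lemma cylinder_kernel:
  assumes "finite J" "J \<subseteq> {0..}" "\<forall>s. A s \<in> sets borel"
  shows "(\<lambda>x. emeasure (P x) (cylinder J A)) \<in> borel_measurable borel"
  using assms
proof (induction "card J" arbitrary: J A rule: less_induct)
  case less
  show ?case
  proof (cases "J = {}")
    case True then show ?thesis using P.emeasure_space_1 by simp
  next
    case False
    define s where "s = Min J"
    define J' where "J' = (\<lambda>r. r - s) ` (J - {s})"
    have "J \<subseteq> {0..Max J}" using less.prems(1,2) by auto
    note C = cylinder_Min[OF less.prems(1) False this, folded s_def, folded J'_def]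
    have J': "J' \<subseteq> {0..}" using C(4) by auto
    let ?C = "cylinder J' (\<lambda>r. A (s + r))"
    have C': "?C \<in> sets (path_sigma {0..})" using C J' less.prems by (intro cylinder_sets) auto
    have [measurable]: "(\<lambda>x. emeasure (P x) ?C) \<in> borel_measurable borel"
      using less.hyps[OF C(3,2) J'] less.prems by simp
    have cs: "cylinder {s} A \<in> sets (path_sigma {0..s})"
      using less.prems C(5) by (intro cylinder_sets) auto
    have "emeasure (P x) (cylinder J A) = (\<integral>\<^sup>+\<omega>. (emeasure (P (\<omega> s)) ?C *
        indicator (A s) (\<omega> s)) \<partial>P x)" for x
    proof -
      have "emeasure (P x) (cylinder J A) = (\<integral>\<^sup>+\<omega>\<in>cylinder {s} A. emeasure (P (\<omega> s)) ?C \<partial>P x)"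
        unfolding C(1) by (rule strong_markov_event[OF optional_time_const prior_events_const[OF
            cs] C']) (use C in simp)
      also have "\<dots> = (\<integral>\<^sup>+\<omega>. (emeasure (P (\<omega> s)) ?C * indicator (A s) (\<omega> s)) \<partial>P x)"
        by (intro nn_integral_cong) (auto simp: cylinder_def indicator_def)
      finally show ?thesis .
    qed
    moreover have "A s \<in> sets borel" using less.prems by simp
    then have "(\<lambda>y. emeasure (P y) ?C * indicator (A s) y) \<in> borel_measurable borel" by measurable
    note measurable_semigroup[OF C(5) this]
    ultimately show ?thesis by simp
  qed
qed

lemma kernel [measurable]: "P \<in> borel \<rightarrow>\<^sub>M subprob_algebra (path_sigma {0..})"
proof (rule measurable_subprob_algebra_generated)
  show "sets (path_sigma {0..}) = sigma_sets cadlag_paths (cylinders {0..})"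
    by (rule sets_path_sigma_cylinders)
  show "Int_stable (cylinders {0..})" by (rule Int_stable_cylinders)
  show "cylinders {0..} \<subseteq> Pow cadlag_paths" by (auto simp: cylinder_def)
  show "subprob_space (P a)" for a by (rule prob_space_imp_subprob_space[OF prob_space_P])
  show "sets (P a) = sets (path_sigma {0..})" for a by (rule sets_P)
  show "(\<lambda>a. emeasure (P a) A) \<in> borel_measurable borel" if "A \<in> cylinders {0..}" for A
    using that cylinder_kernel by blast
  show "(\<lambda>a. emeasure (P a) cadlag_paths) \<in> borel_measurable borel"
    using P.emeasure_space_1 by simp
qed

end

context right_process
begin

text \<open>The functional may depend on T as well as on the shifted path. Both sides are integrals
  against measures on the product of time and path space; on a rectangle the condition on T is
  absorbed into the event A, and the event form of the property applies.\<close>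

lemma strong_markov:
  assumes T: "optional_time T" and A: "A \<in> prior_events T"
    and \<Phi>[measurable]: "\<Phi> \<in> borel_measurable (borel \<Otimes>\<^sub>M path_sigma {0..})"
  shows "(\<integral>\<^sup>+\<omega>\<in>A. \<Phi> (T \<omega>, shift (T \<omega>) \<omega>) \<partial>P x) =
    (\<integral>\<^sup>+\<omega>\<in>A. (\<integral>\<^sup>+w. \<Phi> (T \<omega>, w) \<partial>P (\<omega> (T \<omega>))) \<partial>P x)"
proof -
  let ?S = "borel \<Otimes>\<^sub>M path_sigma {0..} :: (real \<times> (real \<Rightarrow> 'a)) measure"
  let ?Q = "path_sigma {0..} :: (real \<Rightarrow> 'a) measure"
  have [measurable]: "A \<in> sets ?Q" by (rule prior_events_measurable[OF A])
  have [measurable]: "T \<in> borel_measurable ?Q" by (rule optional_time_measurable[OF T])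
  have T0: "0 \<le> T \<omega>" if "\<omega> \<in> space ?Q" for \<omega> using T that by (simp add: optional_time_def)
  have [measurable]: "(\<lambda>\<omega>. \<omega> (T \<omega>)) \<in> borel_measurable ?Q"
    by (rule measurable_path_eval[OF _ T0]) auto
  have [measurable]: "(\<lambda>\<omega>. shift (T \<omega>) \<omega>) \<in> ?Q \<rightarrow>\<^sub>M ?Q"
    by (rule measurable_shift[OF _ T0]) auto
  define MA where "MA = density (P x) (indicator A)"
  have sMA [measurable_cong]: "sets MA = sets ?Q" by (simp add: MA_def sets_P)
  have MA1: "emeasure MA (space MA) \<le> 1"
  proof -
    have "emeasure MA (space MA) = (\<integral>\<^sup>+\<omega>. indicator A \<omega> * indicator (space (P x)) \<omega> \<partial>P x)"
      unfolding MA_def space_density by (rule emeasure_density) (auto simp: sets_P)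
    also have "\<dots> \<le> (\<integral>\<^sup>+\<omega>. 1 \<partial>P x)" by (intro nn_integral_mono) (simp add: indicator_def)
    also have "\<dots> = 1" using P.emeasure_space_1 by simp
    finally show ?thesis .
  qed
  define \<mu> where "\<mu> = distr MA ?S (\<lambda>\<omega>. (T \<omega>, shift (T \<omega>) \<omega>))"
  \<comment> \<open>Keeps \<open>T \<omega>\<close> and draws a fresh path started at
    \<open>\<omega> (T \<omega>)\<close>.\<close>
  define K where "K \<omega> = distr (P (\<omega> (T \<omega>))) ?S (Pair (T \<omega>))" for \<omega>
  have K[measurable]: "K \<in> MA \<rightarrow>\<^sub>M subprob_algebra ?S"
    unfolding K_def by (rule measurable_distr2[where M="?Q"]) measurable
  define \<nu> where "\<nu> = MA \<bind> K"
  have ne: "space MA \<noteq> {}" using P.not_empty[of x] by (simp add: MA_def)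
  have s\<nu>: "sets \<nu> = sets ?S" unfolding \<nu>_def by (rule sets_bind[OF sets_kernel[OF K] ne])
  have em\<nu>: "(\<integral>\<^sup>+z. f z \<partial>\<nu>) = (\<integral>\<^sup>+\<omega>\<in>A. (\<integral>\<^sup>+w. f (T \<omega>, w) \<partial>P (\<omega> (T \<omega>))) \<partial>P x)"
    if [measurable]: "f \<in> borel_measurable ?S" for f
  proof -
    have [measurable]: "(\<lambda>\<omega>. \<integral>\<^sup>+w. f (T \<omega>, w) \<partial>P (\<omega> (T \<omega>))) \<in> borel_measurable ?Q"
      by (rule nn_integral_measurable_subprob_algebra2[where N="?Q"]) measurable
    have "(\<integral>\<^sup>+z. f z \<partial>\<nu>) = (\<integral>\<^sup>+\<omega>. \<integral>\<^sup>+z. f z \<partial>K \<omega> \<partial>MA)"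
      unfolding \<nu>_def by (rule nn_integral_bind[OF _ K]) measurable
    also have "\<dots> = (\<integral>\<^sup>+\<omega>. (\<integral>\<^sup>+w. f (T \<omega>, w) \<partial>P (\<omega> (T \<omega>))) \<partial>MA)"
      unfolding K_def by (intro nn_integral_cong) (subst nn_integral_distr, auto)
    also have "\<dots> = (\<integral>\<^sup>+\<omega>\<in>A. (\<integral>\<^sup>+w. f (T \<omega>, w) \<partial>P (\<omega> (T \<omega>))) \<partial>P x)"
      unfolding MA_def by (subst nn_integral_density) (auto simp: mult.commute)
    finally show ?thesis .
  qed
  have em\<mu>: "(\<integral>\<^sup>+z. f z \<partial>\<mu>) = (\<integral>\<^sup>+\<omega>\<in>A. f (T \<omega>, shift (T \<omega>) \<omega>) \<partial>P x)"
    if [measurable]: "f \<in> borel_measurable ?S" for f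
  proof -
    have m: "(\<lambda>\<omega>. f (T \<omega>, shift (T \<omega>) \<omega>)) \<in> borel_measurable ?Q" by measurable
    have "(\<integral>\<^sup>+z. f z \<partial>\<mu>) = (\<integral>\<^sup>+\<omega>. f (T \<omega>, shift (T \<omega>) \<omega>) \<partial>MA)"
      unfolding \<mu>_def by (rule nn_integral_distr) measurable
    also have "\<dots> = (\<integral>\<^sup>+\<omega>. indicator A \<omega> * f (T \<omega>, shift (T \<omega>) \<omega>) \<partial>P x)"
      unfolding MA_def using m by (intro nn_integral_density) (simp_all add:
          measurable_cong_sets[OF sets_P refl] sets_P)
    finally show ?thesis by (simp only: mult.commute)
  qed
  have "\<mu> = \<nu>"
  proof (rule measure_eqI_generator_eq[OF Int_stable_pair_measure_generator,
        where \<Omega> = "space borel \<times> space ?Q" and A = "\<lambda>_. space borel \<times> space ?Q"])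
    show "{a \<times> b |a b. a \<in> sets borel \<and> b \<in> sets ?Q} \<subseteq> Pow (space borel \<times> space ?Q)"
      by (rule pair_measure_closed)
    show "sets \<mu> = sigma_sets (space borel \<times> space ?Q) {a \<times> b |a b. a \<in> sets borel \<and> b \<in> sets ?Q}"
      by (simp add: \<mu>_def sets_pair_measure)
    show "sets \<nu> = sigma_sets (space borel \<times> space ?Q) {a \<times> b |a b. a \<in> sets borel \<and> b \<in> sets ?Q}"
      by (simp add: s\<nu> sets_pair_measure)
    show "range (\<lambda>_::nat. space borel \<times> space ?Q) \<subseteq> {a \<times> b |a b. a \<in> sets (borel::real measure) \<and>
        b \<in> sets ?Q}"
      using sets.top by (auto intro!: exI[of _ UNIV] exI[of _ cadlag_paths])
    show "emeasure \<mu> (space borel \<times> space ?Q) \<noteq> \<infinity>" for i :: nat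
    proof -
      have "emeasure \<mu> (space ?S) = emeasure MA (space MA)"
        unfolding \<mu>_def by (subst emeasure_distr) (auto intro!: arg_cong[where f="emeasure MA"]
            simp: space_pair_measure sets_eq_imp_space_eq[OF sMA] shift_cadlag T0)
      then show ?thesis using MA1 by (auto simp: space_pair_measure top_unique)
    qed
  next
    fix X assume "X \<in> {a \<times> b |a b. a \<in> sets (borel::real measure) \<and> b \<in> sets ?Q}"
    then obtain a b where X: "X = a \<times> b" and ab[measurable]: "a \<in> sets borel" "b \<in> sets ?Q" by blast
    have XS: "X \<in> sets ?S" unfolding X by (rule pair_measureI[OF ab])
    let ?A = "{\<omega> \<in> A. T \<omega> \<in> a}"
    have A': "?A \<in> prior_events T" by (rule prior_events_Int_time[OF T A ab(1)])
    have A_sub: "A \<subseteq> cadlag_paths" using A by (simp add: prior_events_def)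
    have "emeasure \<mu> X = (\<integral>\<^sup>+z. indicator X z \<partial>\<mu>)" using XS by (simp add: \<mu>_def)
    also have "\<dots> = (\<integral>\<^sup>+\<omega>. indicator {\<omega> \<in> ?A. shift (T \<omega>) \<omega> \<in> b} \<omega> \<partial>P x)"
      using XS by (subst em\<mu>, simp) (intro nn_integral_cong, auto simp: X indicator_def)
    also have "\<dots> = emeasure (P x) {\<omega> \<in> ?A. shift (T \<omega>) \<omega> \<in> b}"
    proof (rule nn_integral_indicator)
      have "{\<omega> \<in> ?A. shift (T \<omega>) \<omega> \<in> b} = {\<omega> \<in> space ?Q. \<omega> \<in> A \<and> T \<omega> \<in> a \<and> shift (T \<omega>) \<omega> \<in> b}"
        using A_sub by auto
      also have "\<dots> \<in> sets ?Q" by measurable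
      finally show "{\<omega> \<in> ?A. shift (T \<omega>) \<omega> \<in> b} \<in> sets (P x)" by (simp add: sets_P)
    qed
    also have "\<dots> = (\<integral>\<^sup>+\<omega>\<in>?A. emeasure (P (\<omega> (T \<omega>))) b \<partial>P x)"
      by (rule strong_markov_event[OF T A' ab(2)])
    also have "\<dots> = (\<integral>\<^sup>+\<omega>\<in>A. (\<integral>\<^sup>+w. indicator X (T \<omega>, w) \<partial>P (\<omega> (T \<omega>))) \<partial>P x)"
    proof (intro nn_integral_cong)
      fix \<omega>
      have "(\<integral>\<^sup>+w. indicator X (T \<omega>, w) \<partial>P (\<omega> (T \<omega>))) =
          (\<integral>\<^sup>+w. indicator a (T \<omega>) * indicator b w \<partial>P (\<omega> (T \<omega>)))"
        by (intro nn_integral_cong) (simp add: X indicator_times)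
      also have "\<dots> = indicator a (T \<omega>) * emeasure (P (\<omega> (T \<omega>))) b"
        by (subst nn_integral_cmult) (auto simp: sets_P)
      finally show "emeasure (P (\<omega> (T \<omega>))) b * indicator ?A \<omega> =
          (\<integral>\<^sup>+w. indicator X (T \<omega>, w) \<partial>P (\<omega> (T \<omega>))) * indicator A \<omega>"
        by (auto simp: indicator_def)
    qed
    also have "\<dots> = emeasure \<nu> X" using XS by (subst em\<nu>[symmetric]) (auto simp: s\<nu>)
    finally show "emeasure \<mu> X = emeasure \<nu> X" .
  qed simp
  then show ?thesis using em\<mu>[OF \<Phi>] em\<nu>[OF \<Phi>] by simp
qed

lemma markov:
  assumes s: "0 \<le> s" and A: "A \<in> sets (path_sigma {0..s})"
    and \<Phi>[measurable]: "\<Phi> \<in> borel_measurable (path_sigma {0..})"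
  shows "(\<integral>\<^sup>+\<omega>\<in>A. \<Phi> (shift s \<omega>) \<partial>P x) = (\<integral>\<^sup>+\<omega>\<in>A. (\<integral>\<^sup>+w. \<Phi> w \<partial>P (\<omega> s)) \<partial>P x)"
proof -
  have "(\<lambda>z. \<Phi> (snd z)) \<in> borel_measurable ((borel :: real measure) \<Otimes>\<^sub>M path_sigma {0..})"
    by measurable
  from strong_markov[OF optional_time_const[OF s] prior_events_const[OF A] this]
  show ?thesis by (simp only: snd_conv)
qed

end

section \<open>Fine continuity of harmonic functions\<close>

text \<open>Approximating from inside and outside at once makes the property invariant under
  complements, so it passes from closed sets to the \<sigma>-algebra they generate.\<close>

lemma closed_open_approximation:
  fixes W :: "'a::metric_space set"
  assumes "finite_measure M" and M: "sets M = sets (borel :: 'a measure)"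
      and W: "W \<in> sets (borel :: 'a measure)" and e: "e > 0"
  shows "\<exists>C U. closed C \<and> open U \<and> C \<subseteq> W \<and> W \<subseteq> U \<and> measure M (U - C) < e"
proof -
  interpret finite_measure M by fact
  have [measurable_cong]: "sets M = sets borel" by (rule M)
  have spM: "space M = UNIV" using sets_eq_imp_space_eq[OF M] by simp
  have cl: "closed C \<Longrightarrow> C \<in> sets M" and op: "open C \<Longrightarrow> C \<in> sets M" for C by (simp_all add: M)
  have "W \<in> sigma_sets UNIV (Collect closed)" using W by (simp add: borel_eq_closed)
  then have "\<forall>e>0. \<exists>C U. closed C \<and> open U \<and> C \<subseteq> W \<and> W \<subseteq> U \<and> measure M (U - C) < e"
  proof induction
    case (Basic C)
    then have C: "closed C" by simp
    show ?case
    proof (cases "C = {}")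
      case True
      then show ?thesis by (intro allI impI exI[of _ "{}"]) simp
    next
      case False
      \<comment> \<open>Open neighbourhoods shrinking to C. The empty set is treated apart because
        \<open>infdist y {}\<close> is 0.\<close>
      define U where "U n = {y. infdist y C < 1 / real (Suc n)}" for n
      have oU: "open (U n)" for n
        unfolding U_def by (intro open_Collect_less continuous_intros)
      have CU: "C \<subseteq> U n" for n by (auto simp: U_def)
      have "(\<Inter>n. U n - C) = {}"
      proof (rule ccontr)
        assume "(\<Inter>n. U n - C) \<noteq> {}"
        then obtain y where y: "\<And>n. y \<in> U n" "y \<notin> C" by blast
        have "infdist y C \<le> 0 + e" if e0: "e > 0" for e
        proof -
          obtain n where "1 / real (Suc n) < e" using nat_approx_posE[OF e0] by auto
          then show ?thesis using y(1)[of n] by (simp add: U_def)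
        qed
        then have "infdist y C \<le> 0" by (rule field_le_epsilon)
        then have "infdist y C = 0" using infdist_nonneg[of y C] by simp
        then show False using in_closed_iff_infdist_zero[OF C False, of y] y(2) by simp
      qed
      moreover have "(\<lambda>n. measure M (U n - C)) \<longlonglongrightarrow> measure M (\<Inter>n. U n - C)"
      proof (rule finite_Lim_measure_decseq)
        show "range (\<lambda>n. U n - C) \<subseteq> sets M" using op[OF oU] cl[OF C] by auto
        have "1 / real (Suc n) \<le> 1 / real (Suc m)" if "m \<le> n" for m n
          using that by (simp add: frac_le)
        then show "decseq (\<lambda>n. U n - C)"
          unfolding decseq_def U_def by (fastforce intro: order_less_le_trans)
      qed
      ultimately have lim: "(\<lambda>n. measure M (U n - C)) \<longlonglongrightarrow> 0"
        by (simp only: measure_empty)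
      show ?thesis
      proof (intro allI impI)
        fix e :: real assume "e > 0"
        then have "\<forall>\<^sub>F n in sequentially. measure M (U n - C) < e"
          using order_tendstoD(2)[OF lim] by simp
        then obtain n where "measure M (U n - C) < e" by (auto simp: eventually_sequentially)
        then show "\<exists>C' U. closed C' \<and> open U \<and> C' \<subseteq> C \<and> C \<subseteq> U \<and> measure M (U - C') < e"
          using C oU CU by blast
      qed
    qed
  next
    case Empty
    then show ?case by (intro allI impI exI[of _ "{}"]) simp
  next
    case (Compl W)
    show ?case
    proof (intro allI impI)
      fix e :: real assume e: "e > 0"
      obtain C U where *: "closed C" "open U" "C \<subseteq> W" "W \<subseteq> U" "measure M (U - C) < e"
        using Compl.IH[rule_format, OF e] by blast
      have "(UNIV - C) - (UNIV - U) = U - C" by auto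
      then show "\<exists>C U. closed C \<and> open U \<and> C \<subseteq> UNIV - W \<and> UNIV - W \<subseteq> U \<and> measure M (U - C) < e"
        using * by (intro exI[of _ "UNIV - U"] exI[of _ "UNIV - C"])
          (simp add: closed_Diff open_Diff Diff_mono)
    qed
  next
    case (Union W)
    show ?case
    proof (intro allI impI)
      fix e :: real assume e: "e > 0"
      \<comment> \<open>These errors sum to e / 2. The other half pays for replacing the union of
        the closed sets, which need not be closed, by a finite one.\<close>
      have "\<exists>C U. closed C \<and> open U \<and> C \<subseteq> W n \<and> W n \<subseteq> U \<and> measure M (U - C) < e / 2 *
          (1/2) ^ Suc n" for n
      proof -
        have "e / 2 * (1/2) ^ Suc n > 0" using e by simp
        then show ?thesis by (rule Union.IH[rule_format])
      qed
      then obtain C U where CU: "\<And>n. closed (C n)" "\<And>n. open (U n)" "\<And>n. C n \<subseteq> W n" "\<And>n. W n \<subseteq> U n"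
        "\<And>n. measure M (U n - C n) < e / 2 * (1/2) ^ Suc n"
        by metis
      have D: "U n - C n \<in> sets M" for n using op[OF CU(2)] cl[OF CU(1)] by auto
      have geo: "(\<lambda>n. e / 2 * (1/2) ^ Suc n) sums (e / 2)"
        using sums_mult[OF power_half_series, of "e/2"] by simp
      have sm: "summable (\<lambda>n. measure M (U n - C n))"
        using CU(5) by (intro summable_comparison_test[OF _ sums_summable[OF geo]])
          (auto intro!: exI[of _ 0] less_imp_le)
      have "measure M (\<Union>n. U n - C n) \<le> (\<Sum>n. measure M (U n - C n))"
        using D sm by (intro finite_measure_subadditive_countably) auto
      also have "\<dots> \<le> (\<Sum>n. e / 2 * (1/2) ^ Suc n)"
        using CU(5) by (intro suminf_le sm sums_summable[OF geo]) (auto intro: less_imp_le)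
      also have "\<dots> = e / 2" using geo by (rule sums_unique[symmetric])
      finally have m1: "measure M (\<Union>n. U n - C n) \<le> e / 2" .
      let ?U = "\<Union>n. U n"
      have mU: "?U \<in> sets M" using op[OF CU(2)] by blast
      have mC: "(\<Union>i<k. C i) \<in> sets M" for k using cl[OF CU(1)] by blast
      have "(\<lambda>k. measure M (?U - (\<Union>i<k. C i))) \<longlonglongrightarrow> measure M (\<Inter>k. ?U - (\<Union>i<k. C i))"
        using mU mC by (intro finite_Lim_measure_decseq) (auto simp: decseq_def)
      moreover have "measure M (\<Inter>k. ?U - (\<Union>i<k. C i)) < e"
      proof -
        have "(\<Inter>k. ?U - (\<Union>i<k. C i)) \<subseteq> (\<Union>n. U n - C n)"
        proof
          fix y assume y: "y \<in> (\<Inter>k. ?U - (\<Union>i<k. C i))"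
          then obtain n where "y \<in> U n" by auto
          moreover have "y \<notin> C n" using y by (auto dest: spec[of _ "Suc n"])
          ultimately show "y \<in> (\<Union>n. U n - C n)" by blast
        qed
        then have "measure M (\<Inter>k. ?U - (\<Union>i<k. C i)) \<le> measure M (\<Union>n. U n - C n)"
          using D by (intro finite_measure_mono) auto
        then show ?thesis using m1 e by linarith
      qed
      ultimately have "\<forall>\<^sub>F k in sequentially. measure M (?U - (\<Union>i<k. C i)) < e"
        by (rule order_tendstoD(2))
      then obtain k where k: "measure M (?U - (\<Union>i<k. C i)) < e" by (auto simp: eventually_sequentially)
      have "closed (\<Union>i<k. C i)" using CU(1) by (intro closed_UN) auto
      moreover have "open ?U" using CU(2) by blast
      moreover have "(\<Union>i<k. C i) \<subseteq> (\<Union>n. W n)" "(\<Union>n. W n) \<subseteq> ?U" using CU(3,4) by blast+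
      ultimately show "\<exists>C U. closed C \<and> open U \<and> C \<subseteq> (\<Union>n. W n) \<and> (\<Union>n. W n) \<subseteq> U \<and> measure M (U - C) < e"
        using k by blast
    qed
  qed
  with e show ?thesis by blast
qed

lemma closed_subset_positive:
  fixes W :: "'a::metric_space set"
  assumes "finite_measure M" and M: "sets M = sets (borel :: 'a measure)" and W: "W \<in> sets borel"
      and pos: "measure M W > 0"
  obtains C where "closed C" "C \<subseteq> W" "measure M C > 0"
proof -
  interpret finite_measure M by fact
  obtain C U where CU: "closed C" "open U" "C \<subseteq> W" "W \<subseteq> U" "measure M (U - C) < measure M W"
    using closed_open_approximation[OF assms] by blast
  have s: "C \<in> sets M" "U \<in> sets M" "W \<in> sets M" using CU W by (simp_all add: M)
  have "measure M W \<le> measure M (C \<union> (U - C))"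
    using CU s by (intro finite_measure_mono) auto
  also have "\<dots> \<le> measure M C + measure M (U - C)"
    using s by (intro measure_Un_le) auto
  finally have "measure M C > 0" using CU(5) by linarith
  with CU show thesis by (intro that)
qed

section \<open>Optional stopping for a harmonic function\<close>

locale harmonic = right_process h P for h :: "'a::topological_space \<Rightarrow> 'b::metric_space" and P +
  fixes c :: real and \<psi> :: "'a \<Rightarrow> real"
  assumes \<psi>_measurable [measurable]: "\<psi> \<in> borel_measurable borel"
    and \<psi>_pos: "\<psi> x > 0"
    and harmonic: "t > 0 \<Longrightarrow> (\<integral>\<^sup>+\<omega>. ennreal (\<psi> (\<omega> t)) \<partial>P x) = ennreal (exp (c * t) * \<psi> x)"
begin

lemma harmonic_nonneg:
  assumes "t \<ge> 0"
  shows "(\<integral>\<^sup>+\<omega>. ennreal (\<psi> (\<omega> t)) \<partial>P x) = ennreal (exp (c * t) * \<psi> x)"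
proof (cases "t = 0")
  case True
  have "(\<integral>\<^sup>+\<omega>. ennreal (\<psi> (\<omega> 0)) \<partial>P x) = (\<integral>\<^sup>+\<omega>. ennreal (\<psi> x) \<partial>P x)"
    using start[of x] by (intro nn_integral_cong_AE) auto
  then show ?thesis using True P.emeasure_space_1[of x] by simp
next
  case False
  with assms harmonic show ?thesis by simp
qed

text \<open>Optional stopping of \<open>exp (- c * t) * \<psi> (\<omega> t)\<close>, from the strong
  Markov property at T and the semigroup identity over the remaining time N - T; no regularity of
  \<psi> along the path enters.\<close>

lemma harmonic_stopped:
  assumes T: "optional_time T" and A: "A \<in> prior_events T" and TN: "\<And>\<omega>. \<omega> \<in> A \<Longrightarrow> T \<omega> \<le> N"
  shows "(\<integral>\<^sup>+\<omega>\<in>A. ennreal (exp (- c * N) * \<psi> (\<omega> N)) \<partial>P x) =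
    (\<integral>\<^sup>+\<omega>\<in>A. ennreal (exp (- c * T \<omega>) * \<psi> (\<omega> (T \<omega>))) \<partial>P x)"
proof -
  have A_sub: "A \<subseteq> cadlag_paths" using A by (simp add: prior_events_def)
  have T0: "0 \<le> T \<omega>" if "\<omega> \<in> A" for \<omega> using T that A_sub by (auto simp: optional_time_def)
  \<comment> \<open>The terminal value at N as seen from time T; \<open>max 0\<close> makes the
    evaluation total, hence jointly measurable.\<close>
  define \<Phi> where "\<Phi> z = ennreal (exp (- c * N) * \<psi> ((snd z) (max 0 (N - fst z))))"
    for z :: "real \<times> (real \<Rightarrow> 'a)"
  have "(\<lambda>z :: real \<times> (real \<Rightarrow> 'a). (snd z) (max 0 (N - fst z))) \<in>
      borel_measurable (borel \<Otimes>\<^sub>M path_sigma {0..})"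
    by (rule measurable_path_eval[where f="\<lambda>z. max 0 (N - fst z)" and g=snd]) auto
  then have \<Phi>: "\<Phi> \<in> borel_measurable (borel \<Otimes>\<^sub>M path_sigma {0..})"
    unfolding \<Phi>_def by measurable
  have "(\<integral>\<^sup>+\<omega>\<in>A. ennreal (exp (- c * N) * \<psi> (\<omega> N)) \<partial>P x) =
      (\<integral>\<^sup>+\<omega>\<in>A. \<Phi> (T \<omega>, shift (T \<omega>) \<omega>) \<partial>P x)"
    using T0 TN by (intro nn_integral_cong) (simp add: \<Phi>_def shift_apply indicator_def)
  also have "\<dots> = (\<integral>\<^sup>+\<omega>\<in>A. (\<integral>\<^sup>+w. \<Phi> (T \<omega>, w) \<partial>P (\<omega> (T \<omega>))) \<partial>P x)"
    by (rule strong_markov[OF T A \<Phi>])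
  also have "\<dots> = (\<integral>\<^sup>+\<omega>\<in>A. ennreal (exp (- c * T \<omega>) * \<psi> (\<omega> (T \<omega>))) \<partial>P x)"
  proof (rule nn_integral_cong)
    fix \<omega>
    have "(\<integral>\<^sup>+w. \<Phi> (T \<omega>, w) \<partial>P (\<omega> (T \<omega>))) = ennreal (exp (- c * T \<omega>) * \<psi> (\<omega> (T \<omega>)))" if "\<omega> \<in> A"
    proof -
      have tN: "0 \<le> N - T \<omega>" using TN[OF that] by simp
      have m: "(\<lambda>w. ennreal (\<psi> (w (N - T \<omega>)))) \<in> borel_measurable (P (\<omega> (T \<omega>)))"
        using tN measurable_coordinate[of "N - T \<omega>" "{0..}"]
            by (simp add: measurable_cong_sets[OF sets_P refl])
      have "(\<integral>\<^sup>+w. \<Phi> (T \<omega>, w) \<partial>P (\<omega> (T \<omega>))) =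
          (\<integral>\<^sup>+w. ennreal (exp (- c * N)) * ennreal (\<psi> (w (N - T \<omega>))) \<partial>P (\<omega> (T \<omega>)))"
        unfolding \<Phi>_def using tN by (simp add: ennreal_mult' max_def)
      also have "\<dots> = ennreal (exp (- c * N)) * ennreal (exp (c * (N - T \<omega>)) * \<psi> (\<omega> (T \<omega>)))"
        using m by (subst nn_integral_cmult) (simp_all add: harmonic_nonneg[OF tN])
      also have "\<dots> = ennreal (exp (- c * N + c * (N - T \<omega>)) * \<psi> (\<omega> (T \<omega>)))"
        by (simp only: ennreal_mult'[symmetric] exp_ge_zero exp_add mult.assoc)
      also have "- c * N + c * (N - T \<omega>) = - c * T \<omega>" by (simp add: algebra_simps)
      finally show ?thesis .
    qed
    then show "(\<integral>\<^sup>+w. \<Phi> (T \<omega>, w) \<partial>P (\<omega> (T \<omega>))) * indicator A \<omega> =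
        ennreal (exp (- c * T \<omega>) * \<psi> (\<omega> (T \<omega>))) * indicator A \<omega>"
      by (cases "\<omega> \<in> A") simp_all
  qed
  finally show ?thesis .
qed


text \<open>
  Along a sequence of rationals decreasing to \<open>S\<close> the path visits \<open>D\<close>. The first visit to \<open>D\<close> at a time
  of a finite set of rationals in \<open>(S, S + d]\<close> splits the martingale integral over \<open>{S < N}\<close>.
\<close>

lemma visits_split:
  assumes S: "optional_time S" and N: "N > 0" and D: "D \<in> sets borel" and d: "0 < d" "d \<le> 1"
    and io: "AE \<omega> in P x. S \<omega> < N \<longrightarrow> (\<exists>r\<in>\<rat>. S \<omega> < r \<and> r \<le> S \<omega> + d \<and> \<omega> r \<in> D)"
  obtains J B where
    "\<And>m::nat. finite (J m)"
    "\<And>m r. B m r \<in> sets (path_sigma {0..})" "\<And>m r. B m r \<subseteq> {\<omega> \<in> cadlag_paths. S \<omega> < N}"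
    "\<And>m. disjoint_family_on (B m) (J m)"
    "\<And>m r \<omega>. r \<in> J m \<Longrightarrow> \<omega> \<in> B m r \<Longrightarrow> S \<omega> < r \<and> r \<le> S \<omega> + d \<and> \<omega> r \<in> D"
    "\<And>m r. r \<in> J m \<Longrightarrow> (\<integral>\<^sup>+\<omega>\<in>B m r. ennreal (exp (- c * (N + 1)) * \<psi> (\<omega> (N + 1))) \<partial>P x) =
       (\<integral>\<^sup>+\<omega>\<in>B m r. ennreal (exp (- c * r) * \<psi> (\<omega> r)) \<partial>P x)"
    "incseq (\<lambda>m. \<Union>r\<in>J m. B m r)"
    "AE \<omega> in P x. S \<omega> < N \<longrightarrow> (\<exists>m. \<omega> \<in> (\<Union>r\<in>J m. B m r))"
proof -
  define q where "q = from_nat_into (\<rat> :: real set)"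
  have q: "range q = \<rat>" unfolding q_def by (rule range_from_nat_into) (auto simp: countable_rat)
  define J where "J m = q ` {..<m}" for m
  define V where "V r \<omega> \<longleftrightarrow> S \<omega> < r \<and> r \<le> S \<omega> + d \<and> \<omega> r \<in> D" for r \<omega>
  \<comment> \<open>Here r is the first visiting time in \<open>J m\<close>. An earlier r' is at
    most S + d automatically, so this bound is left out of the exclusion.\<close>
  define B where "B m r = {\<omega> \<in> cadlag_paths. S \<omega> < N \<and> V r \<omega> \<and>
      (\<forall>r'\<in>J m. r' < r \<longrightarrow> \<not> (S \<omega> < r' \<and> \<omega> r' \<in> D))}" for m r
  have J_mono: "J m \<subseteq> J (Suc m)" for m by (auto simp: J_def)
  have finJ: "finite (J m)" for m by (simp add: J_def)
  have U: "(\<Union>r\<in>J m. B m r) = {\<omega> \<in> cadlag_paths. S \<omega> < N \<and> (\<exists>r\<in>J m. V r \<omega>)}" for m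
  proof (intro equalityI subsetI)
    fix \<omega> assume "\<omega> \<in> {\<omega> \<in> cadlag_paths. S \<omega> < N \<and> (\<exists>r\<in>J m. V r \<omega>)}"
    then have \<omega>: "\<omega> \<in> cadlag_paths" "S \<omega> < N" and ne: "{r \<in> J m. V r \<omega>} \<noteq> {}" by auto
    define r where "r = Min {r \<in> J m. V r \<omega>}"
    have fin: "finite {r \<in> J m. V r \<omega>}" using finJ[of m] by simp
    have r: "r \<in> J m" "V r \<omega>" using Min_in[OF fin ne] by (simp_all add: r_def)
    have "\<not> V r' \<omega>" if "r' \<in> J m" "r' < r" for r'
      using Min_le[OF fin, of r'] that by (auto simp: r_def)
    then have "\<not> (S \<omega> < r' \<and> \<omega> r' \<in> D)" if "r' \<in> J m" "r' < r" for r'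
      using that r(2) by (auto simp: V_def)
    then have "\<omega> \<in> B m r" using \<omega> r by (simp add: B_def)
    then show "\<omega> \<in> (\<Union>r\<in>J m. B m r)" using r by blast
  qed (auto simp: B_def)
  have S0: "0 \<le> S \<omega>" if "\<omega> \<in> cadlag_paths" for \<omega>
    using S that by (simp add: optional_time_def)
  have Sr: "{\<omega> \<in> cadlag_paths. S \<omega> < s} \<in> sets (path_sigma {0..r})" if "s \<le> r" for s r
  proof (cases "0 < s")
    case True
    then have "{\<omega> \<in> cadlag_paths. S \<omega> < s} \<in> sets (path_sigma {0..s})"
      using S by (simp add: optional_time_def)
    then show ?thesis by (rule path_sigma_mono) (use that in auto)
  next
    case False
    then have "{\<omega> \<in> cadlag_paths. S \<omega> < s} = {}" using S0 by force
    then show ?thesis by (metis sets.empty_sets)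
  qed
  have Dr: "{\<omega> \<in> cadlag_paths. \<omega> s \<in> D} \<in> sets (path_sigma {0..r})" if "0 \<le> s" "s \<le> r" for s r
    using that D by (auto simp: sets_path_sigma intro!: sigma_sets.Basic)
  have Br: "B m r \<in> sets (path_sigma {0..r})" for m r
  proof (cases "r > 0")
    case r: True
    let ?G = "\<lambda>s. {\<omega> \<in> cadlag_paths. S \<omega> < s}"
    let ?W = "\<lambda>s. {\<omega> \<in> cadlag_paths. \<omega> s \<in> D}"
    \<comment> \<open>Every condition is expressed by events known at time r, with S \<ge> r - d as
      a complement. So the piece may be stopped at the constant time r.\<close>
    have "B m r = (?G (min r N) - ?G (r - d)) \<inter> ?W r - (\<Union>r'\<in>{r'\<in>J m. 0 \<le> r' \<and> r' < r}. ?G r' \<inter> ?W r')"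
    proof (rule set_eqI)
      fix \<omega>
      show "\<omega> \<in> B m r \<longleftrightarrow>
          \<omega> \<in> (?G (min r N) - ?G (r - d)) \<inter> ?W r - (\<Union>r'\<in>{r'\<in>J m. 0 \<le> r' \<and> r' < r}. ?G r' \<inter> ?W r')"
        using S0[of \<omega>] by (cases "\<omega> \<in> cadlag_paths") (auto simp: B_def V_def)
    qed
    also have "\<dots> \<in> sets (path_sigma {0..r})"
      using r d finJ[of m] by (intro sets.Diff sets.Int sets.finite_UN Sr Dr) auto
    finally show ?thesis .
  next
    case False
    then have "B m r = {}" using S0 by (force simp: B_def V_def)
    then show ?thesis by simp
  qed
  show thesis
  proof (rule that[of J B])
    show "finite (J m)" for m by (rule finJ)
    show "B m r \<in> sets (path_sigma {0..})" for m r by (rule path_sigma_mono[OF Br]) auto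
    show "B m r \<subseteq> {\<omega> \<in> cadlag_paths. S \<omega> < N}" for m r by (auto simp: B_def)
    show "disjoint_family_on (B m) (J m)" for m
      unfolding disjoint_family_on_def
    proof (intro ballI impI)
      fix r r' assume "r \<in> J m" "r' \<in> J m" "r \<noteq> r'"
      then show "B m r \<inter> B m r' = {}"
        by (cases r r' rule: linorder_cases) (auto simp: B_def V_def)
    qed
    show "S \<omega> < r \<and> r \<le> S \<omega> + d \<and> \<omega> r \<in> D" if "\<omega> \<in> B m r" for m r \<omega>
      using that by (simp add: B_def V_def)
    show "incseq (\<lambda>m. \<Union>r\<in>J m. B m r)"
    proof (rule incseq_SucI)
      fix m show "(\<Union>r\<in>J m. B m r) \<subseteq> (\<Union>r\<in>J (Suc m). B (Suc m) r)"
        unfolding U using J_mono[of m] by blast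
    qed
    show "AE \<omega> in P x. S \<omega> < N \<longrightarrow> (\<exists>m. \<omega> \<in> (\<Union>r\<in>J m. B m r))"
    proof (rule AE_mp[OF io], rule AE_I2, intro impI)
      fix \<omega> assume \<omega>: "\<omega> \<in> space (P x)" and SN: "S \<omega> < N"
        and imp: "S \<omega> < N \<longrightarrow> (\<exists>r\<in>\<rat>. S \<omega> < r \<and> r \<le> S \<omega> + d \<and> \<omega> r \<in> D)"
      have "\<exists>r\<in>\<rat>. V r \<omega>" unfolding V_def by (rule mp[OF imp SN])
      then obtain r where r: "r \<in> \<rat>" "V r \<omega>" ..
      obtain i where "r = q i" using r(1) unfolding q[symmetric] ..
      then have "r \<in> J (Suc i)" by (simp add: J_def)
      with r(2) have "\<exists>r\<in>J (Suc i). V r \<omega>" ..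
      then have "\<omega> \<in> (\<Union>r\<in>J (Suc i). B (Suc i) r)" unfolding U using \<omega> SN by simp
      then show "\<exists>m. \<omega> \<in> (\<Union>r\<in>J m. B m r)" ..
    qed
    fix m r
    show "(\<integral>\<^sup>+\<omega>\<in>B m r. ennreal (exp (- c * (N + 1)) * \<psi> (\<omega> (N + 1))) \<partial>P x) =
       (\<integral>\<^sup>+\<omega>\<in>B m r. ennreal (exp (- c * r) * \<psi> (\<omega> r)) \<partial>P x)"
    \<comment> \<open>On a nonempty piece r \<le> S + d and S < N, with d \<le> 1; this is where the
      common horizon N + 1 comes from.\<close>
    proof (cases "B m r = {}")
      case False
      then obtain \<omega> where \<omega>: "\<omega> \<in> B m r" by blast
      then have "0 \<le> S \<omega>" using S0 by (simp add: B_def)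
      then have "0 \<le> r" "r \<le> N + 1" using \<omega> d by (auto simp: B_def V_def)
      then show ?thesis
        by (intro harmonic_stopped[OF optional_time_const prior_events_const[OF Br]])
    qed simp
  qed
qed

end

context harmonic
begin

text \<open>The discounted mass of \<open>S < N\<close>, that is, the stopped integral with \<psi>
  replaced by 1. Bounds on \<psi> at S and just after S become multiples of it.\<close>

definition stopped_mass :: "'a \<Rightarrow> ((real \<Rightarrow> 'a) \<Rightarrow> real) \<Rightarrow> real \<Rightarrow> ennreal" where
  "stopped_mass x S N = (\<integral>\<^sup>+\<omega>\<in>{\<omega> \<in> cadlag_paths. S \<omega> < N}. ennreal (exp (- c * S \<omega>)) \<partial>P x)"

lemma optional_time_lt_prior:
  assumes "optional_time S" shows "{\<omega> \<in> cadlag_paths. S \<omega> < N} \<in> prior_events S"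
proof -
  have "{\<omega> \<in> cadlag_paths. S \<omega> \<in> {..<N}} \<in> prior_events S"
    by (rule prior_events_Int_time[OF assms cadlag_paths_prior[OF assms]]) simp
  then show ?thesis by simp
qed

text \<open>By stopping, the integral at S equals the one at N + 1, and the latter splits over the
  first visits to D. There \<psi> is bounded by a or b, and moving the discount from r back to S
  costs a factor of at most \<open>exp (\<bar>c\<bar> * d)\<close>.\<close>

lemma visits_bounds:
  assumes S: "optional_time S" and N: "N > 0" and D: "D \<in> sets borel" and d: "0 < d" "d \<le> 1"
    and io: "AE \<omega> in P x. S \<omega> < N \<longrightarrow> (\<exists>r\<in>\<rat>. S \<omega> < r \<and> r \<le> S \<omega> + d \<and> \<omega> r \<in> D)"
  shows "(\<forall>y\<in>D. \<psi> y \<le> a) \<longrightarrow>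
      (\<integral>\<^sup>+\<omega>\<in>{\<omega> \<in> cadlag_paths. S \<omega> < N}. ennreal (exp (- c * S \<omega>) * \<psi> (\<omega> (S \<omega>))) \<partial>P x) \<le>
      ennreal (exp (\<bar>c\<bar> * d) * a) * stopped_mass x S N" (is "_ \<longrightarrow> ?U")
    and "(\<forall>y\<in>D. b \<le> \<psi> y) \<longrightarrow>
      ennreal (exp (- \<bar>c\<bar> * d) * b) * stopped_mass x S N \<le>
      (\<integral>\<^sup>+\<omega>\<in>{\<omega> \<in> cadlag_paths. S \<omega> < N}. ennreal (exp (- c * S \<omega>) * \<psi> (\<omega> (S \<omega>))) \<partial>P x)"
    (is "_ \<longrightarrow> ?L")
proof -
  obtain J B where J: "\<And>m::nat. finite (J m)"
    and Bm: "\<And>m r. B m r \<in> sets (path_sigma {0..})"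
    and BG: "\<And>m r. B m r \<subseteq> {\<omega> \<in> cadlag_paths. S \<omega> < N}"
    and disj: "\<And>m. disjoint_family_on (B m) (J m)"
    and V: "\<And>m r \<omega>. r \<in> J m \<Longrightarrow> \<omega> \<in> B m r \<Longrightarrow> S \<omega> < r \<and> r \<le> S \<omega> + d \<and> \<omega> r \<in> D"
    and mart: "\<And>m r. r \<in> J m \<Longrightarrow> (\<integral>\<^sup>+\<omega>\<in>B m r. ennreal (exp (- c * (N + 1)) * \<psi> (\<omega> (N + 1))) \<partial>P x) =
       (\<integral>\<^sup>+\<omega>\<in>B m r. ennreal (exp (- c * r) * \<psi> (\<omega> r)) \<partial>P x)"
    and inc: "incseq (\<lambda>m. \<Union>r\<in>J m. B m r)"
    and exh: "AE \<omega> in P x. S \<omega> < N \<longrightarrow> (\<exists>m. \<omega> \<in> (\<Union>r\<in>J m. B m r))"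
    by (rule visits_split[OF assms]) blast
  define G where "G = {\<omega> \<in> cadlag_paths. S \<omega> < N}"
  define F where "F m = (\<Union>r\<in>J m. B m r)" for m
  define X where "X \<omega> = ennreal (exp (- c * (N + 1)) * \<psi> (\<omega> (N + 1)))" for \<omega>
  define E where "E \<omega> = ennreal (exp (- c * S \<omega>))" for \<omega>
  note Bm[measurable]
  have [measurable]: "F m \<in> sets (path_sigma {0..})" for m
    unfolding F_def using J by (intro sets.finite_UN Bm)
  have [measurable]: "S \<in> borel_measurable (path_sigma {0..})" by (rule optional_time_measurable[OF S])
  have [measurable]: "G \<in> sets (path_sigma {0..})"
    unfolding G_def by (rule prior_events_measurable[OF optional_time_lt_prior[OF S]])
  have [measurable]: "(\<lambda>\<omega> :: real \<Rightarrow> 'a. \<omega> (N + 1)) \<in> borel_measurable (path_sigma {0..})"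
    using N by (intro measurable_coordinate) simp
  have X[measurable]: "X \<in> borel_measurable (path_sigma {0..})" unfolding X_def by measurable
  have E[measurable]: "E \<in> borel_measurable (path_sigma {0..})" unfolding E_def by measurable
  have FG: "F m \<subseteq> G" for m using BG unfolding F_def G_def by blast
  have incF: "incseq F" using inc by (simp add: F_def[abs_def])
  have split: "(\<integral>\<^sup>+\<omega>\<in>F m. f \<omega> \<partial>P x) = (\<Sum>r\<in>J m. \<integral>\<^sup>+\<omega>\<in>B m r. f \<omega> \<partial>P x)"
    if [measurable]: "f \<in> borel_measurable (path_sigma {0..})" for f m
  proof -
    have "indicator (F m) \<omega> = (\<Sum>r\<in>J m. indicator (B m r) \<omega> :: ennreal)" for \<omega>
      unfolding F_def by (rule indicator_UN_disjoint[OF J disj])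
    then have "(\<integral>\<^sup>+\<omega>\<in>F m. f \<omega> \<partial>P x) = (\<integral>\<^sup>+\<omega>. (\<Sum>r\<in>J m. f \<omega> * indicator (B m r) \<omega>) \<partial>P x)"
      by (simp add: sum_distrib_left)
    also have "\<dots> = (\<Sum>r\<in>J m. \<integral>\<^sup>+\<omega>\<in>B m r. f \<omega> \<partial>P x)"
      by (intro nn_integral_sum) measurable
    finally show ?thesis .
  qed
  have sup: "(\<integral>\<^sup>+\<omega>\<in>G. f \<omega> \<partial>P x) = (SUP m. \<integral>\<^sup>+\<omega>\<in>F m. f \<omega> \<partial>P x)"
    if [measurable]: "f \<in> borel_measurable (path_sigma {0..})" for f
  proof -
    have "(SUP m. \<integral>\<^sup>+\<omega>\<in>F m. f \<omega> \<partial>P x) = (\<integral>\<^sup>+\<omega>. (SUP m. f \<omega> * indicator (F m) \<omega>) \<partial>P x)"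
    proof (rule nn_integral_monotone_convergence_SUP[symmetric])
      show "incseq (\<lambda>m \<omega>. f \<omega> * indicator (F m) \<omega>)"
        using incF by (auto simp: incseq_def le_fun_def indicator_def)
    qed measurable
    also have "\<dots> = (\<integral>\<^sup>+\<omega>\<in>G. f \<omega> \<partial>P x)"
    proof (rule nn_integral_cong_AE, rule AE_mp[OF exh], rule AE_I2, rule impI)
      fix \<omega> assume \<omega>: "\<omega> \<in> space (P x)" and imp: "S \<omega> < N \<longrightarrow> (\<exists>m. \<omega> \<in> (\<Union>r\<in>J m. B m r))"
      show "(SUP m. f \<omega> * indicator (F m) \<omega>) = f \<omega> * indicator G \<omega>"
      proof (cases "\<omega> \<in> G")
        case True
        then obtain m where m: "\<omega> \<in> F m" using imp by (auto simp: G_def F_def)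
        have "(SUP m. f \<omega> * indicator (F m) \<omega>) = f \<omega>"
        proof (rule antisym)
          show "(SUP m. f \<omega> * indicator (F m) \<omega>) \<le> f \<omega>"
            by (rule SUP_least) (simp add: indicator_def)
          show "f \<omega> \<le> (SUP m. f \<omega> * indicator (F m) \<omega>)"
            using m by (intro SUP_upper2[of m]) simp_all
        qed
        then show ?thesis using True by simp
      next
        case False
        then have "\<omega> \<notin> F m" for m using FG by blast
        then show ?thesis using False by simp
      qed
    qed
    finally show ?thesis by simp
  qed
  have total: "(\<integral>\<^sup>+\<omega>\<in>G. ennreal (exp (- c * S \<omega>) * \<psi> (\<omega> (S \<omega>))) \<partial>P x) = (\<integral>\<^sup>+\<omega>\<in>G. X \<omega> \<partial>P x)"
    unfolding X_def G_def by (rule harmonic_stopped[OF S optional_time_lt_prior[OF S], symmetric]) simp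
  have mass: "stopped_mass x S N = (\<integral>\<^sup>+\<omega>\<in>G. E \<omega> \<partial>P x)"
    by (simp add: stopped_mass_def G_def E_def)
  have close: "\<bar>c * r - c * S \<omega>\<bar> \<le> \<bar>c\<bar> * d" if "r \<in> J m" "\<omega> \<in> B m r" for r m \<omega>
  proof -
    have "\<bar>r - S \<omega>\<bar> \<le> d" using V[OF that] by linarith
    then have "\<bar>c\<bar> * \<bar>r - S \<omega>\<bar> \<le> \<bar>c\<bar> * d" by (intro mult_left_mono) auto
    then show ?thesis by (simp add: abs_mult[symmetric] right_diff_distrib)
  qed
  have Fm: "(\<integral>\<^sup>+\<omega>\<in>F m. X \<omega> \<partial>P x) = (\<Sum>r\<in>J m. \<integral>\<^sup>+\<omega>\<in>B m r. ennreal (exp (- c * r) * \<psi> (\<omega> r)) \<partial>P x)" for m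
    unfolding split[OF X] unfolding X_def by (rule sum.cong[OF refl mart])
  show "(\<forall>y\<in>D. \<psi> y \<le> a) \<longrightarrow> ?U"
  proof
    assume up: "\<forall>y\<in>D. \<psi> y \<le> a"
    have "(\<integral>\<^sup>+\<omega>\<in>F m. X \<omega> \<partial>P x) \<le> ennreal (exp (\<bar>c\<bar> * d) * a) * (\<integral>\<^sup>+\<omega>\<in>G. E \<omega> \<partial>P x)" for m
    proof -
      have "(\<integral>\<^sup>+\<omega>\<in>F m. X \<omega> \<partial>P x) \<le> (\<Sum>r\<in>J m. \<integral>\<^sup>+\<omega>\<in>B m r. ennreal (exp (\<bar>c\<bar> * d) * a) * E \<omega> \<partial>P x)"
        unfolding Fm
      proof (intro sum_mono nn_integral_mono)
        fix r \<omega> assume r: "r \<in> J m"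
        show "ennreal (exp (- c * r) * \<psi> (\<omega> r)) * indicator (B m r) \<omega> \<le>
            ennreal (exp (\<bar>c\<bar> * d) * a) * E \<omega> * indicator (B m r) \<omega>"
        proof (cases "\<omega> \<in> B m r")
          case True
          have le: "\<psi> (\<omega> r) \<le> a" using V[OF r True] up by blast
          then have a: "0 \<le> a" using \<psi>_pos[of "\<omega> r"] by linarith
          have "- c * r \<le> \<bar>c\<bar> * d + - c * S \<omega>" using close[OF r True] by (simp add: abs_le_iff)
          then have "exp (- c * r) \<le> exp (\<bar>c\<bar> * d) * exp (- c * S \<omega>)"
            unfolding exp_add[symmetric] by simp
          then have "exp (- c * r) * \<psi> (\<omega> r) \<le> (exp (\<bar>c\<bar> * d) * exp (- c * S \<omega>)) * a"
            using le \<psi>_pos[of "\<omega> r"] by (intro mult_mono) auto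
          then have "ennreal (exp (- c * r) * \<psi> (\<omega> r)) \<le> ennreal ((exp (\<bar>c\<bar> * d) * a) * exp (- c * S \<omega>))"
            by (intro ennreal_leI) (simp add: mult_ac)
          also have "\<dots> = ennreal (exp (\<bar>c\<bar> * d) * a) * E \<omega>"
            unfolding E_def using a by (subst ennreal_mult) auto
          finally show ?thesis using True by simp
        qed simp
      qed
      also have "\<dots> = (\<integral>\<^sup>+\<omega>\<in>F m. ennreal (exp (\<bar>c\<bar> * d) * a) * E \<omega> \<partial>P x)"
        by (rule split[symmetric]) measurable
      also have "\<dots> \<le> (\<integral>\<^sup>+\<omega>\<in>G. ennreal (exp (\<bar>c\<bar> * d) * a) * E \<omega> \<partial>P x)"
        using FG by (intro nn_integral_mono) (auto simp: indicator_def)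
      also have "\<dots> = ennreal (exp (\<bar>c\<bar> * d) * a) * (\<integral>\<^sup>+\<omega>\<in>G. E \<omega> \<partial>P x)"
        unfolding mult.assoc by (rule nn_integral_cmult) measurable
      finally show ?thesis .
    qed
    then show ?U unfolding G_def[symmetric] total mass sup[OF X] by (rule SUP_least)
  qed
  show "(\<forall>y\<in>D. b \<le> \<psi> y) \<longrightarrow> ?L"
  proof
    assume low: "\<forall>y\<in>D. b \<le> \<psi> y"
    have "ennreal (exp (- \<bar>c\<bar> * d) * b) * (\<integral>\<^sup>+\<omega>\<in>F m. E \<omega> \<partial>P x) \<le> (\<integral>\<^sup>+\<omega>\<in>F m. X \<omega> \<partial>P x)" for m
    proof -
      have "ennreal (exp (- \<bar>c\<bar> * d) * b) * (\<integral>\<^sup>+\<omega>\<in>F m. E \<omega> \<partial>P x) =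
          (\<integral>\<^sup>+\<omega>\<in>F m. ennreal (exp (- \<bar>c\<bar> * d) * b) * E \<omega> \<partial>P x)"
        unfolding mult.assoc by (rule nn_integral_cmult[symmetric]) measurable
      also have "\<dots> = (\<Sum>r\<in>J m. \<integral>\<^sup>+\<omega>\<in>B m r. ennreal (exp (- \<bar>c\<bar> * d) * b) * E \<omega> \<partial>P x)"
        by (rule split) measurable
      also have "\<dots> \<le> (\<integral>\<^sup>+\<omega>\<in>F m. X \<omega> \<partial>P x)"
        unfolding Fm
      proof (intro sum_mono nn_integral_mono)
        fix r \<omega> assume r: "r \<in> J m"
        show "ennreal (exp (- \<bar>c\<bar> * d) * b) * E \<omega> * indicator (B m r) \<omega> \<le>
            ennreal (exp (- c * r) * \<psi> (\<omega> r)) * indicator (B m r) \<omega>"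
        proof (cases "\<omega> \<in> B m r")
          case True
          have le: "b \<le> \<psi> (\<omega> r)" using V[OF r True] low by blast
          have "- \<bar>c\<bar> * d + - c * S \<omega> \<le> - c * r" using close[OF r True] by (simp add: abs_le_iff)
          then have "exp (- \<bar>c\<bar> * d) * exp (- c * S \<omega>) \<le> exp (- c * r)"
            unfolding exp_add[symmetric] by simp
          \<comment> \<open>If b is negative, \<open>ennreal\<close> truncates the lower bound to 0;
            \<open>max 0 b\<close> mirrors this on the reals.\<close>
          then have "(exp (- \<bar>c\<bar> * d) * exp (- c * S \<omega>)) * max 0 b \<le> exp (- c * r) * \<psi> (\<omega> r)"
            using le \<psi>_pos[of "\<omega> r"] by (intro mult_mono) auto
          then have "ennreal ((exp (- \<bar>c\<bar> * d) * exp (- c * S \<omega>)) * max 0 b) \<le> ennreal (exp (- c *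
              r) * \<psi> (\<omega> r))"
            by (rule ennreal_leI)
          moreover have "ennreal ((exp (- \<bar>c\<bar> * d) * exp (- c * S \<omega>)) * max 0 b) =
              ennreal (exp (- \<bar>c\<bar> * d) * b) * E \<omega>"
          proof (cases "b \<ge> 0")
            case True
            then show ?thesis by (simp add: E_def ennreal_mult'[symmetric] mult_ac max_def)
          next
            case False
            then have "exp (- \<bar>c\<bar> * d) * b \<le> 0" by (intro mult_nonneg_nonpos) auto
            then have "ennreal (exp (- \<bar>c\<bar> * d) * b) = 0" by (rule ennreal_neg)
            with False show ?thesis by (simp add: max_def)
          qed
          ultimately show ?thesis using True by simp
        qed simp
      qed
      finally show ?thesis .
    qed
    then have "(SUP m. ennreal (exp (- \<bar>c\<bar> * d) * b) * (\<integral>\<^sup>+\<omega>\<in>F m. E \<omega> \<partial>P x)) \<le>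
        (SUP m. \<integral>\<^sup>+\<omega>\<in>F m. X \<omega> \<partial>P x)"
      by (intro SUP_mono) auto
    then show ?L unfolding G_def[symmetric] total mass sup[OF X] sup[OF E] SUP_mult_left_ennreal .
  qed
qed

text \<open>Allows \<open>stopped_mass\<close> to be cancelled from inequalities between its
  multiples.\<close>

lemma stopped_mass_bounds:
  assumes S: "optional_time S" and pos: "emeasure (P x) {\<omega> \<in> cadlag_paths. S \<omega> < N} \<noteq> 0"
  shows "0 < stopped_mass x S N" "stopped_mass x S N < \<infinity>"
proof -
  have [measurable]: "S \<in> borel_measurable (path_sigma {0..})" by (rule optional_time_measurable[OF S])
  define G where "G = {\<omega> \<in> cadlag_paths. S \<omega> < N}"
  have G[measurable]: "G \<in> sets (path_sigma {0..})"
    unfolding G_def by (rule prior_events_measurable[OF optional_time_lt_prior[OF S]])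
  have "stopped_mass x S N \<noteq> 0"
  proof
    assume "stopped_mass x S N = 0"
    moreover have "(\<lambda>\<omega>. ennreal (exp (- c * S \<omega>)) * indicator G \<omega>) \<in> borel_measurable (P x)"
      by measurable
    ultimately have "AE \<omega> in P x. ennreal (exp (- c * S \<omega>)) * indicator G \<omega> = 0"
      unfolding stopped_mass_def G_def[symmetric] by (simp only: nn_integral_0_iff_AE)
    then have "AE \<omega> in P x. \<omega> \<notin> G"
      by (rule AE_mp) (simp add: indicator_def)
    moreover have "{\<omega> \<in> space (P x). \<not> \<omega> \<notin> G} = G" by (auto simp: G_def)
    ultimately have "emeasure (P x) G = 0"
      using AE_iff_measurable[of G "P x" "\<lambda>\<omega>. \<omega> \<notin> G"] G by (simp add: sets_P)
    with pos show False by (simp add: G_def)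
  qed
  then show "0 < stopped_mass x S N" by (simp add: zero_less_iff_neq_zero)
  have "stopped_mass x S N \<le> (\<integral>\<^sup>+\<omega>. ennreal (exp (\<bar>c\<bar> * \<bar>N\<bar>)) \<partial>P x)"
    unfolding stopped_mass_def
  proof (rule nn_integral_mono)
    fix \<omega>
    show "ennreal (exp (- c * S \<omega>)) * indicator {\<omega> \<in> cadlag_paths. S \<omega> < N} \<omega> \<le>
        ennreal (exp (\<bar>c\<bar> * \<bar>N\<bar>))"
    proof (cases "\<omega> \<in> cadlag_paths \<and> S \<omega> < N")
      case True
      then have "0 \<le> S \<omega>" "\<bar>S \<omega>\<bar> \<le> \<bar>N\<bar>" using S by (auto simp: optional_time_def)
      then have "\<bar>c\<bar> * \<bar>S \<omega>\<bar> \<le> \<bar>c\<bar> * \<bar>N\<bar>" by (intro mult_left_mono) auto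
      then have "- c * S \<omega> \<le> \<bar>c\<bar> * \<bar>N\<bar>" by (metis abs_le_D2 abs_mult mult_minus_left)
      then show ?thesis using True by simp
    qed auto
  qed
  also have "\<dots> = ennreal (exp (\<bar>c\<bar> * \<bar>N\<bar>))" using P.emeasure_space_1[of x] by simp
  also have "\<dots> < \<infinity>" by simp
  finally show "stopped_mass x S N < \<infinity>" .
qed

end

section \<open>Stopping times located at a hit of a closed set\<close>

definition rational_visits :: "'a set \<Rightarrow> (real \<Rightarrow> 'a) \<Rightarrow> real \<Rightarrow> bool" where
  "rational_visits D \<omega> t \<longleftrightarrow> (\<forall>\<delta>>0. \<exists>r\<in>\<rat>. t < r \<and> r < t + \<delta> \<and> \<omega> r \<in> D)"

lemma rational_exists: "a < b \<Longrightarrow> \<exists>q\<in>\<rat>. a < q \<and> q < (b::real)"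
  using Rats_dense_in_real by blast

context right_process
begin

definition closed_hits :: "'b set \<Rightarrow> 'a set \<Rightarrow> real \<Rightarrow> (real \<Rightarrow> 'a) \<Rightarrow> real \<Rightarrow> bool" where
  "closed_hits C D N \<omega> t \<longleftrightarrow> 0 \<le> t \<and> t < N \<and> h (\<omega> t) \<in> C \<and> rational_visits D \<omega> t"

text \<open>The infimum of the hits is not visibly an optional time, so it is approached from below
  through the optional times that precede all hits.\<close>

definition precedes_hits :: "'b set \<Rightarrow> 'a set \<Rightarrow> real \<Rightarrow> ((real \<Rightarrow> 'a) \<Rightarrow> real) \<Rightarrow> bool" where
  "precedes_hits C D N S \<longleftrightarrow> optional_time S \<and>
     (\<forall>\<omega>\<in>cadlag_paths. S \<omega> \<le> N \<and> (\<forall>t. closed_hits C D N \<omega> t \<longrightarrow> S \<omega> \<le> t))"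

lemma tendsto_h_right:
  assumes "\<omega> \<in> cadlag_paths" "0 \<le> t"
  shows "((\<lambda>s. h (\<omega> s)) \<longlongrightarrow> h (\<omega> t)) (at_right t)"
  using assms by (intro continuous_on_tendsto_compose[OF continuous_h]) (auto simp: cadlag_paths_def)

text \<open>A rational q strictly between the supremum and r bounds all terms uniformly; that every
  term is below r would only bound the supremum by r.\<close>

lemma optional_time_SUP:
  assumes S: "\<And>n::nat. optional_time (S n)" and le: "\<And>n \<omega>. \<omega> \<in> cadlag_paths \<Longrightarrow> S n \<omega> \<le> N"
  shows "optional_time (\<lambda>\<omega>. SUP n. S n \<omega>)"
  unfolding optional_time_def
proof (intro conjI ballI allI impI)
  have bdd: "bdd_above (range (\<lambda>n. S n \<omega>))" if "\<omega> \<in> cadlag_paths" for \<omega>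
    using le[OF that] by (auto simp: bdd_above_def)
  have S0: "0 \<le> S n \<omega>" if "\<omega> \<in> cadlag_paths" for n \<omega>
    using S[of n] that by (simp add: optional_time_def)
  show "0 \<le> (SUP n. S n \<omega>)" if "\<omega> \<in> cadlag_paths" for \<omega>
    using S0[OF that, of 0] cSUP_upper[OF _ bdd[OF that], of 0] by simp
  fix r :: real assume "r > 0"
  have sets: "{\<omega> \<in> cadlag_paths. S n \<omega> < q} \<in> sets (path_sigma {0..r})" if "0 < q" "q < r" for n q
  proof (rule path_sigma_mono)
    show "{\<omega> \<in> cadlag_paths. S n \<omega> < q} \<in> sets (path_sigma {0..q})"
      using S[of n] that by (simp add: optional_time_def)
  qed (use that in auto)
  have "{\<omega> \<in> cadlag_paths. (SUP n. S n \<omega>) < r} = (\<Union>q\<in>{q\<in>\<rat>. 0 < q \<and> q < r}. \<Inter>n. {\<omega> \<in>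
      cadlag_paths. S n \<omega> < q})"
  proof (intro equalityI subsetI)
    fix \<omega> assume "\<omega> \<in> {\<omega> \<in> cadlag_paths. (SUP n. S n \<omega>) < r}"
    then have \<omega>: "\<omega> \<in> cadlag_paths" "(SUP n. S n \<omega>) < r" by auto
    then obtain q where q: "q \<in> \<rat>" "(SUP n. S n \<omega>) < q" "q < r" using rational_exists by blast
    have "S n \<omega> < q" for n
      using cSUP_upper[OF _ bdd[OF \<omega>(1)], of n] q(2) by (auto intro: le_less_trans)
    moreover from this[of 0] S0[OF \<omega>(1), of 0] have "0 < q" by linarith
    ultimately show "\<omega> \<in> (\<Union>q\<in>{q\<in>\<rat>. 0 < q \<and> q < r}. \<Inter>n. {\<omega> \<in> cadlag_paths. S n \<omega> < q})"
      using q \<omega> by auto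
  next
    fix \<omega> assume "\<omega> \<in> (\<Union>q\<in>{q\<in>\<rat>. 0 < q \<and> q < r}. \<Inter>n. {\<omega> \<in> cadlag_paths. S n \<omega> < q})"
    then obtain q where q: "q < r" "\<And>n. \<omega> \<in> cadlag_paths \<and> S n \<omega> < q" by auto
    then have "(SUP n. S n \<omega>) \<le> q" by (intro cSUP_least) (auto intro: less_imp_le)
    then show "\<omega> \<in> {\<omega> \<in> cadlag_paths. (SUP n. S n \<omega>) < r}" using q by auto
  qed
  also have "\<dots> \<in> sets (path_sigma {0..r})"
  proof (rule sets.countable_UN'')
    show "countable {q\<in>\<rat>. 0 < q \<and> q < r}" using countable_rat by (rule countable_subset[rotated]) auto
    show "(\<Inter>n. {\<omega> \<in> cadlag_paths. S n \<omega> < q}) \<in> sets (path_sigma {0..r})"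
      if "q \<in> {q\<in>\<rat>. 0 < q \<and> q < r}" for q
      using sets[of q] that by (intro sets.countable_INT) auto
  qed
  finally show "{\<omega> \<in> cadlag_paths. (SUP n. S n \<omega>) < r} \<in> sets (path_sigma {0..r})" .
qed

definition approach_set ::
  "'b set \<Rightarrow> 'a set \<Rightarrow> real \<Rightarrow> ((real \<Rightarrow> 'a) \<Rightarrow> real) \<Rightarrow> nat \<Rightarrow> (real \<Rightarrow> 'a) \<Rightarrow> real set" where
  "approach_set C D N S n \<omega> =
     {q\<in>\<rat>. S \<omega> < q \<and> q < N \<and> infdist (h (\<omega> q)) C < 1 / real (Suc n) \<and> \<omega> q \<in> D}"

text \<open>Inserting N keeps the set nonempty and the time at most N.\<close>

definition approach_time ::
  "'b set \<Rightarrow> 'a set \<Rightarrow> real \<Rightarrow> ((real \<Rightarrow> 'a) \<Rightarrow> real) \<Rightarrow> nat \<Rightarrow> (real \<Rightarrow> 'a) \<Rightarrow> real" where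
  "approach_time C D N S n \<omega> = Inf (insert N (approach_set C D N S n \<omega>))"

lemma approach_time_less_iff:
  assumes "optional_time S" "\<omega> \<in> cadlag_paths" "0 \<le> N"
  shows "approach_time C D N S n \<omega> < r \<longleftrightarrow> N < r \<or> (\<exists>q\<in>approach_set C D N S n \<omega>. q < r)"
proof -
  have "0 \<le> S \<omega>" using assms by (simp add: optional_time_def)
  then have "bdd_below (insert N (approach_set C D N S n \<omega>))"
    unfolding bdd_below_def using assms by (intro exI[of _ 0]) (auto simp: approach_set_def)
  then show ?thesis unfolding approach_time_def by (subst cInf_less_iff) auto
qed

text \<open>Right after a hit t, the path is near C by right-continuity and visits D at rational
  times, all of them later than S since S \<le> t. So t is a limit of approach points: the approach
  time lies between S and every hit.\<close>

lemma approach_time_precedes: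
  assumes C: "closed C" "C \<noteq> {}" and D: "D \<in> sets borel" and N: "N > 0" and S: "precedes_hits C D N S"
  shows "precedes_hits C D N (approach_time C D N S n)"
    and "\<omega> \<in> cadlag_paths \<Longrightarrow> S \<omega> \<le> approach_time C D N S n \<omega>"
proof -
  let ?T = "approach_time C D N S n"
  have optS: "optional_time S" using S by (simp add: precedes_hits_def)
  note less = approach_time_less_iff[OF optS _ less_imp_le[OF N]]
  have S0: "0 \<le> S \<omega>" if "\<omega> \<in> cadlag_paths" for \<omega>
    using optS that by (simp add: optional_time_def)
  show ST: "S \<omega> \<le> ?T \<omega>" if "\<omega> \<in> cadlag_paths" for \<omega>
  proof (rule ccontr)
    assume "\<not> S \<omega> \<le> ?T \<omega>"
    then have "?T \<omega> < S \<omega>" by simp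
    moreover have "S \<omega> \<le> N" using S that by (simp add: precedes_hits_def)
    ultimately show False unfolding less[OF that] by (auto simp: approach_set_def)
  qed
  have opt: "optional_time ?T"
    unfolding optional_time_def
  proof (intro conjI ballI allI impI)
    show "0 \<le> ?T \<omega>" if "\<omega> \<in> cadlag_paths" for \<omega> using ST[OF that] S0[OF that] by linarith
    fix r :: real assume r: "0 < r"
    show "{\<omega> \<in> cadlag_paths. ?T \<omega> < r} \<in> sets (path_sigma {0..r})"
    proof (cases "N < r")
      case True
      then have "{\<omega> \<in> cadlag_paths. ?T \<omega> < r} = cadlag_paths" using less by blast
      then show ?thesis by simp
    next
      case False
      let ?I = "{q\<in>\<rat>. 0 < q \<and> q < r \<and> q < N}"
      let ?W = "{y. infdist (h y) C < 1 / real (Suc n)} \<inter> D"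
      have eq: "{\<omega> \<in> cadlag_paths. ?T \<omega> < r} =
          (\<Union>q\<in>?I. {\<omega> \<in> cadlag_paths. S \<omega> < q} \<inter> {\<omega> \<in> cadlag_paths. \<omega> q \<in> ?W})"
      proof (rule set_eqI)
        fix \<omega>
        show "\<omega> \<in> {\<omega> \<in> cadlag_paths. ?T \<omega> < r} \<longleftrightarrow>
            \<omega> \<in> (\<Union>q\<in>?I. {\<omega> \<in> cadlag_paths. S \<omega> < q} \<inter> {\<omega> \<in> cadlag_paths. \<omega> q \<in> ?W})"
          using False S0[of \<omega>] less[of \<omega>]
          by (cases "\<omega> \<in> cadlag_paths") (auto simp: approach_set_def)
      qed
      have "(\<lambda>y. infdist (h y) C) \<in> borel_measurable borel"
        by (intro borel_measurable_continuous_onI continuous_on_infdist continuous_h)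
      then have W: "?W \<in> sets borel" using D by measurable
      have "{\<omega> \<in> cadlag_paths. S \<omega> < q} \<inter> {\<omega> \<in> cadlag_paths. \<omega> q \<in> ?W} \<in> sets (path_sigma {0..r})"
        if "0 < q" "q < r" for q
      proof (rule path_sigma_mono[of _ "{0..q}"], rule sets.Int)
        show "{\<omega> \<in> cadlag_paths. S \<omega> < q} \<in> sets (path_sigma {0..q})"
          using optS that by (simp add: optional_time_def)
        show "{\<omega> \<in> cadlag_paths. \<omega> q \<in> ?W} \<in> sets (path_sigma {0..q})"
          unfolding sets_path_sigma
        proof (rule sigma_sets.Basic, rule CollectI)
          have "q \<in> {0..q}" using that by simp
          with W show "\<exists>s A. {\<omega> \<in> cadlag_paths. \<omega> q \<in> ?W} = {\<omega> \<in> cadlag_paths. \<omega> s \<in> A} \<and>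
              s \<in> {0..q} \<and> A \<in> sets borel" by blast
        qed
      qed (use that in auto)
      then show ?thesis unfolding eq
        by (intro sets.countable_UN'' countable_subset[OF _ countable_rat]) auto
    qed
  qed
  show "precedes_hits C D N ?T"
    unfolding precedes_hits_def
  proof (intro conjI ballI allI impI opt)
    fix \<omega> :: "real \<Rightarrow> 'a" assume \<omega>: "\<omega> \<in> cadlag_paths"
    show "?T \<omega> \<le> N"
    proof (rule field_le_epsilon)
      fix e :: real assume "e > 0"
      then have "?T \<omega> < N + e" unfolding less[OF \<omega>] by simp
      then show "?T \<omega> \<le> N + e" by simp
    qed
    fix t assume hit: "closed_hits C D N \<omega> t"
    then have t: "0 \<le> t" "t < N" "h (\<omega> t) \<in> C" "rational_visits D \<omega> t" by (auto simp: closed_hits_def)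
    have St: "S \<omega> \<le> t" using S \<omega> hit by (simp add: precedes_hits_def)
    show "?T \<omega> \<le> t"
    proof (rule field_le_epsilon)
      fix e :: real assume e: "e > 0"
      have "((\<lambda>s. infdist (h (\<omega> s)) C) \<longlongrightarrow> infdist (h (\<omega> t)) C) (at_right t)"
        by (intro tendsto_infdist tendsto_h_right \<omega> t(1))
      moreover have "infdist (h (\<omega> t)) C < 1 / real (Suc n)" using t(3) by simp
      ultimately have "\<forall>\<^sub>F s in at_right t. infdist (h (\<omega> s)) C < 1 / real (Suc n)"
        by (rule order_tendstoD(2))
      then obtain b where b: "b > t" "\<And>s. t < s \<Longrightarrow> s < b \<Longrightarrow> infdist (h (\<omega> s)) C < 1 / real (Suc n)"
        unfolding eventually_at_right_field by blast
      have "min (min (b - t) e) (N - t) > 0" using b e t by simp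
      then obtain q where q: "q \<in> \<rat>" "t < q" "q < t + min (min (b - t) e) (N - t)" "\<omega> q \<in> D"
        using t(4) unfolding rational_visits_def by blast
      then have "q \<in> approach_set C D N S n \<omega>" using b St by (auto simp: approach_set_def)
      moreover have "q < t + e" using q by linarith
      ultimately have "?T \<omega> < t + e" unfolding less[OF \<omega>] by blast
      then show "?T \<omega> \<le> t + e" by simp
    qed
  qed
qed

text \<open>
  The essential supremum of the stopping times preceding all hits coincides with its own approach
  times, hence is itself a hit.
\<close>

lemma stopping_time_at_closed:
  assumes C: "closed C" "C \<noteq> {}" and D: "D \<in> sets borel" and N: "N > 0"
    and hits: "\<And>Z. Z \<in> null_sets (P x) \<Longrightarrow> \<not> {\<omega> \<in> cadlag_paths. \<exists>t. closed_hits C D N \<omega> t} \<subseteq> Z"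
  obtains S where "optional_time S" "emeasure (P x) {\<omega> \<in> cadlag_paths. S \<omega> < N} \<noteq> 0"
    "AE \<omega> in P x. S \<omega> < N \<longrightarrow> h (\<omega> (S \<omega>)) \<in> C \<and> rational_visits D \<omega> (S \<omega>)"
proof -
  \<comment> \<open>The essential supremum is found by maximising the mean, which is bounded because
    all candidates take values in [0, N].\<close>
  define I where "I S = (\<integral>\<omega>. S \<omega> \<partial>P x)" for S :: "(real \<Rightarrow> 'a) \<Rightarrow> real"
  let ?S = "Collect (precedes_hits C D N)"
  have int: "integrable (P x) S" and I_le: "I S \<le> N" if S: "precedes_hits C D N S" for S
  proof -
    have opt: "optional_time S" using S by (simp add: precedes_hits_def)
    have m: "S \<in> borel_measurable (P x)"
      using optional_time_measurable[OF opt] by (simp add: measurable_cong_sets[OF sets_P refl])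
    have b: "0 \<le> S \<omega>" "S \<omega> \<le> N" if "\<omega> \<in> cadlag_paths" for \<omega>
      using opt S that by (auto simp: optional_time_def precedes_hits_def)
    then show i: "integrable (P x) S"
      by (intro P.integrable_const_bound[where B=N] m AE_I2) simp
    have "I S \<le> (\<integral>\<omega>. N \<partial>P x)" unfolding I_def using b i by (intro integral_mono) auto
    then show "I S \<le> N" using P.prob_space[of x] by simp
  qed
  have "optional_time (\<lambda>\<omega>. 0 :: real)" by (rule optional_time_const) simp
  then have zero: "precedes_hits C D N (\<lambda>\<omega>. 0)"
    using N by (simp add: precedes_hits_def closed_hits_def)
  define s where "s = (SUP S\<in>?S. I S)"
  have bdd: "bdd_above (I ` ?S)" using I_le by (auto simp: bdd_above_def)
  have I_s: "I S \<le> s" if "precedes_hits C D N S" for S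
    unfolding s_def using that bdd by (intro cSUP_upper) auto
  have "\<exists>S. precedes_hits C D N S \<and> s - 1 / real (Suc n) < I S" for n
  proof -
    have "s - 1 / real (Suc n) < s" by simp
    then show ?thesis unfolding s_def using zero bdd by (subst (asm) less_cSUP_iff) auto
  qed
  then obtain Sn where Sn: "\<And>n. precedes_hits C D N (Sn n)" "\<And>n. s - 1 / real (Suc n) < I (Sn n)"
    by metis
  define S where "S \<omega> = (SUP n. Sn n \<omega>)" for \<omega>
  have Sn_le: "Sn n \<omega> \<le> N" if "\<omega> \<in> cadlag_paths" for n \<omega> using Sn(1)[of n] that
      by (simp add: precedes_hits_def)
  have bddn: "bdd_above (range (\<lambda>n. Sn n \<omega>))" if "\<omega> \<in> cadlag_paths" for \<omega>
    using Sn_le[OF that] by (auto simp: bdd_above_def)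
  have optS: "optional_time S"
    unfolding S_def using Sn(1) Sn_le by (intro optional_time_SUP[where N=N]) (auto simp:
        precedes_hits_def)
  have S: "precedes_hits C D N S"
    unfolding precedes_hits_def
  proof (intro conjI ballI allI impI optS)
    fix \<omega> :: "real \<Rightarrow> 'a" assume \<omega>: "\<omega> \<in> cadlag_paths"
    show "S \<omega> \<le> N" unfolding S_def using Sn_le[OF \<omega>] by (intro cSUP_least) auto
    show "S \<omega> \<le> t" if "closed_hits C D N \<omega> t" for t
      unfolding S_def using Sn(1) \<omega> that by (intro cSUP_least) (auto simp: precedes_hits_def)
  qed
  have "I (Sn n) \<le> I S" for n
    unfolding I_def S_def using int[OF Sn(1)] int[OF S] bddn
    by (intro integral_mono) (auto simp: S_def[abs_def] intro: cSUP_upper)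
  then have "s - 1 / real (Suc n) \<le> I S" for n using Sn(2)[of n] by (meson less_imp_le order_trans)
  moreover have "(\<lambda>n. s - 1 / real (Suc n)) \<longlonglongrightarrow> s"
    using tendsto_diff[OF tendsto_const[of s] LIMSEQ_inverse_real_of_nat[unfolded inverse_eq_divide]]
    by simp
  ultimately have "s \<le> I S" by (intro LIMSEQ_le_const2[of _ s]) auto
  \<comment> \<open>The approach time is again a candidate and is at least S, so maximality of the
    mean of S forces equality almost surely.\<close>
  have Teq: "AE \<omega> in P x. approach_time C D N S n \<omega> = S \<omega>" for n
  proof -
    note T = approach_time_precedes[OF C D N S, where n=n]
    have diff: "I (approach_time C D N S n) - I S = (\<integral>\<omega>. approach_time C D N S n \<omega> - S \<omega> \<partial>P x)"
      unfolding I_def by (rule Bochner_Integration.integral_diff[symmetric]) (intro int T S)+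
    have nn: "AE \<omega> in P x. 0 \<le> approach_time C D N S n \<omega> - S \<omega>"
      using T(2) by (intro AE_I2) simp
    have "0 \<le> (\<integral>\<omega>. approach_time C D N S n \<omega> - S \<omega> \<partial>P x)" by (rule integral_nonneg_AE[OF nn])
    moreover have "I (approach_time C D N S n) \<le> s" by (rule I_s[OF T(1)])
    ultimately have "(\<integral>\<omega>. approach_time C D N S n \<omega> - S \<omega> \<partial>P x) = 0"
      using diff \<open>s \<le> I S\<close> by linarith
    then have "AE \<omega> in P x. approach_time C D N S n \<omega> - S \<omega> = 0"
      by (subst (asm) integral_nonneg_eq_0_iff_AE[OF _ nn])
        (intro Bochner_Integration.integrable_diff int T S, assumption)
    then show ?thesis by simp
  qed
  show thesis
  proof (rule that[OF optS])
    \<comment> \<open>Every path with a hit satisfies S < N, so if this event were null it would be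
      a null set containing all hits.\<close>
    show "emeasure (P x) {\<omega> \<in> cadlag_paths. S \<omega> < N} \<noteq> 0"
    proof
      assume "emeasure (P x) {\<omega> \<in> cadlag_paths. S \<omega> < N} = 0"
      moreover have "{\<omega> \<in> space (path_sigma {0..}). S \<omega> < N} \<in> sets (path_sigma {0..})"
        using optional_time_measurable[OF optS] by measurable
      ultimately have "{\<omega> \<in> cadlag_paths. S \<omega> < N} \<in> null_sets (P x)" by (simp add: null_sets_def sets_P)
      moreover have "{\<omega> \<in> cadlag_paths. \<exists>t. closed_hits C D N \<omega> t} \<subseteq> {\<omega> \<in> cadlag_paths. S \<omega> < N}"
      proof safe
        fix \<omega> t assume "\<omega> \<in> cadlag_paths" and hit: "closed_hits C D N \<omega> t"
        then have "S \<omega> \<le> t" using S by (simp add: precedes_hits_def)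
        then show "S \<omega> < N" using hit by (simp add: closed_hits_def)
      qed
      ultimately show False using hits by blast
    qed
    have "AE \<omega> in P x. \<forall>n. approach_time C D N S n \<omega> = S \<omega>" using Teq by (simp add: AE_all_countable)
    then show "AE \<omega> in P x. S \<omega> < N \<longrightarrow> h (\<omega> (S \<omega>)) \<in> C \<and> rational_visits D \<omega> (S \<omega>)"
    proof (rule AE_mp, intro AE_I2 impI)
      fix \<omega> assume "\<omega> \<in> space (P x)" and eq: "\<forall>n. approach_time C D N S n \<omega> = S \<omega>" and SN: "S \<omega> < N"
      then have \<omega>: "\<omega> \<in> cadlag_paths" by simp
      have S0: "0 \<le> S \<omega>" using optS \<omega> by (simp add: optional_time_def)
      \<comment> \<open>The infimum equals S and S < N, so approach points accumulate at S from the
        right.\<close>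
      have appr: "\<exists>q\<in>\<rat>. S \<omega> < q \<and> q < S \<omega> + \<delta> \<and> infdist (h (\<omega> q)) C < 1 / real (Suc n) \<and> \<omega> q \<in> D"
        if \<delta>: "\<delta> > 0" for \<delta> n
      proof -
        have "approach_time C D N S n \<omega> < min (S \<omega> + \<delta>) N" using eq \<delta> SN by simp
        then show ?thesis
          unfolding approach_time_less_iff[OF optS \<omega> less_imp_le[OF N]] by (auto simp: approach_set_def)
      qed
      then have "rational_visits D \<omega> (S \<omega>)" unfolding rational_visits_def by blast
      moreover have "h (\<omega> (S \<omega>)) \<in> C"
      proof -
        have "\<forall>n. \<exists>q. S \<omega> < q \<and> q < S \<omega> + 1 / real (Suc n) \<and> infdist (h (\<omega> q)) C < 1 / real (Suc n)"
        proof
          fix n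
          have "1 / real (Suc n) > 0" by simp
          from appr[OF this, of n]
          show "\<exists>q. S \<omega> < q \<and> q < S \<omega> + 1 / real (Suc n) \<and> infdist (h (\<omega> q)) C < 1 / real (Suc n)"
              by blast
        qed
        then obtain q where q: "\<And>n. S \<omega> < q n" "\<And>n. q n < S \<omega> + 1 / real (Suc n)"
          "\<And>n. infdist (h (\<omega> (q n))) C < 1 / real (Suc n)" by metis
        have inv: "(\<lambda>n. 1 / real (Suc n)) \<longlonglongrightarrow> 0"
          using LIMSEQ_inverse_real_of_nat by (simp add: inverse_eq_divide)
        have "q \<longlonglongrightarrow> S \<omega>"
        proof (rule tendsto_sandwich[OF _ _ tendsto_const])
          show "(\<lambda>n. S \<omega> + 1 / real (Suc n)) \<longlonglongrightarrow> S \<omega>"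
            using tendsto_add[OF tendsto_const[of "S \<omega>"] inv] by simp
        qed (use q in \<open>auto intro: less_imp_le always_eventually\<close>)
        then have "filterlim q (at_right (S \<omega>)) sequentially"
          using q(1) by (intro tendsto_imp_filterlim_at_right) auto
        then have "(\<lambda>n. h (\<omega> (q n))) \<longlonglongrightarrow> h (\<omega> (S \<omega>))"
          by (rule filterlim_compose[OF tendsto_h_right[OF \<omega> S0]])
        then have "(\<lambda>n. infdist (h (\<omega> (q n))) C) \<longlonglongrightarrow> infdist (h (\<omega> (S \<omega>))) C"
          by (rule tendsto_infdist)
        moreover have "(\<lambda>n. infdist (h (\<omega> (q n))) C) \<longlonglongrightarrow> 0"
        proof (rule tendsto_sandwich[OF _ _ tendsto_const inv])
          show "\<forall>\<^sub>F n in sequentially. 0 \<le> infdist (h (\<omega> (q n))) C" by (simp add: infdist_nonneg)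
          show "\<forall>\<^sub>F n in sequentially. infdist (h (\<omega> (q n))) C \<le> 1 / real (Suc n)"
            using q(3) by (intro always_eventually allI less_imp_le)
        qed
        ultimately have "infdist (h (\<omega> (S \<omega>))) C = 0" by (rule LIMSEQ_unique)
        then show ?thesis using in_closed_iff_infdist_zero[OF C] by blast
      qed
      ultimately show "h (\<omega> (S \<omega>)) \<in> C \<and> rational_visits D \<omega> (S \<omega>)" by blast
    qed
  qed
qed

end

text \<open>A form with countable quantifiers only, from which joint measurability in time and path
  can be read off.\<close>

lemma rational_visits_iff:
  "rational_visits D \<omega> t \<longleftrightarrow> (\<forall>k::nat. \<exists>q::rat. t < of_rat q \<and> of_rat q < t + 1 / real (Suc k) \<and>
      \<omega> (of_rat q) \<in> D)"
proof
  assume L: "rational_visits D \<omega> t"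
  show "\<forall>k::nat. \<exists>q::rat. t < of_rat q \<and> of_rat q < t + 1 / real (Suc k) \<and> \<omega> (of_rat q) \<in> D"
  proof
    fix k :: nat
    have "1 / real (Suc k) > 0" by simp
    then obtain r where "r \<in> \<rat>" "t < r" "r < t + 1 / real (Suc k)" "\<omega> r \<in> D"
      using L unfolding rational_visits_def by blast
    then show "\<exists>q::rat. t < of_rat q \<and> of_rat q < t + 1 / real (Suc k) \<and> \<omega> (of_rat q) \<in> D"
      by (elim Rats_cases) blast
  qed
next
  assume R: "\<forall>k::nat. \<exists>q::rat. t < of_rat q \<and> of_rat q < t + 1 / real (Suc k) \<and> \<omega> (of_rat q) \<in> D"
  show "rational_visits D \<omega> t"
    unfolding rational_visits_def
  proof (intro allI impI)
    fix \<delta> :: real assume "\<delta> > 0"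
    then obtain k where k: "1 / real (Suc k) < \<delta>" using nat_approx_posE[of \<delta>] by metis
    obtain q :: rat where "t < of_rat q" "of_rat q < t + 1 / real (Suc k)" "\<omega> (of_rat q) \<in> D"
      using R by blast
    then show "\<exists>r\<in>\<rat>. t < r \<and> r < t + \<delta> \<and> \<omega> r \<in> D"
      using k by (intro bexI[of _ "of_rat q"]) auto
  qed
qed

section \<open>Jumps from the right have probability zero\<close>

context harmonic
begin

text \<open>Otherwise some stopping time S has \<psi> on one side of the gap (a, b) at S and visits
  to the other side immediately afterwards. The value at S and the visits bound the same stopped
  integral from opposite sides, which is impossible for a short window d.\<close>

lemma closed_hits_null:
  assumes C: "closed C" and CV: "h -` C \<subseteq> V" and D: "D \<in> sets borel" and N: "N > 0"
    and ab: "0 < a" "a < b"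
    and VD: "(\<forall>y\<in>V. b \<le> \<psi> y) \<and> (\<forall>y\<in>D. \<psi> y \<le> a) \<or> (\<forall>y\<in>V. \<psi> y \<le> a) \<and> (\<forall>y\<in>D. b \<le> \<psi> y)"
  shows "\<exists>Z\<in>null_sets (P x). {\<omega> \<in> cadlag_paths. \<exists>t. closed_hits C D N \<omega> t} \<subseteq> Z"
proof (rule ccontr)
  assume "\<not> ?thesis"
  then have hits: "\<not> {\<omega> \<in> cadlag_paths. \<exists>t. closed_hits C D N \<omega> t} \<subseteq> Z" if "Z \<in> null_sets (P x)" for Z
    using that by blast
  have "C \<noteq> {}"
  proof
    assume "C = {}"
    then have none: "{\<omega> \<in> cadlag_paths. \<exists>t. closed_hits C D N \<omega> t} \<subseteq> {}"
      by (auto simp: closed_hits_def)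
    have "{} \<in> null_sets (P x)" by simp
    from hits[OF this] none show False by (rule notE)
  qed
  from stopping_time_at_closed[OF C this D N hits] obtain S where S: "optional_time S"
    and pos: "emeasure (P x) {\<omega> \<in> cadlag_paths. S \<omega> < N} \<noteq> 0"
    and at: "AE \<omega> in P x. S \<omega> < N \<longrightarrow> h (\<omega> (S \<omega>)) \<in> C \<and> rational_visits D \<omega> (S \<omega>)"
    by blast
  \<comment> \<open>The window after S is so short that the change of the discount factor cannot
    bridge the gap between a and b.\<close>
  obtain d where d: "0 < d" "d \<le> 1" "exp (\<bar>c\<bar> * d) * a < b"
  proof -
    have "((\<lambda>d. exp (\<bar>c\<bar> * d) * a) \<longlongrightarrow> exp (\<bar>c\<bar> * 0) * a) (at_right 0)"
      by (intro tendsto_intros)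
    then have "\<forall>\<^sub>F d in at_right 0. exp (\<bar>c\<bar> * d) * a < b"
      using ab by (intro order_tendstoD(2)) auto
    then obtain e where e: "e > 0" "\<And>d. 0 < d \<Longrightarrow> d < e \<Longrightarrow> exp (\<bar>c\<bar> * d) * a < b"
      unfolding eventually_at_right_field by auto
    show thesis by (rule that[of "min (e / 2) 1"]) (use e in auto)
  qed
  have io: "AE \<omega> in P x. S \<omega> < N \<longrightarrow> (\<exists>r\<in>\<rat>. S \<omega> < r \<and> r \<le> S \<omega> + d \<and> \<omega> r \<in> D)"
  proof (rule AE_mp[OF at], intro AE_I2 impI)
    fix \<omega> assume imp: "S \<omega> < N \<longrightarrow> h (\<omega> (S \<omega>)) \<in> C \<and> rational_visits D \<omega> (S \<omega>)" and SN: "S \<omega> < N"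
    have "rational_visits D \<omega> (S \<omega>)" using mp[OF imp SN] by simp
    then obtain r where "r \<in> \<rat>" "S \<omega> < r" "r < S \<omega> + d" "\<omega> r \<in> D"
      using d(1) unfolding rational_visits_def by blast
    then show "\<exists>r\<in>\<rat>. S \<omega> < r \<and> r \<le> S \<omega> + d \<and> \<omega> r \<in> D" by (intro bexI[of _ r]) auto
  qed
  define G where "G = {\<omega> \<in> cadlag_paths. S \<omega> < N}"
  define m where "m = stopped_mass x S N"
  define I where "I = (\<integral>\<^sup>+\<omega>\<in>G. ennreal (exp (- c * S \<omega>) * \<psi> (\<omega> (S \<omega>))) \<partial>P x)"
  have m: "0 < m" "m < \<infinity>" unfolding m_def by (rule stopped_mass_bounds[OF S pos])+
  have [measurable]: "S \<in> borel_measurable (path_sigma {0..})" by (rule optional_time_measurable[OF S])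
  have [measurable]: "G \<in> sets (path_sigma {0..})"
    unfolding G_def by (rule prior_events_measurable[OF optional_time_lt_prior[OF S]])
  have m_mult: "ennreal k * m = (\<integral>\<^sup>+\<omega>. ennreal k * (ennreal (exp (- c * S \<omega>)) *
      indicator G \<omega>) \<partial>P x)" for k
    unfolding m_def stopped_mass_def G_def[symmetric] by (rule nn_integral_cmult[symmetric]) measurable
  have cancel: "k \<le> l" if "ennreal k * m \<le> ennreal l * m" "0 \<le> l" for k l
  proof -
    obtain r where r: "m = ennreal r" "0 < r" using m by (cases m) auto
    show ?thesis
    proof (cases "0 \<le> k")
      case True
      then have "ennreal (k * r) \<le> ennreal (l * r)"
        using that r by (simp add: ennreal_mult)
      then show ?thesis using that(2) r(2) by simp
    qed (use that(2) in simp)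
  qed
  have bounds: "AE \<omega> in P x. \<omega> \<in> G \<longrightarrow> \<omega> (S \<omega>) \<in> V"
    by (rule AE_mp[OF at], intro AE_I2 impI) (use CV in \<open>auto simp: G_def\<close>)
  from VD show False
  proof
    assume *: "(\<forall>y\<in>V. b \<le> \<psi> y) \<and> (\<forall>y\<in>D. \<psi> y \<le> a)"
    then have "I \<le> ennreal (exp (\<bar>c\<bar> * d) * a) * m"
      using visits_bounds(1)[OF S N D d(1,2) io, of a] unfolding I_def m_def G_def by blast
    moreover have "ennreal b * m \<le> I"
      unfolding m_mult I_def
    proof (rule nn_integral_mono_AE, rule AE_mp[OF bounds], intro AE_I2 impI)
      fix \<omega> assume imp: "\<omega> \<in> G \<longrightarrow> \<omega> (S \<omega>) \<in> V"
      show "ennreal b * (ennreal (exp (- c * S \<omega>)) * indicator G \<omega>) \<le>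
          ennreal (exp (- c * S \<omega>) * \<psi> (\<omega> (S \<omega>))) * indicator G \<omega>"
      proof (cases "\<omega> \<in> G")
        case True
        then have "b * exp (- c * S \<omega>) \<le> exp (- c * S \<omega>) * \<psi> (\<omega> (S \<omega>))"
          using * imp by (simp add: mult.commute)
        then have "ennreal (b * exp (- c * S \<omega>)) \<le> ennreal (exp (- c * S \<omega>) * \<psi> (\<omega> (S \<omega>)))"
          by (rule ennreal_leI)
        then show ?thesis using True ab by (simp add: ennreal_mult)
      qed simp
    qed
    ultimately have "ennreal b * m \<le> ennreal (exp (\<bar>c\<bar> * d) * a) * m" by (rule order_trans[rotated])
    then have "b \<le> exp (\<bar>c\<bar> * d) * a" by (rule cancel) (use ab in simp)
    then show False using d(3) by simp
  next
    assume *: "(\<forall>y\<in>V. \<psi> y \<le> a) \<and> (\<forall>y\<in>D. b \<le> \<psi> y)"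
    then have "ennreal (exp (- \<bar>c\<bar> * d) * b) * m \<le> I"
      using visits_bounds(2)[OF S N D d(1,2) io, of b] unfolding I_def m_def G_def by blast
    moreover have "I \<le> ennreal a * m"
      unfolding m_mult I_def
    proof (rule nn_integral_mono_AE, rule AE_mp[OF bounds], intro AE_I2 impI)
      fix \<omega> assume imp: "\<omega> \<in> G \<longrightarrow> \<omega> (S \<omega>) \<in> V"
      show "ennreal (exp (- c * S \<omega>) * \<psi> (\<omega> (S \<omega>))) * indicator G \<omega> \<le>
          ennreal a * (ennreal (exp (- c * S \<omega>)) * indicator G \<omega>)"
      proof (cases "\<omega> \<in> G")
        case True
        then have "exp (- c * S \<omega>) * \<psi> (\<omega> (S \<omega>)) \<le> a * exp (- c * S \<omega>)"
          using * imp by (simp add: mult.commute)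
        then have "ennreal (exp (- c * S \<omega>) * \<psi> (\<omega> (S \<omega>))) \<le> ennreal (a * exp (- c * S \<omega>))"
          by (rule ennreal_leI)
        then show ?thesis using True ab by (simp add: ennreal_mult)
      qed simp
    qed
    ultimately have "ennreal (exp (- \<bar>c\<bar> * d) * b) * m \<le> ennreal a * m" by (rule order_trans)
    then have "exp (- \<bar>c\<bar> * d) * b \<le> a" by (rule cancel) (use ab in simp)
    then have "exp (\<bar>c\<bar> * d) * (exp (- \<bar>c\<bar> * d) * b) \<le> exp (\<bar>c\<bar> * d) * a"
      by (intro mult_left_mono) auto
    moreover have "exp (\<bar>c\<bar> * d) * (exp (- \<bar>c\<bar> * d) * b) = b"
      by (simp only: mult.assoc[symmetric] exp_add[symmetric]) simp
    ultimately show False using d(3) by linarith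
  qed
qed

text \<open>If hits could be selected on a set G of positive mass, the law of the position at the
  selected time would charge a closed set whose preimage lies in V, against
  \<open>closed_hits_null\<close>.\<close>

lemma hits_null:
  assumes V: "V \<in> sets borel" and D: "D \<in> sets borel" and N: "N > 0" and ab: "0 < a" "a < b"
    and VD: "(\<forall>y\<in>V. b \<le> \<psi> y) \<and> (\<forall>y\<in>D. \<psi> y \<le> a) \<or> (\<forall>y\<in>V. \<psi> y \<le> a) \<and> (\<forall>y\<in>D. b \<le> \<psi> y)"
  shows "\<exists>Z\<in>null_sets (P x). {\<omega> \<in> cadlag_paths. \<exists>t. 0 \<le> t \<and> t < N \<and> \<omega> t \<in> V \<and> rational_visits D \<omega> t} \<subseteq> Z"
proof -
  let ?Q = "path_sigma {0..} :: (real \<Rightarrow> 'a) measure"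
  let ?R = "borel \<Otimes>\<^sub>M ?Q :: (real \<times> (real \<Rightarrow> 'a)) measure"
  \<comment> \<open>All pairs of a hit and its path. The set is measurable since evaluation is
    jointly measurable; its projection to the paths need not be.\<close>
  define A where "A = {(t, \<omega>). \<omega> \<in> cadlag_paths \<and> 0 \<le> t \<and> t < N \<and> \<omega> t \<in> V \<and> rational_visits D \<omega> t}"
  note [measurable] = V D
  have ev: "(\<lambda>z. (snd z) (max 0 (fst z))) \<in> borel_measurable ?R"
    by (rule measurable_path_eval[where f="\<lambda>z. max 0 (fst z)" and g=snd]) auto
  have evq: "(\<lambda>z. (snd z) (max 0 r)) \<in> borel_measurable ?R" for r :: real
    by (rule measurable_compose[OF measurable_snd measurable_coordinate]) simp
  note [measurable] = ev evq
  have "A = {z \<in> space ?R. 0 \<le> fst z \<and> fst z < N \<and> (snd z) (max 0 (fst z)) \<in> V \<and>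
      (\<forall>k::nat. \<exists>q::rat. fst z < of_rat q \<and> of_rat q < fst z + 1 / real (Suc k) \<and>
          (snd z) (max 0 (of_rat q)) \<in> D)}"
    (is "_ = ?A")
  proof (rule set_eqI)
    fix z :: "real \<times> (real \<Rightarrow> 'a)"
    obtain t \<omega> where z: "z = (t, \<omega>)" by (cases z)
    have mx: "max 0 (of_rat q) = (of_rat q :: real)" if "0 \<le> t" "t < of_rat q" for q using that by simp
    show "z \<in> A \<longleftrightarrow> z \<in> ?A"
    proof (cases "0 \<le> t")
      case True
      then have "(t < of_rat q \<and> of_rat q < t + 1 / real (Suc k) \<and> \<omega> (max 0 (of_rat q)) \<in> D) \<longleftrightarrow>
          (t < of_rat q \<and> of_rat q < t + 1 / real (Suc k) \<and> \<omega> (of_rat q) \<in> D)" for q k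
        using mx by auto
      then show ?thesis
        using True unfolding z A_def rational_visits_iff by (simp add: space_pair_measure max_def)
    qed (simp add: z A_def)
  qed
  also have "?A \<in> sets ?R" by measurable
  finally have A: "A \<in> sets (borel \<Otimes>\<^sub>M P x)"
    by (simp add: sets_pair_measure_cong[OF refl sets_P])
  have A_sub: "A \<subseteq> {0..N} \<times> space (P x)" by (auto simp: A_def)
  obtain T G Z where T[measurable]: "T \<in> borel_measurable (P x)" and G[measurable]: "G \<in> sets (P x)"
    and sel: "\<And>\<omega>. \<omega> \<in> G \<Longrightarrow> (T \<omega>, \<omega>) \<in> A" and Z: "Z \<in> null_sets (P x)" "snd ` A \<subseteq> G \<union> Z"
    using measurable_selection[OF P.finite_measure_axioms A A_sub] by metis
  have cover: "{\<omega> \<in> cadlag_paths. \<exists>t. 0 \<le> t \<and> t < N \<and> \<omega> t \<in> V \<and> rational_visits D \<omega> t} \<subseteq> G \<union> Z"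
    using Z(2) by (force simp: A_def)
  have "emeasure (P x) G = 0"
  proof (rule ccontr)
    assume G0: "emeasure (P x) G \<noteq> 0"
    obtain W where W: "W \<in> sets borel" "V = h -` W" using borel_vimage_h[OF V] by blast
    define X where "X \<omega> = h (\<omega> (max 0 (T \<omega>)))" for \<omega>
    have "(\<lambda>\<omega>. \<omega> (max 0 (T \<omega>))) \<in> borel_measurable (P x)"
      by (rule measurable_path_eval[where f="\<lambda>\<omega>. max 0 (T \<omega>)" and g="\<lambda>\<omega>. \<omega>"])
        (auto simp: measurable_ident_sets[OF sets_P])
    then have X[measurable]: "X \<in> borel_measurable (P x)" unfolding X_def by measurable
    define MG where "MG = density (P x) (indicator G)"
    define \<mu> where "\<mu> = distr MG borel X"
    have em: "emeasure \<mu> B = emeasure (P x) {\<omega> \<in> G. X \<omega> \<in> B}" if B: "B \<in> sets borel" for B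
    proof -
      have "emeasure \<mu> B = emeasure MG (X -` B \<inter> space MG)"
        unfolding \<mu>_def using B by (intro emeasure_distr) (auto simp: MG_def)
      also have "\<dots> = emeasure (P x) (G \<inter> (X -` B \<inter> space MG))"
        unfolding MG_def using B measurable_sets[OF X B] by (intro emeasure_restricted) auto
      also have "G \<inter> (X -` B \<inter> space MG) = {\<omega> \<in> G. X \<omega> \<in> B}"
        using sets.sets_into_space[OF G] by (auto simp: MG_def)
      finally show ?thesis .
    qed
    have s\<mu>: "sets \<mu> = sets borel" by (simp add: \<mu>_def)
    have fin: "emeasure \<mu> B \<noteq> \<infinity>" for B
    proof (cases "B \<in> sets borel")
      case True
      then show ?thesis using P.emeasure_finite by (simp add: em)
    qed (simp add: emeasure_notin_sets s\<mu>)
    interpret \<mu>: finite_measure \<mu> by (rule finite_measureI) (rule fin)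
    \<comment> \<open>The alternative \<open>C = W\<close> serves to place X in W on all of G; the
      other one turns mass in C into closed hits.\<close>
    have inV: "X \<omega> \<in> W \<and> closed_hits C D N \<omega> (T \<omega>)" if "\<omega> \<in> G" "X \<omega> \<in> C \<or> C = W" for \<omega> C
    proof -
      have *: "\<omega> \<in> cadlag_paths" "0 \<le> T \<omega>" "T \<omega> < N" "\<omega> (T \<omega>) \<in> V" "rational_visits D \<omega> (T \<omega>)"
        using sel[OF that(1)] by (auto simp: A_def)
      then have "X \<omega> = h (\<omega> (T \<omega>))" by (simp add: X_def)
      then show ?thesis using * that(2) W(2) by (auto simp: closed_hits_def)
    qed
    have "{\<omega> \<in> G. X \<omega> \<in> W} = G" using inV[of _ W] by blast
    then have "emeasure \<mu> W \<noteq> 0" using G0 em[OF W(1)] by simp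
    then have "measure \<mu> W > 0" using fin[of W]
        by (simp add: measure_def zero_less_measure_iff enn2real_positive_iff less_top[symmetric]
            zero_less_iff_neq_zero)
    from closed_subset_positive[OF \<mu>.finite_measure_axioms s\<mu> W(1) this]
    obtain C where C: "closed C" "C \<subseteq> W" "measure \<mu> C > 0" by blast
    have "h -` C \<subseteq> V" using C(2) W(2) by auto
    from closed_hits_null[OF C(1) this D N ab VD]
    obtain Z' where Z': "Z' \<in> null_sets (P x)" "{\<omega> \<in> cadlag_paths. \<exists>t. closed_hits C D N \<omega> t} \<subseteq>
        Z'" by blast
    have "{\<omega> \<in> G. X \<omega> \<in> C} \<subseteq> Z'"
      using inV[of _ C] Z'(2) sets.sets_into_space[OF G] by fastforce
    then have "emeasure (P x) {\<omega> \<in> G. X \<omega> \<in> C} \<le> emeasure (P x) Z'"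
      using Z'(1) by (intro emeasure_mono) auto
    then have "emeasure \<mu> C = 0" using Z'(1) C(1) by (simp add: em null_setsD1)
    then show False using C(3) by (simp add: measure_def)
  qed
  then have "G \<union> Z \<in> null_sets (P x)" using G Z(1) by (intro null_sets.Un) (auto simp: null_sets_def)
  then show ?thesis using cover by blast
qed

text \<open>Pairs of rational levels a < b detect every discontinuity from the right along rational
  times, and there are countably many of them. Outside one null set, continuity along rationals thus
  holds at all t at once, and this is what extends it to real times.\<close>

theorem harmonic_finely_continuous: "finely_continuous P \<psi>"
  unfolding finely_continuous_def
proof
  fix x
  define bad where "bad V D = {\<omega> \<in> cadlag_paths. \<exists>t\<ge>0. \<omega> t \<in> V \<and> rational_visits D \<omega> t}"
      for V D :: "'a set"
  have bad_null: "AE \<omega> in P x. \<omega> \<notin> bad V D"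
    if V: "V \<in> sets borel" and D: "D \<in> sets borel" and ab: "0 < a" "a < b"
    and VD: "(\<forall>y\<in>V. b \<le> \<psi> y) \<and> (\<forall>y\<in>D. \<psi> y \<le> a) \<or> (\<forall>y\<in>V. \<psi> y \<le> a) \<and> (\<forall>y\<in>D. b \<le> \<psi> y)"
    for V D a b
  proof -
    define W where "W n = {\<omega> \<in> cadlag_paths. \<exists>t. 0 \<le> t \<and> t < real (Suc n) \<and> \<omega> t \<in> V \<and>
        rational_visits D \<omega> t}" for n
    have "\<exists>Z. Z \<in> null_sets (P x) \<and> W n \<subseteq> Z" for n
      using hits_null[OF V D _ ab VD, of "real (Suc n)" x] unfolding W_def by (auto simp del: of_nat_Suc)
    then obtain Z where Z: "\<And>n. Z n \<in> null_sets (P x)" "\<And>n. W n \<subseteq> Z n" by metis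
    have "bad V D \<subseteq> (\<Union>n. Z n)"
    proof
      fix \<omega> assume "\<omega> \<in> bad V D"
      then obtain t where t: "\<omega> \<in> cadlag_paths" "0 \<le> t" "\<omega> t \<in> V" "rational_visits D \<omega> t"
        by (auto simp: bad_def)
      obtain n where "t < real n" using reals_Archimedean2 by blast
      then have "t < real (Suc n)" by simp
      with t have "\<omega> \<in> W n" unfolding W_def by blast
      then show "\<omega> \<in> (\<Union>n. Z n)" using Z(2) by blast
    qed
    moreover have "(\<Union>n. Z n) \<in> null_sets (P x)" using Z(1) by blast
    ultimately show ?thesis by (intro AE_I'[of "\<Union>n. Z n"]) auto
  qed
  define hi where "hi a = {y. a \<le> \<psi> y}" for a
  define lo where "lo a = {y. \<psi> y \<le> a}" for a
  have [measurable]: "hi a \<in> sets borel" "lo a \<in> sets borel" for a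
    unfolding hi_def lo_def by measurable
  have "AE \<omega> in P x. \<forall>a\<in>\<rat>. \<forall>b\<in>\<rat>. 0 < a \<and> a < b \<longrightarrow> \<omega> \<notin> bad (hi b) (lo a) \<and> \<omega> \<notin> bad (lo a) (hi b)"
  proof (intro AE_ball_countable[THEN iffD2] countable_rat ballI)
    fix a b :: real
    show "AE \<omega> in P x. 0 < a \<and> a < b \<longrightarrow> \<omega> \<notin> bad (hi b) (lo a) \<and> \<omega> \<notin> bad (lo a) (hi b)"
    proof (cases "0 < a \<and> a < b")
      case True
      have "AE \<omega> in P x. \<omega> \<notin> bad (hi b) (lo a)"
        using True by (intro bad_null[of _ _ a b]) (auto simp: hi_def[of b] lo_def[of a])
      moreover have "AE \<omega> in P x. \<omega> \<notin> bad (lo a) (hi b)"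
        using True by (intro bad_null[of _ _ a b]) (auto simp: hi_def[of b] lo_def[of a])
      ultimately show ?thesis by eventually_elim simp
    qed auto
  qed
  then show "AE \<omega> in P x. \<forall>t\<ge>0. ((\<lambda>s. \<psi> (\<omega> s)) \<longlongrightarrow> \<psi> (\<omega> t)) (at_right t)"
  proof (rule AE_mp, intro AE_I2 impI allI)
    fix \<omega> t
    assume "\<omega> \<in> space (P x)" and t0: "(0::real) \<le> t"
      and good: "\<forall>a\<in>\<rat>. \<forall>b\<in>\<rat>. 0 < a \<and> a < b \<longrightarrow> \<omega> \<notin> bad (hi b) (lo a) \<and> \<omega> \<notin> bad (lo a) (hi b)"
    then have \<omega>: "\<omega> \<in> cadlag_paths" by simp
    have good': "(b \<le> \<psi> (\<omega> t) \<longrightarrow> \<not> rational_visits (lo a) \<omega> t) \<and> (\<psi> (\<omega> t) \<le> a \<longrightarrow>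
        \<not> rational_visits (hi b) \<omega> t)"
      if "a \<in> \<rat>" "b \<in> \<rat>" "0 < a" "a < b" "0 \<le> t" for a b t
    proof -
      have "\<omega> \<notin> bad (hi b) (lo a)" "\<omega> \<notin> bad (lo a) (hi b)" using good that by blast+
      then show ?thesis using \<omega> that(5) unfolding bad_def hi_def[of b] lo_def[of a] by blast
    qed
    have rat: "\<exists>\<delta>>0. \<forall>r\<in>\<rat>. t < r \<and> r < t + \<delta> \<longrightarrow> \<bar>\<psi> (\<omega> r) - \<psi> (\<omega> t)\<bar> < e"
      if e: "e > 0" and t: "0 \<le> t" for e t
    proof -
      \<comment> \<open>Two levels are needed on each side of \<psi> (\<omega> t): one that
        separates the current value and, strictly beyond it, one that defines the excluded
        visits.\<close>
      obtain b where b: "b \<in> \<rat>" "max 0 (\<psi> (\<omega> t) - e) < b" "b < \<psi> (\<omega> t)"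
        using rational_exists[of "max 0 (\<psi> (\<omega> t) - e)" "\<psi> (\<omega> t)"] e \<psi>_pos[of "\<omega> t"] by auto
      obtain a where a: "a \<in> \<rat>" "max 0 (\<psi> (\<omega> t) - e) < a" "a < b"
        using rational_exists[OF b(2)] by auto
      have "\<not> rational_visits (lo a) \<omega> t" using good'[of a b t] a b t by auto
      then obtain d1 where d1: "d1 > 0" "\<And>r. r \<in> \<rat> \<Longrightarrow> t < r \<Longrightarrow> r < t + d1 \<Longrightarrow> \<not> \<psi> (\<omega> r) \<le> a"
        unfolding rational_visits_def lo_def by blast
      obtain a' where a': "a' \<in> \<rat>" "\<psi> (\<omega> t) < a'" "a' < \<psi> (\<omega> t) + e"
        using rational_exists[of "\<psi> (\<omega> t)" "\<psi> (\<omega> t) + e"] e by auto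
      obtain b' where b': "b' \<in> \<rat>" "a' < b'" "b' < \<psi> (\<omega> t) + e"
        using rational_exists[OF a'(3)] by auto
      have "0 < a'" using a'(2) \<psi>_pos[of "\<omega> t"] by linarith
      then have "\<not> rational_visits (hi b') \<omega> t" using good'[of a' b' t] a' b' t by auto
      then obtain d2 where d2: "d2 > 0" "\<And>r. r \<in> \<rat> \<Longrightarrow> t < r \<Longrightarrow> r < t + d2 \<Longrightarrow> \<not> b' \<le> \<psi> (\<omega> r)"
        unfolding rational_visits_def hi_def by blast
      show ?thesis
      proof (intro exI[of _ "min d1 d2"] conjI ballI impI)
        show "0 < min d1 d2" using d1 d2 by simp
        fix r assume r: "r \<in> \<rat>" "t < r \<and> r < t + min d1 d2"
        then have "r < t + d1" "r < t + d2" by (simp_all add: min_def split: if_splits)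
        then have "\<not> \<psi> (\<omega> r) \<le> a" "\<not> b' \<le> \<psi> (\<omega> r)" using r d1(2)[of r] d2(2)[of r] by auto
        then show "\<bar>\<psi> (\<omega> r) - \<psi> (\<omega> t)\<bar> < e" using a b' by auto
      qed
    qed
    show "((\<lambda>s. \<psi> (\<omega> s)) \<longlongrightarrow> \<psi> (\<omega> t)) (at_right t)"
    proof (rule tendstoI)
      fix e :: real assume "e > 0"
      then have e2: "e / 2 > 0" by simp
      obtain d where d: "d > 0" "\<And>r. r \<in> \<rat> \<Longrightarrow> t < r \<Longrightarrow> r < t + d \<Longrightarrow> \<bar>\<psi> (\<omega> r) - \<psi> (\<omega> t)\<bar> < e / 2"
        using rat[OF e2 t0] by blast
      \<comment> \<open>A real s is compared with a rational r just after it: \<open>rat\<close> at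
        s makes the value at r close to that at s, and \<open>rat\<close> at t close to that at
        t.\<close>
      have "dist (\<psi> (\<omega> s)) (\<psi> (\<omega> t)) < e" if s: "t < s" "s < t + d" for s
      proof -
        have "0 \<le> s" using s t0 by simp
        from rat[OF e2 this] obtain d' where d': "d' > 0"
          "\<And>r. r \<in> \<rat> \<Longrightarrow> s < r \<Longrightarrow> r < s + d' \<Longrightarrow> \<bar>\<psi> (\<omega> r) - \<psi> (\<omega> s)\<bar> < e / 2" by blast
        obtain r where r: "r \<in> \<rat>" "s < r" "r < min (s + d') (t + d)"
          using rational_exists[of s "min (s + d') (t + d)"] s d' by auto
        have "\<bar>\<psi> (\<omega> r) - \<psi> (\<omega> s)\<bar> < e / 2" "\<bar>\<psi> (\<omega> r) - \<psi> (\<omega> t)\<bar> < e / 2"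
          using d(2)[of r] d'(2)[of r] r s by auto
        then show ?thesis unfolding dist_real_def by linarith
      qed
      then show "\<forall>\<^sub>F s in at_right t. dist (\<psi> (\<omega> s)) (\<psi> (\<omega> t)) < e"
        unfolding eventually_at_right_field using d(1) by (intro exI[of _ "t + d"]) auto
    qed
  qed
qed

end

section \<open>Processes with transition densities\<close>

context right_process
begin

lemma measurable_eval_P: "0 \<le> t \<Longrightarrow> (\<lambda>\<omega>. \<omega> t) \<in> P x \<rightarrow>\<^sub>M borel"
  using measurable_coordinate[of t "{0..}"] by (simp add: measurable_cong_sets[OF sets_P refl])

lemma semigroup:
  assumes s: "0 \<le> s" and t: "0 \<le> t" and f[measurable]: "f \<in> borel_measurable borel"
  shows "(\<integral>\<^sup>+\<omega>. f (\<omega> (s + t)) \<partial>P x) = (\<integral>\<^sup>+\<omega>. (\<integral>\<^sup>+w. f (w t) \<partial>P (\<omega> s)) \<partial>P x)"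
proof -
  have "(\<lambda>w :: real \<Rightarrow> 'a. f (w t)) \<in> borel_measurable (path_sigma {0..})"
    using t by (intro measurable_compose[OF measurable_coordinate f]) simp
  from markov[OF s cadlag_paths_sets this, of x]
  have "(\<integral>\<^sup>+\<omega>\<in>cadlag_paths. f (shift s \<omega> t) \<partial>P x) = (\<integral>\<^sup>+\<omega>\<in>cadlag_paths. (\<integral>\<^sup>+w. f (w t) \<partial>P (\<omega> s)) \<partial>P x)" .
  moreover have "(\<integral>\<^sup>+\<omega>\<in>cadlag_paths. f (shift s \<omega> t) \<partial>P x) = (\<integral>\<^sup>+\<omega>. f (\<omega> (s + t)) \<partial>P x)"
    using t by (intro nn_integral_cong) (simp add: shift_apply)
  moreover have "(\<integral>\<^sup>+\<omega>\<in>cadlag_paths. (\<integral>\<^sup>+w. f (w t) \<partial>P (\<omega> s)) \<partial>P x) =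
      (\<integral>\<^sup>+\<omega>. (\<integral>\<^sup>+w. f (w t) \<partial>P (\<omega> s)) \<partial>P x)"
    by (intro nn_integral_cong) simp
  ultimately show ?thesis by simp
qed

lemma two_times:
  assumes s: "0 \<le> s" and t: "0 \<le> t" and F[measurable]: "F \<in> borel_measurable (borel \<Otimes>\<^sub>M borel)"
  shows "(\<integral>\<^sup>+\<omega>. F (\<omega> s, \<omega> (s + t)) \<partial>P x) = (\<integral>\<^sup>+\<omega>. (\<integral>\<^sup>+w. F (\<omega> s, w t) \<partial>P (\<omega> s)) \<partial>P x)"
proof -
  have m: "(\<lambda>w :: real \<Rightarrow> 'a. w 0) \<in> borel_measurable (path_sigma {0..})"
    "(\<lambda>w :: real \<Rightarrow> 'a. w t) \<in> borel_measurable (path_sigma {0..})"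
    using t by (auto intro: measurable_coordinate)
  have "(\<lambda>w :: real \<Rightarrow> 'a. F (w 0, w t)) \<in> borel_measurable (path_sigma {0..})"
    by (rule measurable_compose[OF measurable_Pair[OF m] F])
  from markov[OF s cadlag_paths_sets this, of x]
  have "(\<integral>\<^sup>+\<omega>\<in>cadlag_paths. F (shift s \<omega> 0, shift s \<omega> t) \<partial>P x) =
      (\<integral>\<^sup>+\<omega>\<in>cadlag_paths. (\<integral>\<^sup>+w. F (w 0, w t) \<partial>P (\<omega> s)) \<partial>P x)" .
  moreover have "(\<integral>\<^sup>+\<omega>\<in>cadlag_paths. F (shift s \<omega> 0, shift s \<omega> t) \<partial>P x) =
      (\<integral>\<^sup>+\<omega>. F (\<omega> s, \<omega> (s + t)) \<partial>P x)"
    using t by (intro nn_integral_cong) (simp add: shift_apply)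
  moreover have "(\<integral>\<^sup>+w. F (w 0, w t) \<partial>P y) = (\<integral>\<^sup>+w. F (y, w t) \<partial>P y)" for y
    using start[of y] by (intro nn_integral_cong_AE) auto
  then have "(\<integral>\<^sup>+\<omega>\<in>cadlag_paths. (\<integral>\<^sup>+w. F (w 0, w t) \<partial>P (\<omega> s)) \<partial>P x) =
      (\<integral>\<^sup>+\<omega>. (\<integral>\<^sup>+w. F (\<omega> s, w t) \<partial>P (\<omega> s)) \<partial>P x)"
    by (intro nn_integral_cong) simp
  ultimately show ?thesis by simp
qed

end

text \<open>Bounded test functions identify the law of X as the measure with density k; for
  nonnegative functions both sides are then integrals against this measure.\<close>

lemma density_from_bounded:
  fixes k :: "'a::topological_space \<Rightarrow> real"
  assumes M: "prob_space M" and X: "X \<in> borel_measurable M" and sm: "sets m = sets borel"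
    and k: "k \<in> borel_measurable m" "\<And>y. 0 \<le> k y"
    and eq: "\<And>f :: 'a \<Rightarrow> real. f \<in> borel_measurable borel \<Longrightarrow> bounded (range f) \<Longrightarrow>
      (\<integral>\<omega>. f (X \<omega>) \<partial>M) = (\<integral>y. k y * f y \<partial>m)"
    and f: "f \<in> borel_measurable borel"
  shows "(\<integral>\<^sup>+\<omega>. f (X \<omega>) \<partial>M) = (\<integral>\<^sup>+y. ennreal (k y) * f y \<partial>m)"
proof -
  interpret M: prob_space M by fact
  have "bounded (range (\<lambda>_::'a. 1 :: real))" by simp
  from eq[OF _ this] have "(\<integral>y. k y \<partial>m) = 1" using M.prob_space by simp
  \<comment> \<open>A nonintegrable k would have Bochner integral 0 instead of 1.\<close>
  then have int: "integrable m k" using not_integrable_integral_eq by fastforce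
  have "distr M borel X = density m k"
  proof (rule measure_eqI)
    show "sets (distr M borel X) = sets (density m k)" by (simp add: sm)
    fix A assume "A \<in> sets (distr M borel X)"
    then have A: "A \<in> sets borel" "A \<in> sets m" by (simp_all add: sm)
    have "bounded (range (indicator A :: 'a \<Rightarrow> real))"
      by (rule boundedI[where B=1]) (auto simp: indicator_def)
    with eq[of "indicator A"] A have e: "(\<integral>\<omega>. indicator A (X \<omega>) \<partial>M) = (\<integral>y. k y *
        indicator A y \<partial>m)" by simp
    have XA: "X -` A \<inter> space M \<in> sets M" using X A(1) by (rule measurable_sets)
    have "(\<integral>\<omega>. indicator A (X \<omega>) \<partial>M) = (\<integral>\<omega>. indicator (X -` A \<inter> space M) \<omega> \<partial>M :: real)"
      by (intro Bochner_Integration.integral_cong) (auto simp: indicator_def)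
    also have "\<dots> = measure M (X -` A \<inter> space M)" using XA by simp
    finally have e': "measure M (X -` A \<inter> space M) = (\<integral>y. k y * indicator A y \<partial>m)" using e by simp
    have "emeasure (distr M borel X) A = ennreal (measure M (X -` A \<inter> space M))"
      using X A by (simp add: emeasure_distr M.emeasure_eq_measure)
    also have "\<dots> = (\<integral>\<^sup>+y. ennreal (k y * indicator A y) \<partial>m)"
    proof -
      have "integrable m (\<lambda>y. k y * indicator A y)"
        using integrable_mult_indicator[OF A(2) int] by (simp add: mult.commute)
      then show ?thesis unfolding e' using k(2) by (intro nn_integral_eq_integral[symmetric]) auto
    qed
    also have "\<dots> = emeasure (density m k) A"
      using k A by (subst emeasure_density) (auto intro!: nn_integral_cong simp: indicator_def)
    finally show "emeasure (distr M borel X) A = emeasure (density m k) A" .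
  qed
  then have "(\<integral>\<^sup>+y. f y \<partial>distr M borel X) = (\<integral>\<^sup>+y. f y \<partial>density m k)" by simp
  moreover have "f \<in> borel_measurable m" using f by (simp add: measurable_cong_sets[OF sm refl])
  ultimately show ?thesis using X f k by (simp add: nn_integral_distr nn_integral_density)
qed

locale transition_density = right_process h P
  for h :: "'a::topological_space \<Rightarrow> 'b::metric_space" and P +
  fixes P' and m :: "'a measure" and p :: "'a \<Rightarrow> real \<Rightarrow> 'a \<Rightarrow> real"
  assumes duality: "duality_hypothesis P P' m"
    and density: "transition_density_hypothesis P P' m p"
begin

lemma sets_m [measurable_cong, simp]: "sets m = sets borel"
  and sigma_finite_m: "sigma_finite_measure m"
  and dual_process: "borel_right_process P'"
  using duality unfolding duality_hypothesis_def by blast+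

lemma space_m [simp]: "space m = UNIV"
  using sets_eq_imp_space_eq[OF sets_m] by simp

sublocale m: sigma_finite_measure m by (rule sigma_finite_m)

sublocale dual: right_process h P'
  by unfold_locales (rule dual_process)

lemma p_pos: "t > 0 \<Longrightarrow> p x t y > 0"
  using density unfolding transition_density_hypothesis_def by blast

lemma p_nonneg: "t > 0 \<Longrightarrow> 0 \<le> p x t y"
  using p_pos[of t x y] by simp

lemma chapman_kolmogorov:
  "0 < s \<Longrightarrow> 0 < t \<Longrightarrow> ennreal (p x (t + s) y) = (\<integral>\<^sup>+z. ennreal (p x t z * p z s y) \<partial>m)"
  using density unfolding transition_density_hypothesis_def by blast

lemma measurable_p_times:
  assumes f: "f \<in> borel_measurable M" and g: "g \<in> borel_measurable M" and u: "u \<in> borel_measurable M"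
    and pos: "\<And>z. z \<in> space M \<Longrightarrow> 0 < u z"
  shows "(\<lambda>z. p (f z) (u z) (g z)) \<in> borel_measurable M"
proof -
  have "u \<in> M \<rightarrow>\<^sub>M restrict_space borel {0<..}"
    using u pos by (intro measurable_restrict_space2) auto
  then have "(\<lambda>z. (f z, u z, g z)) \<in> M \<rightarrow>\<^sub>M borel \<Otimes>\<^sub>M (restrict_space borel {0<..} \<Otimes>\<^sub>M borel)"
    using f g by (intro measurable_Pair)
  moreover have "(\<lambda>(x, t, y). p x t y) \<in> borel_measurable (borel \<Otimes>\<^sub>M (restrict_space borel {0<..}
      \<Otimes>\<^sub>M borel))"
    using density unfolding transition_density_hypothesis_def by blast
  ultimately have "(\<lambda>z. (\<lambda>(x, t, y). p x t y) (f z, u z, g z)) \<in> borel_measurable M"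
    by (rule measurable_compose)
  then show ?thesis by simp
qed

lemma measurable_p:
  assumes "f \<in> borel_measurable M" "g \<in> borel_measurable M" "0 < t"
  shows "(\<lambda>z. p (f z) t (g z)) \<in> borel_measurable M"
  using assms by (intro measurable_p_times) auto

lemma measurable_borel_m: "borel_measurable m = (borel_measurable borel :: ('a \<Rightarrow>
    'c::topological_space) set)"
  by (intro measurable_cong_sets) simp_all

lemma nn_density:
  assumes t: "0 < t" and f: "f \<in> borel_measurable borel"
  shows "(\<integral>\<^sup>+\<omega>. f (\<omega> t) \<partial>P x) = (\<integral>\<^sup>+y. ennreal (p x t y) * f y \<partial>m)"
    and "(\<integral>\<^sup>+\<omega>. f (\<omega> t) \<partial>P' x) = (\<integral>\<^sup>+y. ennreal (p y t x) * f y \<partial>m)"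
proof -
  have eq: "(\<integral>\<omega>. g (\<omega> t) \<partial>P x) = (\<integral>y. p x t y * g y \<partial>m)"
    "(\<integral>\<omega>. g (\<omega> t) \<partial>P' x) = (\<integral>y. p y t x * g y \<partial>m)"
    if "g \<in> borel_measurable borel" "bounded (range g)" for g :: "'a \<Rightarrow> real"
    using density t that unfolding transition_density_hypothesis_def by blast+
  show "(\<integral>\<^sup>+\<omega>. f (\<omega> t) \<partial>P x) = (\<integral>\<^sup>+y. ennreal (p x t y) * f y \<partial>m)"
  proof (rule density_from_bounded[OF prob_space_P _ sets_m _ _ eq(1) f])
    show "(\<lambda>\<omega>. \<omega> t) \<in> P x \<rightarrow>\<^sub>M borel" using t by (intro measurable_eval_P) simp
    show "(\<lambda>y. p x t y) \<in> borel_measurable m"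
      unfolding measurable_borel_m by (rule measurable_p[OF _ _ t]) simp_all
  qed (simp_all add: p_nonneg t)
  show "(\<integral>\<^sup>+\<omega>. f (\<omega> t) \<partial>P' x) = (\<integral>\<^sup>+y. ennreal (p y t x) * f y \<partial>m)"
  proof (rule density_from_bounded[OF dual.prob_space_P _ sets_m _ _ eq(2) f])
    show "(\<lambda>\<omega>. \<omega> t) \<in> P' x \<rightarrow>\<^sub>M borel" using t by (intro dual.measurable_eval_P) simp
    show "(\<lambda>y. p y t x) \<in> borel_measurable m"
      unfolding measurable_borel_m by (rule measurable_p[OF _ _ t]) simp_all
  qed (simp_all add: p_nonneg t)
qed

lemma p_integral: "0 < t \<Longrightarrow> (\<integral>\<^sup>+y. ennreal (p x t y) \<partial>m) = 1"
  using nn_density(1)[of t "\<lambda>_. 1" x] P.emeasure_space_1[of x] by simp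

lemma m_nonzero: "emeasure m UNIV \<noteq> 0"
proof
  assume "emeasure m UNIV = 0"
  then have "AE y in m. ennreal (p undefined 1 y) = 0" by (intro AE_I[of _ _ UNIV]) auto
  then have "(\<integral>\<^sup>+y. ennreal (p undefined 1 y) \<partial>m) = 0"
    by (subst nn_integral_cong_AE[where v="\<lambda>_. 0"]) auto
  then show False using p_integral[of 1 undefined] by simp
qed

text \<open>Extracts a point from an almost everywhere statement; m is not zero because transition
  densities integrate to 1.\<close>

lemma AE_m_ex: "AE y in m. \<Psi> y \<Longrightarrow> \<exists>y. \<Psi> y"
proof (rule ccontr)
  assume ae: "AE y in m. \<Psi> y" and "\<not> (\<exists>y. \<Psi> y)"
  then have "AE y in m. False" by simp
  then show False using AE_iff_measurable[of UNIV m "\<lambda>_. False"] m_nonzero by simp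
qed

lemma nn_density_two:
  assumes s: "0 < s" and u: "0 < u" and F[measurable]: "F \<in> borel_measurable (borel \<Otimes>\<^sub>M borel)"
  shows "(\<integral>\<^sup>+\<omega>. F (\<omega> s, \<omega> (s + u)) \<partial>P x) =
    (\<integral>\<^sup>+z. ennreal (p x s (fst z)) * (ennreal (p (fst z) u (snd z)) * F z) \<partial>(m \<Otimes>\<^sub>M m))"
proof -
  interpret mm: pair_sigma_finite m m ..
  have [measurable]: "(\<lambda>z. p (fst z) u (snd z)) \<in> borel_measurable (borel \<Otimes>\<^sub>M borel)"
    by (rule measurable_p[OF _ _ u]) simp_all
  have [measurable]: "(\<lambda>z. p x s (fst z)) \<in> borel_measurable (borel \<Otimes>\<^sub>M borel)"
    by (rule measurable_p[OF _ _ s]) simp_all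
  have [measurable]: "(\<lambda>y. p x s y) \<in> borel_measurable borel" by (rule measurable_p[OF _ _ s]) simp_all
  have inner: "(\<integral>\<^sup>+w. F (y, w u) \<partial>P y) = (\<integral>\<^sup>+z. ennreal (p y u z) * F (y, z) \<partial>m)" for y
    by (rule nn_density(1)[OF u]) measurable
  have "(\<integral>\<^sup>+\<omega>. F (\<omega> s, \<omega> (s + u)) \<partial>P x) = (\<integral>\<^sup>+\<omega>. (\<integral>\<^sup>+z. ennreal (p (\<omega> s) u z) * F (\<omega> s, z) \<partial>m) \<partial>P x)"
    using s u by (subst two_times) (simp_all add: inner)
  also have "\<dots> = (\<integral>\<^sup>+y. ennreal (p x s y) * (\<integral>\<^sup>+z. ennreal (p y u z) * F (y, z) \<partial>m) \<partial>m)"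
  proof (rule nn_density(1)[OF s])
    have "(\<lambda>z. ennreal (p (fst z) u (snd z)) * F z) \<in> borel_measurable (borel \<Otimes>\<^sub>M m)" by measurable
    from m.borel_measurable_nn_integral_fst[OF this]
    show "(\<lambda>y. \<integral>\<^sup>+z. ennreal (p y u z) * F (y, z) \<partial>m) \<in> borel_measurable borel" by simp
  qed
  also have "\<dots> = (\<integral>\<^sup>+y. \<integral>\<^sup>+z. ennreal (p x s y) * (ennreal (p y u z) * F (y, z)) \<partial>m \<partial>m)"
  proof (intro nn_integral_cong nn_integral_cmult[symmetric])
    fix y
    have "(\<lambda>z. p y u z) \<in> borel_measurable borel" by (rule measurable_p[OF _ _ u]) simp_all
    then show "(\<lambda>z. ennreal (p y u z) * F (y, z)) \<in> borel_measurable m"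
      unfolding measurable_borel_m by measurable
  qed
  also have "\<dots> = (\<integral>\<^sup>+z. ennreal (p x s (fst z)) * (ennreal (p (fst z) u (snd z)) * F z) \<partial>(m \<Otimes>\<^sub>M m))"
    by (subst m.nn_integral_fst[symmetric]) (simp_all, measurable)
  finally show ?thesis .
qed

end

section \<open>Processes with a common diagonal bridge\<close>

lemma AE_eq_of_nn_integral_eq:
  assumes "sigma_finite_measure M" and f: "f \<in> borel_measurable M" and g: "g \<in> borel_measurable M"
    and eq: "\<And>A. A \<in> sets M \<Longrightarrow> (\<integral>\<^sup>+z\<in>A. f z \<partial>M) = (\<integral>\<^sup>+z\<in>A. g z \<partial>M)"
  shows "AE z in M. f z = (g z :: ennreal)"
proof -
  interpret sigma_finite_measure M by fact
  have "density M f = density M g"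
    by (rule measure_eqI) (simp_all add: emeasure_density f g eq)
  then show ?thesis using density_unique[OF f g] by simp
qed

text \<open>Any good y' shares some z with the good y fixed at the start, so C has the same value at
  both. The nested quantifiers let C and R be arbitrary functions.\<close>

lemma AE_pair_separate:
  assumes M: "\<And>\<Psi>. AE y in M. \<Psi> y \<Longrightarrow> \<exists>y. \<Psi> y"
    and eq: "AE y in M. AE z in M. C y = R z"
  obtains k where "AE y in M. C y = k" "AE z in M. R z = k"
proof -
  obtain y where y: "AE z in M. C y = R z" using M[OF eq] by blast
  then have R: "AE z in M. R z = C y" by eventually_elim simp
  have "AE y' in M. C y' = C y"
    using eq
  proof eventually_elim
    case (elim y')
    from this R have "AE z in M. C y' = C y" by eventually_elim simp
    then show ?case using M by blast
  qed
  with R show thesis by (intro that[of "C y"])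
qed

text \<open>\<open>bridge\<close> is the equality of the diagonal bridges of length
  \<open>t0\<close>, written out through the laws and densities of the two processes.\<close>

locale bridged = P: transition_density h P P' m p + Q: transition_density h Q Q' n q
  for h :: "'a::topological_space \<Rightarrow> 'b::metric_space" and P P' m p Q Q' n q +
  fixes t0 :: real
  assumes t0: "t0 > 0"
    and bridge: "\<And>x s F. 0 \<le> s \<Longrightarrow> s < t0 \<Longrightarrow> F \<in> borel_measurable (path_sigma {0..s}) \<Longrightarrow>
      (\<integral>\<^sup>+\<omega>. F \<omega> * ennreal (p (\<omega> s) (t0 - s) x / p x t0 x) \<partial>P x) =
      (\<integral>\<^sup>+\<omega>. F \<omega> * ennreal (q (\<omega> s) (t0 - s) x / q x t0 x) \<partial>Q x)"
begin

text \<open>The quotient of the two bridge weights at time s, hence the density of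
  \<open>Q x\<close> with respect to \<open>P x\<close> on the past of s.\<close>

definition r :: "real \<Rightarrow> 'a \<Rightarrow> 'a \<Rightarrow> real" where
  "r s x y = p y (t0 - s) x * q x t0 x / (p x t0 x * q y (t0 - s) x)"

lemma r_pos: "s < t0 \<Longrightarrow> r s x y > 0"
  by (simp add: r_def P.p_pos Q.p_pos t0)

lemma measurable_r: "s < t0 \<Longrightarrow> (\<lambda>y. r s x y) \<in> borel_measurable borel"
  unfolding r_def
  by (intro borel_measurable_divide borel_measurable_times P.measurable_p Q.measurable_p)
      (simp_all add: t0)

lemma Q_eq_r_P:
  assumes s: "0 \<le> s" "s < t0" and F: "F \<in> borel_measurable (path_sigma {0..s})"
  shows "(\<integral>\<^sup>+\<omega>. F \<omega> \<partial>Q x) = (\<integral>\<^sup>+\<omega>. F \<omega> * ennreal (r s x (\<omega> s)) \<partial>P x)"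
proof -
  \<comment> \<open>The extra factor cancels the bridge weight on the Q side.\<close>
  let ?F = "\<lambda>\<omega>. F \<omega> * ennreal (q x t0 x / q (\<omega> s) (t0 - s) x)"
  have co: "(\<lambda>\<omega> :: real \<Rightarrow> 'a. \<omega> s) \<in> borel_measurable (path_sigma {0..s})"
    using s by (intro measurable_coordinate) simp
  have "(\<lambda>\<omega> :: real \<Rightarrow> 'a. q (\<omega> s) (t0 - s) x) \<in> borel_measurable (path_sigma {0..s})"
    using s by (intro Q.measurable_p co) simp_all
  then have "?F \<in> borel_measurable (path_sigma {0..s})" using F by measurable
  from bridge[OF s this, of x]
  have "(\<integral>\<^sup>+\<omega>. ?F \<omega> * ennreal (q (\<omega> s) (t0 - s) x / q x t0 x) \<partial>Q x) =
      (\<integral>\<^sup>+\<omega>. ?F \<omega> * ennreal (p (\<omega> s) (t0 - s) x / p x t0 x) \<partial>P x)" by simp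
  moreover have "?F \<omega> * ennreal (q (\<omega> s) (t0 - s) x / q x t0 x) = F \<omega>" for \<omega>
  proof -
    have "q x t0 x > 0" "q (\<omega> s) (t0 - s) x > 0" by (simp_all add: Q.p_pos s t0)
    then show ?thesis by (simp add: mult.assoc ennreal_mult'[symmetric])
  qed
  moreover have "?F \<omega> * ennreal (p (\<omega> s) (t0 - s) x / p x t0 x) = F \<omega> * ennreal (r s x (\<omega> s))" for \<omega>
  proof -
    have "q x t0 x > 0" "q (\<omega> s) (t0 - s) x > 0" by (simp_all add: Q.p_pos s t0)
    then show ?thesis by (simp add: mult.assoc ennreal_mult'[symmetric] r_def mult_ac)
  qed
  ultimately show ?thesis by simp
qed

lemma one_time:
  assumes s: "0 < s" "s < t0" and f[measurable]: "f \<in> borel_measurable borel"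
  shows "(\<integral>\<^sup>+y. ennreal (q x s y) * f y \<partial>n) = (\<integral>\<^sup>+y. ennreal (p x s y * r s x y) * f y \<partial>m)"
proof -
  have rm[measurable]: "(\<lambda>y. r s x y) \<in> borel_measurable borel" by (rule measurable_r[OF s(2)])
  have co: "(\<lambda>\<omega> :: real \<Rightarrow> 'a. \<omega> s) \<in> borel_measurable (path_sigma {0..s})"
    using s by (intro measurable_coordinate) simp
  have "(\<integral>\<^sup>+y. ennreal (q x s y) * f y \<partial>n) = (\<integral>\<^sup>+\<omega>. f (\<omega> s) \<partial>Q x)"
    by (rule Q.nn_density(1)[OF s(1) f, symmetric])
  also have "\<dots> = (\<integral>\<^sup>+\<omega>. f (\<omega> s) * ennreal (r s x (\<omega> s)) \<partial>P x)"
    using s by (intro Q_eq_r_P measurable_compose[OF co f]) simp_all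
  also have "\<dots> = (\<integral>\<^sup>+y. ennreal (p x s y) * (f y * ennreal (r s x y)) \<partial>m)"
    by (rule P.nn_density(1)[OF s(1), where f="\<lambda>y. f y * ennreal (r s x y)"]) measurable
  also have "\<dots> = (\<integral>\<^sup>+y. ennreal (p x s y * r s x y) * f y \<partial>m)"
    by (intro nn_integral_cong) (simp add: ennreal_mult' P.p_nonneg[OF s(1)] mult_ac)
  finally show ?thesis .
qed

text \<open>The density of n with respect to m, obtained by comparing the laws at time t0 / 2 from
  one starting point.\<close>

definition w :: "'a \<Rightarrow> real" where
  "w y = p undefined (t0 / 2) y * r (t0 / 2) undefined y / q undefined (t0 / 2) y"

lemma w_pos: "w y > 0"
  by (simp add: w_def P.p_pos Q.p_pos r_pos t0)

lemma measurable_w [measurable]: "w \<in> borel_measurable borel"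
  unfolding w_def using t0
  by (intro borel_measurable_divide borel_measurable_times P.measurable_p Q.measurable_p
      measurable_r) simp_all

lemma n_eq_density: "n = density m w"
proof (rule measure_eqI)
  fix A assume "A \<in> sets n"
  then have A[measurable]: "A \<in> sets borel" by simp
  let ?x = "undefined :: 'a" and ?s = "t0 / 2"
  let ?f = "\<lambda>y. ennreal (1 / q ?x ?s y) * indicator A y"
  have qs: "q ?x ?s y > 0" for y by (simp add: Q.p_pos t0)
  have [measurable]: "(\<lambda>y. q ?x ?s y) \<in> borel_measurable borel" using t0
      by (intro Q.measurable_p) simp_all
  have "emeasure n A = (\<integral>\<^sup>+y. ennreal (q ?x ?s y) * ?f y \<partial>n)"
    unfolding mult.assoc[symmetric] using qs A
        by (simp add: ennreal_mult'[symmetric] less_imp_le less_imp_neq[symmetric])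
  also have "\<dots> = (\<integral>\<^sup>+y. ennreal (p ?x ?s y * r ?s ?x y) * ?f y \<partial>m)"
    using t0 by (intro one_time) (simp_all, measurable)
  also have "\<dots> = (\<integral>\<^sup>+y. ennreal (w y) * indicator A y \<partial>m)"
    using qs P.p_pos[of ?s ?x] r_pos[of ?s ?x] t0
    by (intro nn_integral_cong) (simp add: w_def mult.assoc[symmetric] ennreal_mult'[symmetric]
        less_imp_le)
  also have "\<dots> = emeasure (density m w) A"
    by (subst emeasure_density) (simp_all add: P.measurable_borel_m)
  finally show "emeasure n A = emeasure (density m w) A" .
qed simp

lemma nn_integral_n:
  "f \<in> borel_measurable borel \<Longrightarrow> (\<integral>\<^sup>+y. f y \<partial>n) = (\<integral>\<^sup>+y. ennreal (w y) * f y \<partial>m)"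
  unfolding n_eq_density by (rule nn_integral_density) (simp_all add: P.measurable_borel_m)

text \<open>Both sides are densities, with respect to the square of m, of the law under
  \<open>Q x\<close> of the positions at s and s + u. The right side comes from changing to
  \<open>P x\<close>, where the density sees only the later position.\<close>

lemma joint:
  assumes s: "0 < s" and u: "0 < u" and su: "s + u < t0"
  shows "AE y in m. AE z in m. q x s y * w y * (q y u z * w z) = p x s y * p y u z * r (s + u) x z"
proof -
  interpret mm: pair_sigma_finite m m ..
  let ?MM = "m \<Otimes>\<^sub>M m"
  have sMM: "sets ?MM = sets (borel \<Otimes>\<^sub>M borel)" by (rule sets_pair_measure_cong) simp_all
  have bMM: "borel_measurable ?MM = (borel_measurable (borel \<Otimes>\<^sub>M borel) :: ('a \<times> 'a \<Rightarrow>
      'c::topological_space) set)"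
    by (rule measurable_cong_sets[OF sMM refl])
  have [measurable]: "(\<lambda>z. q x s (fst z)) \<in> borel_measurable (borel \<Otimes>\<^sub>M borel)"
    "(\<lambda>z. q (fst z) u (snd z)) \<in> borel_measurable (borel \<Otimes>\<^sub>M borel)"
    "(\<lambda>z. p x s (fst z)) \<in> borel_measurable (borel \<Otimes>\<^sub>M borel)"
    "(\<lambda>z. p (fst z) u (snd z)) \<in> borel_measurable (borel \<Otimes>\<^sub>M borel)"
    by (intro P.measurable_p Q.measurable_p s u measurable_fst measurable_snd; simp)+
  have [measurable]: "(\<lambda>y. r (s + u) x y) \<in> borel_measurable borel" by (rule measurable_r[OF su])
  define f where "f z = q x s (fst z) * w (fst z) * (q (fst z) u (snd z) * w (snd z))" for z
  define g where "g z = p x s (fst z) * p (fst z) u (snd z) * r (s + u) x (snd z)" for z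
  have fm[measurable]: "f \<in> borel_measurable (borel \<Otimes>\<^sub>M borel)" unfolding f_def by measurable
  have gm[measurable]: "g \<in> borel_measurable (borel \<Otimes>\<^sub>M borel)" unfolding g_def by measurable
  have nn: "n \<Otimes>\<^sub>M n = density ?MM (\<lambda>(y, z). ennreal (w y) * ennreal (w z))"
    unfolding n_eq_density
  proof (rule pair_measure_density)
    show "sigma_finite_measure (density m w)" unfolding n_eq_density[symmetric]
        by (rule Q.sigma_finite_m)
  qed (simp_all add: P.measurable_borel_m P.sigma_finite_m)
  have "(\<integral>\<^sup>+z\<in>A. ennreal (f z) \<partial>?MM) = (\<integral>\<^sup>+z\<in>A. ennreal (g z) \<partial>?MM)" if "A \<in> sets ?MM" for A
  proof -
    have A[measurable]: "A \<in> sets (borel \<Otimes>\<^sub>M borel)" using that by (simp add: sMM)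
    let ?I = "indicator A :: 'a \<times> 'a \<Rightarrow> ennreal"
    have "(\<integral>\<^sup>+z\<in>A. ennreal (f z) \<partial>?MM) =
        (\<integral>\<^sup>+z. (\<lambda>(y, z). ennreal (w y) * ennreal (w z)) z * (ennreal (q x s (fst z)) *
            (ennreal (q (fst z) u (snd z)) * ?I z)) \<partial>?MM)"
      using w_pos Q.p_pos[OF s] Q.p_pos[OF u]
      by (intro nn_integral_cong) (simp add: f_def ennreal_mult less_imp_le mult_ac split_beta)
    also have "\<dots> = (\<integral>\<^sup>+z. ennreal (q x s (fst z)) * (ennreal (q (fst z) u (snd z)) * ?I z) \<partial>(n \<Otimes>\<^sub>M n))"
      unfolding nn by (rule nn_integral_density[symmetric]) (unfold bMM split_beta, measurable)
    also have "\<dots> = (\<integral>\<^sup>+\<omega>. ?I (\<omega> s, \<omega> (s + u)) \<partial>Q x)"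
      by (rule Q.nn_density_two[OF s u, symmetric]) measurable
    also have "\<dots> = (\<integral>\<^sup>+\<omega>. ?I (\<omega> s, \<omega> (s + u)) * ennreal (r (s + u) x (\<omega> (s + u))) \<partial>P x)"
    proof (rule Q_eq_r_P)
      have "(\<lambda>\<omega> :: real \<Rightarrow> 'a. \<omega> s) \<in> borel_measurable (path_sigma {0..s + u})"
        "(\<lambda>\<omega> :: real \<Rightarrow> 'a. \<omega> (s + u)) \<in> borel_measurable (path_sigma {0..s + u})"
        using s u by (auto intro!: measurable_coordinate)
      then have "(\<lambda>\<omega> :: real \<Rightarrow> 'a. (\<omega> s, \<omega> (s + u))) \<in> path_sigma {0..s + u} \<rightarrow>\<^sub>M borel \<Otimes>\<^sub>M borel"
        by (rule measurable_Pair)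
      then show "(\<lambda>\<omega> :: real \<Rightarrow> 'a. ?I (\<omega> s, \<omega> (s + u))) \<in> borel_measurable (path_sigma {0..s + u})"
        by (rule measurable_compose) measurable
    qed (use s u su in simp_all)
    also have "\<dots> = (\<integral>\<^sup>+z. ennreal (p x s (fst z)) * (ennreal (p (fst z) u (snd z)) * (?I z *
        ennreal (r (s + u) x (snd z)))) \<partial>?MM)"
      by (rule P.nn_density_two[OF s u, where F="\<lambda>z. ?I z *
          ennreal (r (s + u) x (snd z))", simplified fst_conv snd_conv]) measurable
    also have "\<dots> = (\<integral>\<^sup>+z\<in>A. ennreal (g z) \<partial>?MM)"
      using r_pos[OF su] P.p_pos[OF s] P.p_pos[OF u]
      by (intro nn_integral_cong) (simp add: g_def ennreal_mult less_imp_le mult_ac)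
    finally show ?thesis .
  qed
  then have "AE z in ?MM. ennreal (f z) = ennreal (g z)"
    by (intro AE_eq_of_nn_integral_eq mm.P.sigma_finite_measure_axioms) (unfold bMM, measurable)
  then have "AE z in ?MM. f z = g z"
  proof eventually_elim
    case (elim z)
    have "0 \<le> f z" "0 \<le> g z"
      using w_pos r_pos[OF su] P.p_pos[OF s] P.p_pos[OF u] Q.p_pos[OF s] Q.p_pos[OF u]
      by (simp_all add: f_def g_def less_imp_le)
    then show ?case using elim by simp
  qed
  from mm.AE_pair[OF this] show ?thesis by (simp add: f_def g_def)
qed

section \<open>Splitting the ratio of the transition densities\<close>

definition v :: real where "v = t0 / 2"

text \<open>The ratio of densities from the reference point; the ratio from x turns out to be a
  multiple of it by a factor of x alone.\<close>

definition k :: "real \<Rightarrow> 'a \<Rightarrow> real" where "k s y = q undefined s y / p undefined s y"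

lemma v: "0 < v" "v < t0"
  using t0 by (simp_all add: v_def)

lemma k_pos: "0 < s \<Longrightarrow> k s y > 0"
  by (simp add: k_def P.p_pos Q.p_pos)

lemma measurable_k: "0 < s \<Longrightarrow> k s \<in> borel_measurable borel"
  unfolding k_def by (intro borel_measurable_divide P.measurable_p Q.measurable_p) simp_all

text \<open>Divide \<open>joint\<close> from x by \<open>joint\<close> from the reference point.
  With u = v - s the total time is always v, so a function of s and y equals a function of z that
  does not involve s. Hence the same constant serves all s.\<close>

lemma factor_exists:
  "\<exists>\<phi>>0. \<forall>s. 0 < s \<and> s < v \<longrightarrow> (AE y in m. q x s y = \<phi> * (k s y * p x s y))"
proof -
  let ?x = "undefined :: 'a"
  define C where "C s y = q x s y / (k s y * p x s y)" for s y
  define R where "R z = r v x z / r v ?x z" for z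
  have CR: "AE y in m. AE z in m. C s y = R z" if s: "0 < s" "s < v" for s
  proof -
    have u: "0 < v - s" "s + (v - s) < t0" using s v by simp_all
    note J = joint[OF s(1) u(1,2)]
    show ?thesis
      using J[of x] J[of ?x]
    proof eventually_elim
      case (elim y)
      then show ?case
      proof eventually_elim
        case (elim z)
        have pos: "q x s y > 0" "q ?x s y > 0" "p x s y > 0" "p ?x s y > 0" "p y (v - s) z > 0"
          "q y (v - s) z > 0" "w y > 0" "w z > 0" "r v x z > 0" "r v ?x z > 0"
          by (simp_all add: P.p_pos Q.p_pos s u w_pos r_pos v)
        define a where "a = w y * (q y (v - s) z * w z) / p y (v - s) z"
        have "a > 0" using pos by (simp add: a_def)
        have "r v x z = q x s y / p x s y * a" "r v ?x z = q ?x s y / p ?x s y * a"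
          using elim pos by (simp_all add: a_def field_simps)
        then show ?case using pos \<open>a > 0\<close> by (simp add: C_def R_def k_def)
      qed
    qed
  qed
  have "0 < v / 2" "v / 2 < v" using v by simp_all
  from AE_pair_separate[OF P.AE_m_ex CR[OF this]] obtain \<phi> where \<phi>: "AE z in m. R z = \<phi>" by metis
  have "\<exists>z. R z = \<phi>" by (rule P.AE_m_ex[OF \<phi>])
  then have "\<phi> > 0" using r_pos[OF v(2)] by (auto simp: R_def)
  moreover have "AE y in m. q x s y = \<phi> * (k s y * p x s y)" if s: "0 < s" "s < v" for s
    using CR[OF s]
  proof eventually_elim
    case (elim y)
    from this \<phi> have "AE z in m. C s y = \<phi>" by eventually_elim simp
    then have "C s y = \<phi>" using P.AE_m_ex by blast
    moreover have "k s y > 0" "p x s y > 0" by (simp_all add: k_pos P.p_pos s)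
    ultimately show ?case by (auto simp: C_def field_simps)
  qed
  ultimately show ?thesis by blast
qed

definition \<phi> :: "'a \<Rightarrow> real" where
  "\<phi> x = (SOME a. a > 0 \<and> (\<forall>s. 0 < s \<and> s < v \<longrightarrow> (AE y in m. q x s y = a * (k s y * p x s y))))"

definition \<psi> :: "'a \<Rightarrow> real" where "\<psi> x = 1 / \<phi> x"

lemma \<phi>: "\<phi> x > 0" "0 < s \<Longrightarrow> s < v \<Longrightarrow> AE y in m. q x s y = \<phi> x * (k s y * p x s y)"
  using someI_ex[OF factor_exists[of x, folded Bex_def[of "{0<..}"], simplified Bex_def greaterThan_iff]]
  unfolding \<phi>_def by blast+

lemma \<psi>_pos: "\<psi> x > 0"
  using \<phi>(1) by (simp add: \<psi>_def)

text \<open>\<phi> is chosen separately for each x. Since q integrates to 1 against n, the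
  reciprocal of \<phi> x is the integral of p * k * w over y, and that is measurable in x.\<close>

lemma measurable_\<psi> [measurable]: "\<psi> \<in> borel_measurable borel"
proof -
  define s where "s = v / 2"
  have s: "0 < s" "s < v" "s < t0" using v by (simp_all add: s_def)
  have [measurable]: "k s \<in> borel_measurable borel" by (rule measurable_k[OF s(1)])
  have [measurable]: "(\<lambda>y. p x s y) \<in> borel_measurable borel" "(\<lambda>y. q x s y) \<in>
      borel_measurable borel" for x
    using s by (auto intro!: P.measurable_p Q.measurable_p)
  have "(\<integral>\<^sup>+y. ennreal (p x s y * (k s y * w y)) \<partial>m) = ennreal (\<psi> x)" for x
  proof -
    have "1 = (\<integral>\<^sup>+y. ennreal (w y) * ennreal (q x s y) \<partial>m)"
      using Q.p_integral[OF s(1), of x] by (subst (asm) nn_integral_n) simp_all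
    also have "\<dots> = (\<integral>\<^sup>+y. ennreal (\<phi> x) * ennreal (p x s y * (k s y * w y)) \<partial>m)"
    proof (rule nn_integral_cong_AE)
      show "AE y in m. ennreal (w y) * ennreal (q x s y) = ennreal (\<phi> x) * ennreal (p x s y *
          (k s y * w y))"
        using \<phi>(2)[OF s(1,2), of x]
      proof eventually_elim
        case (elim y)
        show ?case
          unfolding elim using w_pos[of y] \<phi>(1)[of x] by (simp add: ennreal_mult'[symmetric] mult_ac)
      qed
    qed
    also have "\<dots> = ennreal (\<phi> x) * (\<integral>\<^sup>+y. ennreal (p x s y * (k s y * w y)) \<partial>m)"
      by (rule nn_integral_cmult) (unfold P.measurable_borel_m, measurable)
    finally have "ennreal (\<psi> x) * 1 = ennreal (\<psi> x) * (ennreal (\<phi> x) * (\<integral>\<^sup>+y. ennreal (p x s y *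
        (k s y * w y)) \<partial>m))"
      by simp
    then show ?thesis
      using \<phi>(1)[of x] by (simp add: mult.assoc[symmetric] ennreal_mult'[symmetric] \<psi>_def)
  qed
  moreover have "(\<lambda>x. \<integral>\<^sup>+y. ennreal (p x s y * (k s y * w y)) \<partial>m) \<in> borel_measurable borel"
  proof -
    have [measurable]: "(\<lambda>z. p (fst z) s (snd z)) \<in> borel_measurable (borel \<Otimes>\<^sub>M m)"
      using s by (intro P.measurable_p) measurable
    have "(\<lambda>z. ennreal (p (fst z) s (snd z) * (k s (snd z) * w (snd z)))) \<in>
        borel_measurable (borel \<Otimes>\<^sub>M m)"
      by measurable
    from P.m.borel_measurable_nn_integral_fst[OF this] show ?thesis by simp
  qed
  ultimately have "(\<lambda>x. ennreal (\<psi> x)) \<in> borel_measurable borel" by simp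
  then have "(\<lambda>x. enn2real (ennreal (\<psi> x))) \<in> borel_measurable borel" by measurable
  then show ?thesis using \<psi>_pos by (simp add: less_imp_le)
qed

text \<open>Inserting the factorisation of q over u into \<open>joint\<close> from the reference
  point leaves k * w * \<phi> at y equal to a function of z, hence constant. So k * w is a multiple
  of \<psi>, and the factorisation over s takes the claimed form.\<close>

lemma density_ratio_small:
  assumes s: "0 < s" "s < v"
  shows "\<exists>\<beta>>0. \<forall>x. AE y in m. q x s y * w y = \<beta> * (p x s y * \<psi> y) / \<psi> x"
proof -
  let ?x = "undefined :: 'a"
  define u where "u = (v - s) / 2"
  have u: "0 < u" "u < v" "s + u < t0" using s v by (simp_all add: u_def field_simps)
  define C where "C y = k s y * w y * \<phi> y" for y
  define R where "R z = r (s + u) ?x z / (k u z * w z)" for z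
  have "AE y in m. AE z in m. C y = R z"
    using joint[OF s(1) u(1) u(3), of ?x]
  proof eventually_elim
    case (elim y)
    from this \<phi>(2)[OF u(1,2), of y] show ?case
    proof eventually_elim
      case (elim z)
      have pos: "p ?x s y > 0" "p y u z > 0" "k u z > 0" "w z > 0"
        by (simp_all add: P.p_pos s u k_pos w_pos)
      have "q ?x s y = k s y * p ?x s y" using pos by (simp add: k_def)
      then have "p ?x s y * p y u z * (k s y * w y * \<phi> y * (k u z * w z)) = p ?x s y * p y u z *
          r (s + u) ?x z"
        using elim by (simp add: mult_ac)
      then have "k s y * w y * \<phi> y * (k u z * w z) = r (s + u) ?x z" using pos by simp
      then show ?case using pos by (simp add: C_def R_def field_simps)
    qed
  qed
  from AE_pair_separate[OF P.AE_m_ex this] obtain \<beta> where \<beta>: "AE y in m. C y = \<beta>" by metis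
  have "\<exists>y. C y = \<beta>" by (rule P.AE_m_ex[OF \<beta>])
  then have "\<beta> > 0" using k_pos[OF s(1)] w_pos \<phi>(1) by (auto simp: C_def)
  moreover have "AE y in m. q x s y * w y = \<beta> * (p x s y * \<psi> y) / \<psi> x" for x
    using \<beta> \<phi>(2)[OF s, of x]
  proof eventually_elim
    case (elim y)
    have "k s y * w y = \<beta> * \<psi> y" using elim(1) \<phi>(1)[of y] by (auto simp: C_def \<psi>_def field_simps)
    have "q x s y * w y = \<phi> x * p x s y * (k s y * w y)" unfolding elim(2) by (simp add: mult_ac)
    also have "\<dots> = \<beta> * (p x s y * \<psi> y) / \<psi> x"
      unfolding \<open>k s y * w y = \<beta> * \<psi> y\<close> by (simp add: \<psi>_def[of x])
    finally show ?case .
  qed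
  ultimately show ?thesis by blast
qed

end

section \<open>Measurable solutions of Cauchy's functional equation\<close>

text \<open>Measurability bounds L on a large part of the unit interval, which meets its translates
  by small u; so L is bounded near 0. The deviation D from linearity vanishes at positive integers,
  is therefore bounded on all positive reals, and scales with integers, which forces it to be
  0.\<close>

lemma measurable_additive_linear:
  fixes L :: "real \<Rightarrow> real"
  assumes L[measurable]: "L \<in> borel_measurable borel"
    and add: "\<And>s t. 0 < s \<Longrightarrow> 0 < t \<Longrightarrow> L (s + t) = L s + L t" and t: "t > 0"
  shows "L t = L 1 * t"
proof -
  define B where "B n = {t \<in> {0<..<1}. \<bar>L t\<bar> \<le> real n}" for n
  have B[measurable]: "B n \<in> sets borel" for n unfolding B_def by measurable
  have "(\<lambda>n. emeasure lborel (B n)) \<longlonglongrightarrow> emeasure lborel (\<Union>n. B n)"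
    using B by (intro Lim_emeasure_incseq) (auto simp: incseq_def B_def)
  moreover have "(\<Union>n. B n) = {0<..<1}"
  proof (intro equalityI subsetI)
    fix u :: real assume u: "u \<in> {0<..<1}"
    obtain n where "\<bar>L u\<bar> \<le> real n" using real_arch_simple by blast
    then show "u \<in> (\<Union>n. B n)" using u by (auto simp: B_def)
  qed (auto simp: B_def)
  ultimately have "(\<lambda>n. emeasure lborel (B n)) \<longlonglongrightarrow> 1" by simp
  moreover have "ennreal (3/4) < 1" by (simp add: ennreal_less_one_iff)
  ultimately have "\<forall>\<^sub>F n in sequentially. ennreal (3/4) < emeasure lborel (B n)"
    by (rule order_tendstoD(1))
  then obtain n where n: "ennreal (3/4) < emeasure lborel (B n)" by (auto simp: eventually_sequentially)
  have bounded: "\<bar>L u\<bar> \<le> 2 * real n" if u: "0 < u" "u < 1/4" for u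
  proof -
    define B' where "B' = (+) u -` B n"
    have B'[measurable]: "B' \<in> sets borel" 
      unfolding B'_def using measurable_sets[of "(+) u" borel borel "B n"] B by simp
    have "emeasure lborel B' = emeasure (distr lborel borel ((+) u)) (B n)"
      by (subst emeasure_distr) (auto simp: B'_def)
    then have e: "emeasure lborel B' = emeasure lborel (B n)" by (simp add: lborel_distr_plus)
    have "B n \<inter> B' \<noteq> {}"
    proof
      assume disj: "B n \<inter> B' = {}"
      have "ennreal (3/4) + ennreal (3/4) \<le> emeasure lborel (B n) + emeasure lborel B'"
        unfolding e using n by (intro add_mono) auto
      also have "\<dots> = emeasure lborel (B n \<union> B')"
        using disj by (intro plus_emeasure) auto
      \<comment> \<open>The translate by -u stays in an interval of length 5/4 together with
        \<open>B n\<close>; two disjoint sets of measure above 3/4 do not fit there.\<close>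
      also have "\<dots> \<le> emeasure lborel {-1/4..1::real}"
        using u by (intro emeasure_mono) (auto simp: B_def B'_def)
      also have "\<dots> = ennreal (5/4)" by simp
      finally have "ennreal (3/4 + 3/4) \<le> ennreal (5/4)" by (subst ennreal_plus) auto
      then show False by simp
    qed
    then obtain s where "s \<in> B n" "u + s \<in> B n" by (auto simp: B'_def)
    then have "0 < s" "\<bar>L s\<bar> \<le> real n" "\<bar>L (u + s)\<bar> \<le> real n" by (auto simp: B_def)
    then show ?thesis using add[OF u(1) \<open>0 < s\<close>] by linarith
  qed
  have mult: "L (real (Suc k) * s) = real (Suc k) * L s" if s: "0 < s" for k s
  proof (induction k)
    case (Suc k)
    have "L (real (Suc (Suc k)) * s) = L (real (Suc k) * s + s)" by (simp add: algebra_simps)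
    also have "\<dots> = L (real (Suc k) * s) + L s" using s by (intro add) simp_all
    finally show ?case unfolding Suc by (simp add: algebra_simps)
  qed simp
  define D where "D s = L s - L 1 * s" for s
  have D_mult: "D (real (Suc k) * s) = real (Suc k) * D s" if "0 < s" for k s
    unfolding D_def mult[OF that] by (simp add: algebra_simps)
  \<comment> \<open>Division by 8 brings numbers below 2 under 1/4, where L is bounded, and D scales
    back by the factor 8.\<close>
  define K where "K = 8 * (2 * real n + \<bar>L 1\<bar>)"
  have D2: "\<bar>D s\<bar> \<le> K" if s: "0 < s" "s < 2" for s
  proof -
    have "\<bar>L (s / 8)\<bar> \<le> 2 * real n" using s by (intro bounded) auto
    moreover have "\<bar>L 1 * (s / 8)\<bar> \<le> \<bar>L 1\<bar> * 1"
      unfolding abs_mult using s by (intro mult_left_mono) auto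
    ultimately have "\<bar>D (s / 8)\<bar> \<le> 2 * real n + \<bar>L 1\<bar>" unfolding D_def by linarith
    moreover have "D s = 8 * D (s / 8)" using D_mult[of "s / 8" 7] s by simp
    ultimately show ?thesis by (simp add: K_def abs_mult)
  qed
  have D_bdd: "\<bar>D s\<bar> \<le> K" if s: "0 < s" for s
  proof (cases "s < 2")
    case False
    \<comment> \<open>\<open>Suc k\<close> is the integer part of s minus 1, which leaves a
      remainder in [1, 2): additivity is known for positive arguments only, and s may itself be an
      integer.\<close>
    define k where "k = nat \<lfloor>s\<rfloor> - 2"
    have k: "real (Suc k) = of_int \<lfloor>s\<rfloor> - 1"
      using False by (simp add: k_def of_nat_diff le_nat_iff le_floor_iff)
    define r where "r = s - real (Suc k)"
    have r: "0 < r" "r < 2" unfolding r_def k by linarith+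
    have "D s = D r + D (real (Suc k))"
      using add[OF r(1), of "real (Suc k)"] by (simp add: D_def r_def algebra_simps)
    also have "D (real (Suc k)) = 0" using D_mult[of 1 k] by (simp add: D_def)
    finally show ?thesis using D2[OF r] by simp
  qed (use D2 s in simp)
  have "\<bar>D t\<bar> \<le> 0 + e" if e: "e > 0" for e
  proof -
    obtain k where k: "K / e < real k" using reals_Archimedean2 by blast
    have "real (Suc k) * \<bar>D t\<bar> \<le> K"
      using D_bdd[of "real (Suc k) * t"] t unfolding D_mult[OF t] by (simp add: abs_mult)
    also have "K \<le> real k * e" using k e by (simp add: divide_less_eq less_imp_le)
    also have "\<dots> \<le> real (Suc k) * e" using e by (intro mult_right_mono) auto
    finally show ?thesis by (simp add: mult_le_cancel_left)
  qed
  then have "\<bar>D t\<bar> \<le> 0" by (rule field_le_epsilon)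
  then show ?thesis by (simp add: D_def)
qed

section \<open>Harmonic transforms of path laws\<close>

text \<open>Doob's transform of the semigroup, multiplied by \<psi> x so that no division occurs in
  \<open>ennreal\<close>.\<close>

locale h_transform = P: right_process h P + Q: right_process h Q
  for h :: "'a::topological_space \<Rightarrow> 'b::metric_space" and P Q +
  fixes c :: real and \<psi> :: "'a \<Rightarrow> real"
  assumes measurable_psi [measurable]: "\<psi> \<in> borel_measurable borel"
    and psi_pos: "\<psi> x > 0"
    and transform: "0 < t \<Longrightarrow> f \<in> borel_measurable borel \<Longrightarrow>
      ennreal (\<psi> x) * (\<integral>\<^sup>+\<omega>. f (\<omega> t) \<partial>Q x) =
      ennreal (exp (- c * t)) * (\<integral>\<^sup>+\<omega>. ennreal (\<psi> (\<omega> t)) * f (\<omega> t) \<partial>P x)"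
begin

lemma harmonic_psi:
  assumes "t > 0" shows "(\<integral>\<^sup>+\<omega>. ennreal (\<psi> (\<omega> t)) \<partial>P x) = ennreal (exp (c * t) * \<psi> x)"
proof -
  have "ennreal (\<psi> x) = ennreal (exp (- c * t)) * (\<integral>\<^sup>+\<omega>. ennreal (\<psi> (\<omega> t)) \<partial>P x)"
    using transform[OF assms, of "\<lambda>_. 1" x] Q.P.emeasure_space_1[of x] by simp
  then have "ennreal (exp (c * t)) * ennreal (\<psi> x) =
      (ennreal (exp (c * t)) * ennreal (exp (- c * t))) * (\<integral>\<^sup>+\<omega>. ennreal (\<psi> (\<omega> t)) \<partial>P x)"
    by (simp add: mult.assoc)
  also have "ennreal (exp (c * t)) * ennreal (exp (- c * t)) = 1"
    by (simp add: ennreal_mult'[symmetric] exp_add[symmetric])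
  finally show ?thesis by (simp add: ennreal_mult')
qed

sublocale harmonic h P c \<psi>
  by unfold_locales (simp_all add: psi_pos harmonic_psi)

lemma transform_nonneg:
  assumes t: "0 \<le> t" and f: "f \<in> borel_measurable borel"
  shows "ennreal (\<psi> x) * (\<integral>\<^sup>+\<omega>. f (\<omega> t) \<partial>Q x) =
      ennreal (exp (- c * t)) * (\<integral>\<^sup>+\<omega>. ennreal (\<psi> (\<omega> t)) * f (\<omega> t) \<partial>P x)"
proof (cases "t = 0")
  case True
  have "(\<integral>\<^sup>+\<omega>. f (\<omega> 0) \<partial>Q x) = (\<integral>\<^sup>+\<omega>. f x \<partial>Q x)"
    using Q.start[of x] by (intro nn_integral_cong_AE) auto
  moreover have "(\<integral>\<^sup>+\<omega>. ennreal (\<psi> (\<omega> 0)) * f (\<omega> 0) \<partial>P x) = (\<integral>\<^sup>+\<omega>. ennreal (\<psi> x) * f x \<partial>P x)"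
    using P.start[of x] by (intro nn_integral_cong_AE) auto
  ultimately show ?thesis
    using True P.P.emeasure_space_1[of x] Q.P.emeasure_space_1[of x] by simp
qed (use transform t f in simp)

text \<open>The one-time transform acts at the first time s, the induction hypothesis acts on the
  rest from \<open>\<omega> s\<close> with horizon t - s, and the Markov property of P reassembles
  the two.\<close>

lemma transform_cylinder:
  assumes "finite J" "J \<subseteq> {0..t}" "\<forall>s. A s \<in> sets borel" "0 \<le> t"
  shows "ennreal (\<psi> x) * emeasure (Q x) (cylinder J A) =
    ennreal (exp (- c * t)) * (\<integral>\<^sup>+\<omega>\<in>cylinder J A. ennreal (\<psi> (\<omega> t)) \<partial>P x)"
  using assms
proof (induction "card J" arbitrary: J A t x rule: less_induct)
  case less
  show ?case
  proof (cases "J = {}")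
    case True
    have "(\<integral>\<^sup>+\<omega>\<in>cadlag_paths. ennreal (\<psi> (\<omega> t)) \<partial>P x) = (\<integral>\<^sup>+\<omega>. ennreal (\<psi> (\<omega> t)) \<partial>P x)"
      by (intro nn_integral_cong) simp
    then show ?thesis
      using True transform_nonneg[OF less.prems(4), of "\<lambda>_. 1" x] by simp
  next
    case False
    define s where "s = Min J"
    define J' where "J' = (\<lambda>r. r - s) ` (J - {s})"
    note C = cylinder_Min[OF less.prems(1) False less.prems(2), folded s_def, folded J'_def]
    let ?C = "cylinder J' (\<lambda>r. A (s + r))"
    have ts: "0 \<le> t - s" using C(6) by simp
    have C': "?C \<in> sets (path_sigma {0..})"
      using C less.prems by (intro cylinder_sets) auto
    have cs: "cylinder {s} A \<in> sets (path_sigma {0..s})"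
      using less.prems C(5) by (intro cylinder_sets) auto
    have As[measurable]: "A s \<in> sets borel" using less.prems by simp
    have J'0: "J' \<subseteq> {0..}" using C(4) by auto
    have g[measurable]: "(\<lambda>y. emeasure (Q y) ?C) \<in> borel_measurable borel"
      using less.prems by (intro Q.cylinder_kernel C(2) J'0) simp
    have ind: "indicator (cylinder J A) \<omega> = indicator (cylinder {s} A) \<omega> *
        (indicator ?C (shift s \<omega>) :: ennreal)" for \<omega>
      unfolding C(1) by (auto simp: indicator_def)
    have co: "(\<lambda>w :: real \<Rightarrow> 'a. w (t - s)) \<in> borel_measurable (path_sigma {0..})"
      using ts by (intro measurable_coordinate) simp
    have \<Phi>: "(\<lambda>w. ennreal (\<psi> (w (t - s))) * indicator ?C w) \<in> borel_measurable (path_sigma {0..})"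
      using co C' by measurable
    have inner: "(\<lambda>y. \<integral>\<^sup>+w. ennreal (\<psi> (w (t - s))) * indicator ?C w \<partial>P y) \<in> borel_measurable borel"
      by (rule measurable_compose[OF P.kernel nn_integral_measurable_subprob_algebra[OF \<Phi>]])
    have IH: "ennreal (\<psi> y) * emeasure (Q y) ?C =
        ennreal (exp (- c * (t - s))) * (\<integral>\<^sup>+w\<in>?C. ennreal (\<psi> (w (t - s))) \<partial>P y)" for y
      by (rule less.hyps[OF C(3,2,4) _ ts]) (use less.prems in simp)
    have "emeasure (Q x) (cylinder J A) = (\<integral>\<^sup>+\<omega>. indicator (A s) (\<omega> s) * emeasure (Q (\<omega> s)) ?C \<partial>Q x)"
    proof -
      have "emeasure (Q x) (cylinder J A) = (\<integral>\<^sup>+\<omega>\<in>cylinder {s} A. emeasure (Q (\<omega> s)) ?C \<partial>Q x)"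
        unfolding C(1) by (rule Q.strong_markov_event[OF optional_time_const[OF C(5)]
            prior_events_const[OF cs] C'])
      also have "\<dots> = (\<integral>\<^sup>+\<omega>. indicator (A s) (\<omega> s) * emeasure (Q (\<omega> s)) ?C \<partial>Q x)"
        by (intro nn_integral_cong) (auto simp: cylinder_def indicator_def)
      finally show ?thesis .
    qed
    then have "ennreal (\<psi> x) * emeasure (Q x) (cylinder J A) =
        ennreal (exp (- c * s)) * (\<integral>\<^sup>+\<omega>. ennreal (\<psi> (\<omega> s)) * (indicator (A s) (\<omega> s) *
            emeasure (Q (\<omega> s)) ?C) \<partial>P x)"
      using transform_nonneg[OF C(5), of "\<lambda>y. indicator (A s) y * emeasure (Q y) ?C" x] by simp
    also have "(\<integral>\<^sup>+\<omega>. ennreal (\<psi> (\<omega> s)) * (indicator (A s) (\<omega> s) * emeasure (Q (\<omega> s)) ?C) \<partial>P x) =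
        (\<integral>\<^sup>+\<omega>. ennreal (exp (- c * (t - s))) * (indicator (A s) (\<omega> s) *
            (\<integral>\<^sup>+w\<in>?C. ennreal (\<psi> (w (t - s))) \<partial>P (\<omega> s))) \<partial>P x)"
      by (intro nn_integral_cong) (metis (no_types, lifting) IH mult.left_commute)
    also have "\<dots> = ennreal (exp (- c * (t - s))) *
        (\<integral>\<^sup>+\<omega>. indicator (A s) (\<omega> s) * (\<integral>\<^sup>+w\<in>?C. ennreal (\<psi> (w (t - s))) \<partial>P (\<omega> s)) \<partial>P x)"
      by (intro nn_integral_cmult measurable_compose[OF P.measurable_eval_P[OF C(5)],
          where g="\<lambda>y. indicator (A s) y * (\<integral>\<^sup>+w\<in>?C. ennreal (\<psi> (w (t - s))) \<partial>P y)"]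
          borel_measurable_times_ennreal inner) measurable
    also have "(\<integral>\<^sup>+\<omega>. indicator (A s) (\<omega> s) * (\<integral>\<^sup>+w\<in>?C. ennreal (\<psi> (w (t - s))) \<partial>P (\<omega> s)) \<partial>P x) =
        (\<integral>\<^sup>+\<omega>\<in>cylinder {s} A. (\<integral>\<^sup>+w\<in>?C. ennreal (\<psi> (w (t - s))) \<partial>P (\<omega> s)) \<partial>P x)"
      by (intro nn_integral_cong) (auto simp: cylinder_def indicator_def)
    also have "\<dots> = (\<integral>\<^sup>+\<omega>\<in>cylinder {s} A. (ennreal (\<psi> (shift s \<omega> (t - s))) *
        indicator ?C (shift s \<omega>)) \<partial>P x)"
      by (rule P.markov[OF C(5) cs \<Phi>, symmetric])
    also have "\<dots> = (\<integral>\<^sup>+\<omega>\<in>cylinder J A. ennreal (\<psi> (\<omega> t)) \<partial>P x)"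
      using ts by (intro nn_integral_cong) (simp add: ind shift_apply mult_ac)
    also have "ennreal (exp (- c * s)) * (ennreal (exp (- c * (t - s))) *
        (\<integral>\<^sup>+\<omega>\<in>cylinder J A. ennreal (\<psi> (\<omega> t)) \<partial>P x)) =
        ennreal (exp (- c * s + - c * (t - s))) * (\<integral>\<^sup>+\<omega>\<in>cylinder J A. ennreal (\<psi> (\<omega> t)) \<partial>P x)"
      by (simp only: mult.assoc[symmetric] ennreal_mult'[symmetric] exp_ge_zero exp_add)
    also have "- c * s + - c * (t - s) = - c * t" by (simp add: algebra_simps)
    finally show ?thesis .
  qed
qed

lemma subalgebra_paths:
  assumes "sets M = sets (path_sigma {0..})" "0 \<le> t"
  shows "subalgebra M (path_sigma {0..t})"
  using sets_path_sigma_mono[of "{0..t}" "{0..}"] assms sets_eq_imp_space_eq[OF assms(1)]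
  by (auto simp: subalgebra_def)

text \<open>Cylinders generate the \<sigma>-algebra and are stable under intersection. Writing
  \<open>\<psi> (\<omega> 0)\<close> for \<open>\<psi> x\<close>, which is the same almost surely,
  gives one density for all starting points.\<close>

lemma path_density:
  assumes t: "0 \<le> t"
  shows "restr_to_subalg (Q x) (path_sigma {0..t}) =
    density (restr_to_subalg (P x) (path_sigma {0..t}))
      (\<lambda>\<omega>. ennreal (exp (- c * t) * (\<psi> (\<omega> t) / \<psi> (\<omega> 0))))"
proof -
  let ?F = "path_sigma {0..t} :: (real \<Rightarrow> 'a) measure"
  let ?d = "\<lambda>\<omega>. ennreal (exp (- c * t) * (\<psi> (\<omega> t) / \<psi> (\<omega> 0)))"
  note subP = subalgebra_paths[OF P.sets_P t] and subQ = subalgebra_paths[OF Q.sets_P t]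
  have co[measurable]: "(\<lambda>\<omega> :: real \<Rightarrow> 'a. \<omega> t) \<in> borel_measurable ?F" "(\<lambda>\<omega> :: real \<Rightarrow> 'a. \<omega> 0) \<in>
      borel_measurable ?F"
    using t by (auto intro!: measurable_coordinate)
  have d[measurable]: "?d \<in> borel_measurable ?F" by measurable
  have d': "?d \<in> borel_measurable (restr_to_subalg (P x) ?F)"
    using d by (simp add: measurable_cong_sets[OF sets_restr_to_subalg[OF subP] refl])
  have dP: "emeasure (density (restr_to_subalg (P x) ?F) ?d) A = (\<integral>\<^sup>+\<omega>\<in>A. ?d \<omega> \<partial>P x)"
    if A: "A \<in> sets ?F" for A
  proof -
    have "emeasure (density (restr_to_subalg (P x) ?F) ?d) A = (\<integral>\<^sup>+\<omega>\<in>A. ?d \<omega> \<partial>restr_to_subalg (P x) ?F)"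
      using A d' by (intro emeasure_density) (simp_all add: sets_restr_to_subalg[OF subP])
    also have "\<dots> = (\<integral>\<^sup>+\<omega>\<in>A. ?d \<omega> \<partial>P x)"
      using A d by (intro nn_integral_subalgebra2[OF subP] borel_measurable_times_ennreal
          borel_measurable_indicator)
    finally show ?thesis .
  qed
  show ?thesis
  proof (rule measure_eqI_generator_eq[OF Int_stable_cylinders[of "{0..t}"],
      where \<Omega> = cadlag_paths and A = "\<lambda>_. cadlag_paths"])
    show "cylinders {0..t} \<subseteq> Pow cadlag_paths" by (auto simp: cylinder_def)
    show "sets (restr_to_subalg (Q x) ?F) = sigma_sets cadlag_paths (cylinders {0..t})"
      by (simp only: sets_restr_to_subalg[OF subQ] sets_path_sigma_cylinders)
    show "sets (density (restr_to_subalg (P x) ?F) ?d) = sigma_sets cadlag_paths (cylinders {0..t})"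
      by (simp only: sets_density sets_restr_to_subalg[OF subP] sets_path_sigma_cylinders)
    show "range (\<lambda>_::nat. cadlag_paths) \<subseteq> cylinders {0..t}" using cadlag_paths_in_cylinders by blast
    show "emeasure (restr_to_subalg (Q x) ?F) cadlag_paths \<noteq> \<infinity>" for i :: nat
      by (subst emeasure_restr_to_subalg[OF subQ]) (simp_all add: Q.P.emeasure_finite)
    fix X :: "(real \<Rightarrow> 'a) set" assume "X \<in> cylinders {0..t}"
    then obtain J A where X: "X = cylinder J A"
        and J: "finite J" "J \<subseteq> {0..t}" "\<forall>s. A s \<in> sets borel" by blast
    have XF: "X \<in> sets ?F" unfolding X by (rule cylinder_sets[OF J])
    have XP: "X \<in> sets (P x)" using XF path_sigma_mono[of X "{0..t}" "{0..}"] by (auto simp: P.sets_P)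
    have m: "(\<lambda>\<omega>. ennreal (\<psi> (\<omega> t))) \<in> borel_measurable (P x)"
      using P.measurable_eval_P[OF t] by measurable
    have "emeasure (restr_to_subalg (Q x) ?F) X = emeasure (Q x) X"
      by (rule emeasure_restr_to_subalg[OF subQ XF])
    also have "\<dots> = ennreal (1 / \<psi> x) * (ennreal (\<psi> x) * emeasure (Q x) X)"
      using psi_pos[of x] by (simp add: mult.assoc[symmetric] ennreal_mult'[symmetric])
    also have "\<dots> = ennreal (1 / \<psi> x) * (ennreal (exp (- c * t)) * (\<integral>\<^sup>+\<omega>\<in>X. ennreal (\<psi> (\<omega> t)) \<partial>P x))"
      unfolding X by (simp only: transform_cylinder[OF J t])
    also have "\<dots> = (\<integral>\<^sup>+\<omega>. (ennreal (1 / \<psi> x) * ennreal (exp (- c * t))) * (ennreal (\<psi> (\<omega> t)) *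
        indicator X \<omega>) \<partial>P x)"
      unfolding mult.assoc[symmetric, of "ennreal (1 / \<psi> x)"]
      using m XP by (intro nn_integral_cmult[symmetric] borel_measurable_times_ennreal
          borel_measurable_indicator)
    also have "\<dots> = (\<integral>\<^sup>+\<omega>\<in>X. ?d \<omega> \<partial>P x)"
    proof (rule nn_integral_cong_AE, rule AE_mp[OF P.start[of x]], rule AE_I2, rule impI)
      fix \<omega> :: "real \<Rightarrow> 'a" assume "\<omega> 0 = x"
      then show "(ennreal (1 / \<psi> x) * ennreal (exp (- c * t))) * (ennreal (\<psi> (\<omega> t)) *
          indicator X \<omega>) = ?d \<omega> * indicator X \<omega>"
        using psi_pos[of x] psi_pos[of "\<omega> t"]
        by (simp add: mult.assoc[symmetric] ennreal_mult'[symmetric] less_imp_le mult_ac)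
    qed
    also have "\<dots> = emeasure (density (restr_to_subalg (P x) ?F) ?d) X" by (rule dP[OF XF, symmetric])
    finally show "emeasure (restr_to_subalg (Q x) ?F) X =
        emeasure (density (restr_to_subalg (P x) ?F) ?d) X" .
  qed simp
qed

lemma nn_integral_transform:
  assumes t: "0 \<le> t" and F: "F \<in> borel_measurable (path_sigma {0..t})"
  shows "(\<integral>\<^sup>+\<omega>. F \<omega> \<partial>Q x) = (\<integral>\<^sup>+\<omega>. ennreal (exp (- c * t) * (\<psi> (\<omega> t) / \<psi> x)) * F \<omega> \<partial>P x)"
proof -
  let ?F = "path_sigma {0..t} :: (real \<Rightarrow> 'a) measure"
  let ?d = "\<lambda>\<omega>. ennreal (exp (- c * t) * (\<psi> (\<omega> t) / \<psi> (\<omega> 0)))"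
  note subP = subalgebra_paths[OF P.sets_P t] and subQ = subalgebra_paths[OF Q.sets_P t]
  have [measurable]: "(\<lambda>\<omega> :: real \<Rightarrow> 'a. \<omega> t) \<in> borel_measurable ?F" "(\<lambda>\<omega> :: real \<Rightarrow> 'a. \<omega> 0) \<in>
      borel_measurable ?F"
    using t by (auto intro!: measurable_coordinate)
  have d: "?d \<in> borel_measurable ?F" by measurable
  have "(\<integral>\<^sup>+\<omega>. F \<omega> \<partial>Q x) = (\<integral>\<^sup>+\<omega>. F \<omega> \<partial>restr_to_subalg (Q x) ?F)"
    by (rule nn_integral_subalgebra2[OF subQ F, symmetric])
  also have "\<dots> = (\<integral>\<^sup>+\<omega>. ?d \<omega> * F \<omega> \<partial>restr_to_subalg (P x) ?F)"
    unfolding path_density[OF t] using d F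
    by (intro nn_integral_density) (simp_all add: measurable_cong_sets[OF sets_restr_to_subalg[OF
        subP] refl])
  also have "\<dots> = (\<integral>\<^sup>+\<omega>. ?d \<omega> * F \<omega> \<partial>P x)"
    using d F by (intro nn_integral_subalgebra2[OF subP] borel_measurable_times_ennreal)
  also have "\<dots> = (\<integral>\<^sup>+\<omega>. ennreal (exp (- c * t) * (\<psi> (\<omega> t) / \<psi> x)) * F \<omega> \<partial>P x)"
    using P.start[of x] by (intro nn_integral_cong_AE) (auto elim: AE_mp)
  finally show ?thesis .
qed

text \<open>The density is strictly positive, so the two laws share their null sets.\<close>

lemma equivalent_path_laws:
  assumes t: "0 \<le> t"
  shows "equivalent_measures (restr_to_subalg (P x) (path_sigma {0..t})) (restr_to_subalg (Q x)
      (path_sigma {0..t}))"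
proof -
  let ?F = "path_sigma {0..t} :: (real \<Rightarrow> 'a) measure"
  let ?M = "restr_to_subalg (P x) ?F"
  let ?d = "\<lambda>\<omega>. ennreal (exp (- c * t) * (\<psi> (\<omega> t) / \<psi> (\<omega> 0)))"
  note subP = subalgebra_paths[OF P.sets_P t]
  have [measurable]: "(\<lambda>\<omega> :: real \<Rightarrow> 'a. \<omega> t) \<in> borel_measurable ?F" "(\<lambda>\<omega> :: real \<Rightarrow> 'a. \<omega> 0) \<in>
      borel_measurable ?F"
    using t by (auto intro!: measurable_coordinate)
  have "?d \<in> borel_measurable ?F" by measurable
  then have d: "?d \<in> borel_measurable ?M"
    by (simp add: measurable_cong_sets[OF sets_restr_to_subalg[OF subP] refl])
  have pos: "?d \<omega> > 0" for \<omega> using psi_pos by simp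
  have "A \<in> null_sets ?M \<longleftrightarrow> A \<in> null_sets (density ?M ?d)" for A
  proof -
    have "(AE \<omega> in ?M. \<omega> \<in> A \<longrightarrow> ?d \<omega> = 0) \<longleftrightarrow> (AE \<omega> in ?M. \<omega> \<notin> A)"
      using pos by (intro AE_cong) (auto simp: less_le)
    then have "A \<in> null_sets (density ?M ?d) \<longleftrightarrow> A \<in> sets ?M \<and> (AE \<omega> in ?M. \<omega> \<notin> A)"
      by (simp only: null_sets_density_iff[OF d])
    then show ?thesis using AE_iff_null_sets[of A ?M] null_setsD2[of A ?M] by blast
  qed
  then show ?thesis
    unfolding equivalent_measures_def absolutely_continuous_def path_density[OF t] by blast
qed

end

section \<open>The transform relating two processes with a common diagonal bridge\<close>

context bridged
begin

text \<open>The transform at a single time t, where b stands for the exponential factor before its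
  dependence on t is known.\<close>

definition scaled :: "real \<Rightarrow> real \<Rightarrow> bool" where
  "scaled t b \<longleftrightarrow> (\<forall>f\<in>borel_measurable borel. \<forall>x. ennreal (\<psi> x) * (\<integral>\<^sup>+\<omega>. f (\<omega> t) \<partial>Q x) =
     ennreal b * (\<integral>\<^sup>+\<omega>. ennreal (\<psi> (\<omega> t)) * f (\<omega> t) \<partial>P x))"

lemma scaledD:
  "scaled t b \<Longrightarrow> f \<in> borel_measurable borel \<Longrightarrow> ennreal (\<psi> x) * (\<integral>\<^sup>+\<omega>. f (\<omega> t) \<partial>Q x) =
     ennreal b * (\<integral>\<^sup>+\<omega>. ennreal (\<psi> (\<omega> t)) * f (\<omega> t) \<partial>P x)"
  by (simp add: scaled_def)

lemma scaled_small:
  assumes s: "0 < s" "s < v" shows "\<exists>b>0. scaled s b"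
proof -
  obtain b where b: "b > 0" "\<And>x. AE y in m. q x s y * w y = b * (p x s y * \<psi> y) / \<psi> x"
    using density_ratio_small[OF s] by blast
  have "scaled s b"
    unfolding scaled_def
  proof (intro ballI allI)
    fix f :: "'a \<Rightarrow> ennreal" and x assume f[measurable]: "f \<in> borel_measurable borel"
    have [measurable]: "(\<lambda>y. p x s y) \<in> borel_measurable borel" "(\<lambda>y. q x s y) \<in> borel_measurable borel"
      using s by (auto intro!: P.measurable_p Q.measurable_p)
    have "(\<integral>\<^sup>+\<omega>. f (\<omega> s) \<partial>Q x) = (\<integral>\<^sup>+y. ennreal (w y) * (ennreal (q x s y) * f y) \<partial>m)"
      unfolding Q.nn_density(1)[OF s(1) f] by (rule nn_integral_n) measurable
    then have "ennreal (\<psi> x) * (\<integral>\<^sup>+\<omega>. f (\<omega> s) \<partial>Q x) =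
        (\<integral>\<^sup>+y. ennreal (\<psi> x) * (ennreal (w y) * (ennreal (q x s y) * f y)) \<partial>m)"
      by (simp, intro nn_integral_cmult[symmetric]) (unfold P.measurable_borel_m, measurable)
    also have "\<dots> = (\<integral>\<^sup>+y. ennreal b * (ennreal (p x s y) * (ennreal (\<psi> y) * f y)) \<partial>m)"
    proof (rule nn_integral_cong_AE)
      show "AE y in m. ennreal (\<psi> x) * (ennreal (w y) * (ennreal (q x s y) * f y)) =
          ennreal b * (ennreal (p x s y) * (ennreal (\<psi> y) * f y))"
        using b(2)[of x]
      proof eventually_elim
        case (elim y)
        have "\<psi> x * (w y * q x s y) = b * (p x s y * \<psi> y)"
          using elim \<psi>_pos[of x] by (simp add: field_simps)
        then have "ennreal (\<psi> x * (w y * q x s y)) * f y = ennreal (b * (p x s y * \<psi> y)) * f y"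
          by (simp only:)
        then show ?case
          using \<psi>_pos b(1) w_pos[of y] P.p_pos[OF s(1)] Q.p_pos[OF s(1)]
          by (simp add: ennreal_mult less_imp_le mult.assoc)
      qed
    qed
    also have "\<dots> = ennreal b * (\<integral>\<^sup>+y. ennreal (p x s y) * (ennreal (\<psi> y) * f y) \<partial>m)"
      by (rule nn_integral_cmult) (unfold P.measurable_borel_m, measurable)
    also have "(\<integral>\<^sup>+y. ennreal (p x s y) * (ennreal (\<psi> y) * f y) \<partial>m) = (\<integral>\<^sup>+\<omega>. ennreal (\<psi> (\<omega> s)) *
        f (\<omega> s) \<partial>P x)"
      by (rule P.nn_density(1)[OF s(1), where f="\<lambda>y. ennreal (\<psi> y) * f y", symmetric]) measurable
    finally show "ennreal (\<psi> x) * (\<integral>\<^sup>+\<omega>. f (\<omega> s) \<partial>Q x) =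
        ennreal b * (\<integral>\<^sup>+\<omega>. ennreal (\<psi> (\<omega> s)) * f (\<omega> s) \<partial>P x)" .
  qed
  with b(1) show ?thesis by blast
qed

lemma scaled_add:
  assumes s: "0 < s" "scaled s a" and t: "0 < t" "scaled t b" and ab: "0 < a" "0 < b"
  shows "scaled (s + t) (a * b)"
  unfolding scaled_def
proof (intro ballI allI)
  fix f :: "'a \<Rightarrow> ennreal" and x assume f[measurable]: "f \<in> borel_measurable borel"
  have st: "0 \<le> s" "0 \<le> t" using s t by simp_all
  have g: "(\<lambda>y. \<integral>\<^sup>+w. f (w t) \<partial>Q y) \<in> borel_measurable borel"
    by (rule Q.measurable_semigroup[OF st(2) f])
  have \<psi>f: "(\<lambda>y. ennreal (\<psi> y) * f y) \<in> borel_measurable borel" by measurable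
  have "ennreal (\<psi> x) * (\<integral>\<^sup>+\<omega>. f (\<omega> (s + t)) \<partial>Q x) =
      ennreal a * (\<integral>\<^sup>+\<omega>. ennreal (\<psi> (\<omega> s)) * (\<integral>\<^sup>+w. f (w t) \<partial>Q (\<omega> s)) \<partial>P x)"
    unfolding Q.semigroup[OF st f] by (rule scaledD[OF s(2) g])
  also have "(\<integral>\<^sup>+\<omega>. ennreal (\<psi> (\<omega> s)) * (\<integral>\<^sup>+w. f (w t) \<partial>Q (\<omega> s)) \<partial>P x) =
      (\<integral>\<^sup>+\<omega>. ennreal b * (\<integral>\<^sup>+w. ennreal (\<psi> (w t)) * f (w t) \<partial>P (\<omega> s)) \<partial>P x)"
    by (intro nn_integral_cong scaledD[OF t(2) f])
  also have "\<dots> = ennreal b * (\<integral>\<^sup>+\<omega>. (\<integral>\<^sup>+w. ennreal (\<psi> (w t)) * f (w t) \<partial>P (\<omega> s)) \<partial>P x)"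
    by (intro nn_integral_cmult measurable_compose[OF P.measurable_eval_P[OF st(1)]]
        P.measurable_semigroup[OF st(2) \<psi>f])
  also have "(\<integral>\<^sup>+\<omega>. (\<integral>\<^sup>+w. ennreal (\<psi> (w t)) * f (w t) \<partial>P (\<omega> s)) \<partial>P x) =
      (\<integral>\<^sup>+\<omega>. ennreal (\<psi> (\<omega> (s + t))) * f (\<omega> (s + t)) \<partial>P x)"
    by (rule P.semigroup[OF st \<psi>f, symmetric])
  finally show "ennreal (\<psi> x) * (\<integral>\<^sup>+\<omega>. f (\<omega> (s + t)) \<partial>Q x) =
      ennreal (a * b) * (\<integral>\<^sup>+\<omega>. ennreal (\<psi> (\<omega> (s + t))) * f (\<omega> (s + t)) \<partial>P x)"
    using ab by (simp add: ennreal_mult mult.assoc)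
qed

text \<open>The bridges control times below v; a longer t is cut into equal pieces shorter than v,
  and the constants multiply.\<close>

lemma scaled_exists:
  assumes t: "0 < t" shows "\<exists>b>0. scaled t b"
proof -
  obtain k where k: "t / v < real k" using reals_Archimedean2 by blast
  define s where "s = t / real (Suc k)"
  have "t < real (Suc k) * v" using k v by (simp add: field_simps)
  then have s: "0 < s" "s < v" using t by (simp_all add: s_def field_simps)
  obtain b where b: "b > 0" "scaled s b" using scaled_small[OF s] by blast
  have "scaled (real (Suc i) * s) (b ^ Suc i)" for i
  proof (induction i)
    case (Suc i)
    have "scaled (s + real (Suc i) * s) (b * b ^ Suc i)"
      using b s Suc by (intro scaled_add) simp_all
    then show ?case by (simp add: algebra_simps)
  qed (use b in simp)
  from this[of k] have "scaled t (b ^ Suc k)" by (simp add: s_def del: of_nat_Suc)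
  with b(1) show ?thesis by (intro exI[of _ "b ^ Suc k"]) simp
qed

lemma scaled_semigroup:
  assumes "scaled t b" "0 < b" shows "(\<integral>\<^sup>+\<omega>. ennreal (\<psi> (\<omega> t)) \<partial>P x) = ennreal (\<psi> x / b)"
proof -
  have "ennreal (\<psi> x) = ennreal b * (\<integral>\<^sup>+\<omega>. ennreal (\<psi> (\<omega> t)) \<partial>P x)"
    using scaledD[OF assms(1), of "\<lambda>_. 1" x] Q.P.emeasure_space_1[of x] by simp
  then have "ennreal (1 / b) * ennreal (\<psi> x) =
      (ennreal (1 / b) * ennreal b) * (\<integral>\<^sup>+\<omega>. ennreal (\<psi> (\<omega> t)) \<partial>P x)"
    by (simp only: mult.assoc)
  also have "ennreal (1 / b) * ennreal b = 1" using assms(2) by (simp add: ennreal_mult'[symmetric])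
  finally show ?thesis using assms(2) by (simp add: ennreal_mult'[symmetric])
qed

text \<open>Testing with the function 1 shows that \<open>b t\<close> is the quotient of \<psi> by
  its image under the semigroup, at the reference point. This makes it unique, hence multiplicative,
  and measurable in t.\<close>

lemma scaled_exp: "\<exists>c. \<forall>t>0. scaled t (exp (- c * t))"
proof -
  let ?x = "undefined :: 'a"
  obtain b where b: "\<And>t. 0 < t \<Longrightarrow> b t > 0" "\<And>t. 0 < t \<Longrightarrow> scaled t (b t)"
    using scaled_exists by metis
  \<comment> \<open>The density p is jointly measurable on positive times; the value 1 fills in the
    other ones.\<close>
  define g where "g t = (\<integral>\<^sup>+y. ennreal (p ?x (if 0 < t then t else 1) y * \<psi> y) \<partial>m)" for t
  have g: "g t = ennreal (\<psi> ?x / b t)" if t: "0 < t" for t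
  proof -
    have "g t = (\<integral>\<^sup>+y. ennreal (p ?x t y) * ennreal (\<psi> y) \<partial>m)"
      unfolding g_def using t P.p_nonneg[OF t] by (simp add: ennreal_mult')
    also have "\<dots> = (\<integral>\<^sup>+\<omega>. ennreal (\<psi> (\<omega> t)) \<partial>P ?x)"
      by (rule P.nn_density(1)[OF t, symmetric]) measurable
    finally show ?thesis using scaled_semigroup[OF b(2) b(1)] t by simp
  qed
  have gm[measurable]: "g \<in> borel_measurable borel"
  proof -
    have [measurable]: "(\<lambda>z :: real \<times> 'a. p ?x (if 0 < fst z then fst z else 1) (snd z)) \<in>
        borel_measurable (borel \<Otimes>\<^sub>M m)"
    proof (rule P.measurable_p_times)
      have "(\<lambda>t :: real. if 0 < t then t else 1) \<in> borel_measurable borel" by simp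
      then show "(\<lambda>z :: real \<times> 'a. if 0 < fst z then fst z else 1) \<in> borel_measurable (borel \<Otimes>\<^sub>M m)"
        by (rule measurable_compose[OF measurable_fst])
      show "snd \<in> borel_measurable ((borel :: real measure) \<Otimes>\<^sub>M m)" by measurable
    qed simp_all
    have "(\<lambda>z :: real \<times> 'a. ennreal (p ?x (if 0 < fst z then fst z else 1) (snd z) * \<psi> (snd z)))
        \<in> borel_measurable (borel \<Otimes>\<^sub>M m)" by measurable
    from P.m.borel_measurable_nn_integral_fst[OF this] show ?thesis by (simp add: g_def[abs_def])
  qed
  define L where "L t = ln (\<psi> ?x / enn2real (g t))" for t
  have Lm: "L \<in> borel_measurable borel" unfolding L_def by measurable
  have Lb: "L t = ln (b t)" if t: "0 < t" for t
    using b(1)[OF t] \<psi>_pos[of ?x] unfolding L_def g[OF t] by (simp add: enn2real_ennreal)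
  have badd: "b (s + t) = b s * b t" if s: "0 < s" and t: "0 < t" for s t
  proof -
    have "scaled (s + t) (b s * b t)" using b s t by (intro scaled_add) simp_all
    then have "ennreal (\<psi> ?x / (b s * b t)) = ennreal (\<psi> ?x / b (s + t))"
      using scaled_semigroup[of "s + t" _ ?x] b s t by (metis add_pos_pos mult_pos_pos)
    then have "\<psi> ?x / (b s * b t) = \<psi> ?x / b (s + t)"
      using b(1)[OF s] b(1)[OF t] b(1)[of "s + t"] s t \<psi>_pos[of ?x] by (subst (asm) ennreal_inj) simp_all
    then show ?thesis using b(1)[OF s] b(1)[OF t] b(1)[of "s + t"] s t \<psi>_pos[of ?x]
        by (simp add: field_simps)
  qed
  have "L (s + t) = L s + L t" if s: "0 < s" and t: "0 < t" for s t
    using b(1)[OF s] b(1)[OF t] s t by (simp add: Lb badd ln_mult)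
  then have ln_b: "ln (b t) = L 1 * t" if "0 < t" for t
    unfolding Lb[OF that, symmetric] by (rule measurable_additive_linear[OF Lm _ that])
  have "\<forall>t>0. scaled t (exp (- (- L 1) * t))"
  proof (intro allI impI)
    fix t :: real assume t: "0 < t"
    have "exp (- (- L 1) * t) = exp (ln (b t))" unfolding ln_b[OF t] by simp
    also have "\<dots> = b t" using b(1)[OF t] by simp
    finally show "scaled t (exp (- (- L 1) * t))" using b(2)[OF t] by simp
  qed
  then show ?thesis by blast
qed

definition c :: real where "c = (SOME c. \<forall>t>0. scaled t (exp (- c * t)))"

sublocale forward: h_transform h P Q c \<psi>
proof
  show "\<psi> x > 0" for x by (rule \<psi>_pos)
  fix t :: real and f :: "'a \<Rightarrow> ennreal" and x assume "0 < t" "f \<in> borel_measurable borel"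
  moreover have "\<forall>t>0. scaled t (exp (- c * t))" unfolding c_def by (rule someI_ex[OF scaled_exp])
  ultimately show "ennreal (\<psi> x) * (\<integral>\<^sup>+\<omega>. f (\<omega> t) \<partial>Q x) =
      ennreal (exp (- c * t)) * (\<integral>\<^sup>+\<omega>. ennreal (\<psi> (\<omega> t)) * f (\<omega> t) \<partial>P x)"
    by (intro scaledD) simp_all
qed (rule measurable_\<psi>)

section \<open>The dual function and the exact relation between the densities\<close>

text \<open>The formula of \<open>q_eq\<close> at t = t0 and x = y, solved for its dual
  factor.\<close>

definition \<psi>' :: "'a \<Rightarrow> real" where
  "\<psi>' x = exp (- c * t0) * p x t0 x / (q x t0 x * \<psi> x)"

lemma \<psi>'_pos: "\<psi>' x > 0"
  by (simp add: \<psi>'_def P.p_pos Q.p_pos t0 \<psi>_pos)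

lemma measurable_\<psi>' [measurable]: "\<psi>' \<in> borel_measurable borel"
  unfolding \<psi>'_def
  by (intro borel_measurable_divide borel_measurable_times P.measurable_p Q.measurable_p
      measurable_\<psi>) (simp_all add: t0)

text \<open>The law of the position at s under \<open>Q x\<close> has two densities with respect to
  m, one from the bridges and one from the transform; dividing by p gives the claim.\<close>

lemma r_eq:
  assumes s: "0 < s" "s < t0"
  shows "AE y in m. r s x y = exp (- c * s) * (\<psi> y / \<psi> x)"
proof -
  have [measurable]: "(\<lambda>y. p x s y) \<in> borel_measurable borel" "(\<lambda>y. r s x y) \<in> borel_measurable borel"
    using s by (auto intro!: P.measurable_p measurable_r)
  define g where "g y = p x s y * (exp (- c * s) * (\<psi> y / \<psi> x))" for y
  have gm: "g \<in> borel_measurable borel" unfolding g_def by measurable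
  have "(\<integral>\<^sup>+y\<in>A. ennreal (p x s y * r s x y) \<partial>m) = (\<integral>\<^sup>+y\<in>A. ennreal (g y) \<partial>m)" if "A \<in> sets m" for A
  proof -
    have A[measurable]: "A \<in> sets borel" using that by simp
    have "(\<integral>\<^sup>+y\<in>A. ennreal (p x s y * r s x y) \<partial>m) = (\<integral>\<^sup>+\<omega>. indicator A (\<omega> s) \<partial>Q x)"
      using one_time[OF s, of "indicator A" x] Q.nn_density(1)[OF s(1), of "indicator A" x] by simp
    also have "\<dots> = ennreal (1 / \<psi> x) * (ennreal (\<psi> x) * (\<integral>\<^sup>+\<omega>. indicator A (\<omega> s) \<partial>Q x))"
      using \<psi>_pos[of x] by (simp add: mult.assoc[symmetric] ennreal_mult'[symmetric])
    also have "\<dots> = ennreal (1 / \<psi> x) * (ennreal (exp (- c * s)) * (\<integral>\<^sup>+y. ennreal (p x s y) *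
        (ennreal (\<psi> y) * indicator A y) \<partial>m))"
      using forward.transform[OF s(1), of "indicator A" x]
        P.nn_density(1)[OF s(1), of "\<lambda>y. ennreal (\<psi> y) * indicator A y" x] by simp
    also have "\<dots> = (\<integral>\<^sup>+y. (ennreal (1 / \<psi> x) * ennreal (exp (- c * s))) * (ennreal (p x s y) *
        (ennreal (\<psi> y) * indicator A y)) \<partial>m)"
      unfolding mult.assoc[symmetric, of "ennreal (1 / \<psi> x)"]
      by (rule nn_integral_cmult[symmetric]) (unfold P.measurable_borel_m, measurable)
    also have "\<dots> = (\<integral>\<^sup>+y\<in>A. ennreal (g y) \<partial>m)"
    proof (intro nn_integral_cong)
      fix y
      have "g y = 1 / \<psi> x * exp (- c * s) * (p x s y * \<psi> y)" by (simp add: g_def)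
      then show "(ennreal (1 / \<psi> x) * ennreal (exp (- c * s))) * (ennreal (p x s y) *
          (ennreal (\<psi> y) * indicator A y)) =
          ennreal (g y) * indicator A y"
        using \<psi>_pos[of x] \<psi>_pos[of y] P.p_pos[OF s(1), of x y]
            by (simp only: ennreal_mult' ennreal_mult less_imp_le zero_le_mult_iff exp_ge_zero
                divide_nonneg_pos zero_le_one mult.assoc)
    qed
    finally show ?thesis .
  qed
  then have "AE y in m. ennreal (p x s y * r s x y) = ennreal (g y)"
    by (intro AE_eq_of_nn_integral_eq P.sigma_finite_m) (unfold P.measurable_borel_m, use gm in
        measurable)
  then show ?thesis
  proof eventually_elim
    case (elim y)
    have pos: "p x s y > 0" "r s x y > 0" "exp (- c * s) * (\<psi> y / \<psi> x) > 0"
      using \<psi>_pos[of x] \<psi>_pos[of y] P.p_pos[OF s(1), of x y] r_pos[OF s(2), of x y] by simp_all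
    have "0 \<le> p x s y * r s x y" "0 \<le> g y"
      unfolding g_def by (intro mult_nonneg_nonneg less_imp_le pos)+
    then have "p x s y * r s x y = g y" using elim by (simp only: ennreal_inj)
    then show ?case unfolding g_def using pos(1) by (simp only: mult_cancel_left) simp
  qed
qed

text \<open>At time t0 - u from y, the definition of r contains p and q over the time u from z to y.
  Solving \<open>r_eq\<close> for q therefore holds for every endpoint y, with exceptions only in
  the starting point z.\<close>

lemma q_eq_AE:
  assumes u: "0 < u" "u < t0"
  shows "AE z in m. q z u y = exp (- c * u) * p z u y / (\<psi> z * \<psi>' y)"
proof -
  have "0 < t0 - u" "t0 - u < t0" using u by simp_all
  from r_eq[OF this, of y] show ?thesis
  proof eventually_elim
    case (elim z)
    have pos: "p z u y > 0" "q y t0 y > 0" "p y t0 y > 0" "q z u y > 0" "\<psi> z > 0" "\<psi> y > 0"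
      by (simp_all add: P.p_pos Q.p_pos t0 u \<psi>_pos)
    have ex: "exp (- c * (t0 - u)) = exp (- c * t0) / exp (- c * u)"
      by (simp add: exp_diff[symmetric] algebra_simps)
    have "p z u y * q y t0 y / (p y t0 y * q z u y) = exp (- c * t0) / exp (- c * u) * (\<psi> z / \<psi> y)"
      using elim unfolding r_def ex by simp
    then show ?case using pos by (simp add: \<psi>'_def field_simps)
  qed
qed

text \<open>The final stretch of length u, where q is known for almost all z, is integrated against
  the law at s = t - u. That law has a density, so the exceptional z vanish and all x, y and t are
  covered.\<close>

lemma q_eq:
  assumes t: "0 < t"
  shows "q x t y = exp (- c * t) * p x t y / (\<psi> x * \<psi>' y)"
proof -
  \<comment> \<open>u < t0 gives access to \<open>q_eq_AE\<close>, and u < t leaves s > 0.\<close>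
  define u where "u = min t t0 / 2"
  define s where "s = t - u"
  have u: "0 < u" "u < t0" and s: "0 < s" and ts: "t = s + u" using t t0
      by (auto simp: u_def s_def min_def)
  have [measurable]: "(\<lambda>z. p z u y) \<in> borel_measurable borel" "(\<lambda>z. q z u y) \<in> borel_measurable borel"
    "(\<lambda>z. p x s z) \<in> borel_measurable borel"
    using u s by (auto intro!: P.measurable_p Q.measurable_p)
  have "ennreal (q x t y) = (\<integral>\<^sup>+z. ennreal (q x s z) * ennreal (q z u y) \<partial>n)"
    unfolding ts Q.chapman_kolmogorov[OF u(1) s] using Q.p_nonneg[OF s] by (simp add: ennreal_mult')
  also have "\<dots> = (\<integral>\<^sup>+\<omega>. ennreal (q (\<omega> s) u y) \<partial>Q x)"
    by (rule Q.nn_density(1)[OF s, symmetric]) measurable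
  finally have "ennreal (\<psi> x) * ennreal (q x t y) =
      ennreal (exp (- c * s)) * (\<integral>\<^sup>+\<omega>. ennreal (\<psi> (\<omega> s)) * ennreal (q (\<omega> s) u y) \<partial>P x)"
    using forward.transform[OF s, of "\<lambda>z. ennreal (q z u y)" x] by simp
  also have "(\<integral>\<^sup>+\<omega>. ennreal (\<psi> (\<omega> s)) * ennreal (q (\<omega> s) u y) \<partial>P x) =
      (\<integral>\<^sup>+z. ennreal (p x s z) * (ennreal (\<psi> z) * ennreal (q z u y)) \<partial>m)"
    by (rule P.nn_density(1)[OF s, where f="\<lambda>z. ennreal (\<psi> z) * ennreal (q z u y)"]) measurable
  also have "\<dots> = (\<integral>\<^sup>+z. ennreal (exp (- c * u) / \<psi>' y) * ennreal (p x s z * p z u y) \<partial>m)"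
  proof (rule nn_integral_cong_AE)
    show "AE z in m. ennreal (p x s z) * (ennreal (\<psi> z) * ennreal (q z u y)) =
        ennreal (exp (- c * u) / \<psi>' y) * ennreal (p x s z * p z u y)"
      using q_eq_AE[OF u, of y]
    proof eventually_elim
      case (elim z)
      have pos: "0 < p x s z" "0 < \<psi> z" "0 < \<psi>' y" "0 < q z u y"
        by (simp_all add: P.p_pos s \<psi>_pos \<psi>'_pos Q.p_pos u)
      have "p x s z * (\<psi> z * q z u y) = exp (- c * u) / \<psi>' y * (p x s z * p z u y)"
        unfolding elim using pos by (simp add: field_simps)
      then show ?case using pos by (simp add: ennreal_mult'[symmetric] less_imp_le)
    qed
  qed
  also have "\<dots> = ennreal (exp (- c * u) / \<psi>' y) * (\<integral>\<^sup>+z. ennreal (p x s z * p z u y) \<partial>m)"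
    by (rule nn_integral_cmult) (unfold P.measurable_borel_m, measurable)
  also have "(\<integral>\<^sup>+z. ennreal (p x s z * p z u y) \<partial>m) = ennreal (p x t y)"
    unfolding ts by (rule P.chapman_kolmogorov[OF u(1) s, symmetric])
  finally have "ennreal (\<psi> x * q x t y) = ennreal (exp (- c * s) * (exp (- c * u) / \<psi>' y * p x t y))"
    using \<psi>_pos[of x] \<psi>'_pos[of y]
    by (simp only: ennreal_mult' exp_ge_zero divide_nonneg_nonneg less_imp_le)
  moreover have "0 \<le> \<psi> x * q x t y" "0 \<le> exp (- c * s) * (exp (- c * u) / \<psi>' y * p x t y)"
    using \<psi>_pos[of x] \<psi>'_pos[of y] P.p_pos[OF t, of x y] Q.p_pos[OF t, of x y]
        by (simp_all add: less_imp_le)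
  ultimately have "\<psi> x * q x t y = exp (- c * s) * (exp (- c * u) / \<psi>' y * p x t y)"
    by (subst (asm) ennreal_inj)
  also have "\<dots> = exp (- c * s) * exp (- c * u) * p x t y / \<psi>' y" by simp
  also have "exp (- c * s) * exp (- c * u) = exp (- c * t)"
    unfolding ts by (simp add: exp_add[symmetric] algebra_simps)
  finally show ?thesis using \<psi>_pos[of x] \<psi>'_pos[of y] by (simp add: field_simps)
qed

text \<open>The law at time 1 from the reference point is tested with 1 / q: this leaves n on the Q
  side, and by \<open>q_eq\<close> the weight \<psi> * \<psi>' on the P side.\<close>

lemma n_eq_psi: "n = density m (\<lambda>x. ennreal (\<psi> x * \<psi>' x))"
proof (rule measure_eqI)
  fix A assume "A \<in> sets n"
  then have A[measurable]: "A \<in> sets borel" by simp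
  let ?x = "undefined :: 'a"
  have one: "(0::real) < 1" by simp
  have [measurable]: "(\<lambda>y. q ?x 1 y) \<in> borel_measurable borel" by (intro Q.measurable_p) simp_all
  let ?f = "\<lambda>y. ennreal (1 / q ?x 1 y) * indicator A y"
  have q1: "q ?x 1 y > 0" for y by (simp add: Q.p_pos)
  have f: "?f \<in> borel_measurable borel" by measurable
  have "emeasure n A = (\<integral>\<^sup>+y. ennreal (q ?x 1 y) * ?f y \<partial>n)"
    unfolding mult.assoc[symmetric]
    using q1 A by (simp add: ennreal_mult'[symmetric] less_imp_le less_imp_neq[symmetric])
  also have "\<dots> = (\<integral>\<^sup>+\<omega>. ?f (\<omega> 1) \<partial>Q ?x)" by (rule Q.nn_density(1)[OF one f, symmetric])
  also have "\<dots> = ennreal (1 / \<psi> ?x) * (ennreal (\<psi> ?x) * (\<integral>\<^sup>+\<omega>. ?f (\<omega> 1) \<partial>Q ?x))"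
    using \<psi>_pos[of ?x] by (simp add: mult.assoc[symmetric] ennreal_mult'[symmetric])
  also have "ennreal (\<psi> ?x) * (\<integral>\<^sup>+\<omega>. ?f (\<omega> 1) \<partial>Q ?x) =
      ennreal (exp (- c * 1)) * (\<integral>\<^sup>+\<omega>. ennreal (\<psi> (\<omega> 1)) * ?f (\<omega> 1) \<partial>P ?x)"
    by (rule forward.transform[OF one f])
  also have "(\<integral>\<^sup>+\<omega>. ennreal (\<psi> (\<omega> 1)) * ?f (\<omega> 1) \<partial>P ?x) =
      (\<integral>\<^sup>+y. ennreal (p ?x 1 y) * (ennreal (\<psi> y) * ?f y) \<partial>m)"
    by (rule P.nn_density(1)[OF one, where f="\<lambda>y. ennreal (\<psi> y) * ?f y"]) measurable
  also have "\<dots> = (\<integral>\<^sup>+y. ennreal (\<psi> ?x * exp c) * (ennreal (\<psi> y * \<psi>' y) * indicator A y) \<partial>m)"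
  proof (intro nn_integral_cong)
    fix y
    have pos: "0 < p ?x 1 y" "0 < \<psi> ?x" "0 < \<psi> y" "0 < \<psi>' y" by (simp_all add: P.p_pos \<psi>_pos \<psi>'_pos)
    have "p ?x 1 y * (\<psi> y * (1 / q ?x 1 y)) = \<psi> ?x * exp c * (\<psi> y * \<psi>' y)"
      unfolding q_eq[OF one] using pos by (simp add: exp_minus field_simps)
    moreover have "ennreal (p ?x 1 y) * (ennreal (\<psi> y) * ?f y) = ennreal (p ?x 1 y * (\<psi> y *
        (1 / q ?x 1 y))) * indicator A y"
      using pos by (simp only: ennreal_mult' less_imp_le mult.assoc)
    moreover have "ennreal (\<psi> ?x * exp c) * (ennreal (\<psi> y * \<psi>' y) * indicator A y) =
        ennreal (\<psi> ?x * exp c * (\<psi> y * \<psi>' y)) * indicator A y"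
      using pos by (simp only: ennreal_mult'[symmetric] mult.assoc[symmetric] exp_ge_zero
          less_imp_le mult_nonneg_nonneg)
    ultimately show "ennreal (p ?x 1 y) * (ennreal (\<psi> y) * ?f y) =
        ennreal (\<psi> ?x * exp c) * (ennreal (\<psi> y * \<psi>' y) * indicator A y)" by simp
  qed
  also have "\<dots> = ennreal (\<psi> ?x * exp c) * (\<integral>\<^sup>+y. ennreal (\<psi> y * \<psi>' y) * indicator A y \<partial>m)"
    by (rule nn_integral_cmult) (unfold P.measurable_borel_m, measurable)
  also have "ennreal (1 / \<psi> ?x) * (ennreal (exp (- c * 1)) * (ennreal (\<psi> ?x * exp c) *
      (\<integral>\<^sup>+y. ennreal (\<psi> y * \<psi>' y) * indicator A y \<partial>m))) =
      ennreal (1 / \<psi> ?x * (exp (- c * 1) * (\<psi> ?x * exp c))) * (\<integral>\<^sup>+y. ennreal (\<psi> y * \<psi>' y) *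
          indicator A y \<partial>m)"
    using \<psi>_pos[of ?x] by (simp only: ennreal_mult' exp_ge_zero mult.assoc zero_le_divide_1_iff
        less_imp_le)
  also have "1 / \<psi> ?x * (exp (- c * 1) * (\<psi> ?x * exp c)) = 1"
    using \<psi>_pos[of ?x] by (simp add: exp_minus field_simps)
  also have "ennreal 1 * (\<integral>\<^sup>+y. ennreal (\<psi> y * \<psi>' y) * indicator A y \<partial>m) =
      emeasure (density m (\<lambda>x. ennreal (\<psi> x * \<psi>' x))) A"
    by (subst emeasure_density) (simp_all add: P.measurable_borel_m)
  finally show "emeasure n A = emeasure (density m (\<lambda>x. ennreal (\<psi> x * \<psi>' x))) A" .
qed simp

text \<open>The dual density is q with exchanged arguments, taken with respect to n; the factor
  \<psi> y in the density of n cancels the one in q. Path laws and fine continuity of the dual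
  processes follow with the same c.\<close>

sublocale dual: h_transform h P' Q' c \<psi>'
proof
  show "\<psi>' x > 0" for x by (rule \<psi>'_pos)
  fix t :: real and f :: "'a \<Rightarrow> ennreal" and x assume t: "0 < t"
      and f[measurable]: "f \<in> borel_measurable borel"
  have [measurable]: "(\<lambda>y. p y t x) \<in> borel_measurable borel" "(\<lambda>y. q y t x) \<in> borel_measurable borel"
    using t by (auto intro!: P.measurable_p Q.measurable_p)
  have "ennreal (\<psi>' x) * (\<integral>\<^sup>+\<omega>. f (\<omega> t) \<partial>Q' x) =
      ennreal (\<psi>' x) * (\<integral>\<^sup>+y. ennreal (\<psi> y * \<psi>' y) * (ennreal (q y t x) * f y) \<partial>m)"
    unfolding Q.nn_density(2)[OF t f] n_eq_psi
    by (subst nn_integral_density) (simp_all add: P.measurable_borel_m)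
  also have "\<dots> = (\<integral>\<^sup>+y. ennreal (\<psi>' x) * (ennreal (\<psi> y * \<psi>' y) * (ennreal (q y t x) * f y)) \<partial>m)"
    by (rule nn_integral_cmult[symmetric]) (unfold P.measurable_borel_m, measurable)
  also have "\<dots> = (\<integral>\<^sup>+y. ennreal (exp (- c * t)) * (ennreal (p y t x) * (ennreal (\<psi>' y) * f y)) \<partial>m)"
  proof (intro nn_integral_cong)
    fix y
    have pos: "0 < p y t x" "0 < q y t x" "0 < \<psi> y" "0 < \<psi>' y" "0 < \<psi>' x"
        by (simp_all add: P.p_pos Q.p_pos \<psi>_pos \<psi>'_pos t)
    have "\<psi>' x * (\<psi> y * \<psi>' y * q y t x) = exp (- c * t) * (p y t x * \<psi>' y)"
      unfolding q_eq[OF t] using pos by (simp add: field_simps)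
    then have "ennreal (\<psi>' x * (\<psi> y * \<psi>' y * q y t x)) * f y = ennreal (exp (- c * t) * (p y t x *
        \<psi>' y)) * f y"
      by (simp only:)
    moreover have "ennreal (\<psi>' x) * (ennreal (\<psi> y * \<psi>' y) * (ennreal (q y t x) * f y)) =
        ennreal (\<psi>' x * (\<psi> y * \<psi>' y * q y t x)) * f y"
      using pos by (simp add: ennreal_mult less_imp_le mult.assoc)
    moreover have "ennreal (exp (- c * t)) * (ennreal (p y t x) * (ennreal (\<psi>' y) * f y)) =
        ennreal (exp (- c * t) * (p y t x * \<psi>' y)) * f y"
      using pos by (simp only: ennreal_mult' exp_ge_zero less_imp_le mult.assoc)
    ultimately show "ennreal (\<psi>' x) * (ennreal (\<psi> y * \<psi>' y) * (ennreal (q y t x) * f y)) =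
        ennreal (exp (- c * t)) * (ennreal (p y t x) * (ennreal (\<psi>' y) * f y))" by simp
  qed
  also have "\<dots> = ennreal (exp (- c * t)) * (\<integral>\<^sup>+y. ennreal (p y t x) * (ennreal (\<psi>' y) * f y) \<partial>m)"
    by (rule nn_integral_cmult) (unfold P.measurable_borel_m, measurable)
  also have "(\<integral>\<^sup>+y. ennreal (p y t x) * (ennreal (\<psi>' y) * f y) \<partial>m) = (\<integral>\<^sup>+\<omega>. ennreal (\<psi>' (\<omega> t)) *
      f (\<omega> t) \<partial>P' x)"
    by (rule P.nn_density(2)[OF t, where f="\<lambda>y. ennreal (\<psi>' y) * f y", symmetric]) measurable
  finally show "ennreal (\<psi>' x) * (\<integral>\<^sup>+\<omega>. f (\<omega> t) \<partial>Q' x) =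
      ennreal (exp (- c * t)) * (\<integral>\<^sup>+\<omega>. ennreal (\<psi>' (\<omega> t)) * f (\<omega> t) \<partial>P' x)" .
qed (rule measurable_\<psi>')

text \<open>The path density at s times the ratio of the q equals the ratio of the p: by
  \<open>q_eq\<close> the factors \<psi> at \<open>\<omega> s\<close> and at x, the factor \<psi>' y
  and the exponentials all cancel.\<close>

lemma bridge_law_transfer:
  assumes t: "0 < t" and \<mu>: "bridge_law P p x t y \<mu>"
  shows "bridge_law Q q x t y \<mu>"
  unfolding bridge_law_def
proof (intro conjI ballI)
  show "prob_space \<mu>" "sets \<mu> = sets (path_sigma {0..<t})" using \<mu> by (auto simp: bridge_law_def)
  fix s and F :: "(real \<Rightarrow> 'a) \<Rightarrow> ennreal"
  assume s: "s \<in> {0..<t}" and F: "F \<in> borel_measurable (path_sigma {0..s})"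
  have s': "0 \<le> s" "0 < t - s" using s by simp_all
  have co: "(\<lambda>\<omega> :: real \<Rightarrow> 'a. \<omega> s) \<in> borel_measurable (path_sigma {0..s})"
    using s by (intro measurable_coordinate) simp
  have qm: "(\<lambda>\<omega> :: real \<Rightarrow> 'a. q (\<omega> s) (t - s) y) \<in> borel_measurable (path_sigma {0..s})"
    by (rule Q.measurable_p[OF co _ s'(2)]) simp
  have "(\<integral>\<^sup>+\<omega>. F \<omega> * ennreal (q (\<omega> s) (t - s) y / q x t y) \<partial>Q x) =
      (\<integral>\<^sup>+\<omega>. ennreal (exp (- c * s) * (\<psi> (\<omega> s) / \<psi> x)) * (F \<omega> *
          ennreal (q (\<omega> s) (t - s) y / q x t y)) \<partial>P x)"
    by (intro forward.nn_integral_transform[OF s'(1)] borel_measurable_times_ennreal F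
        measurable_compose[OF _ measurable_ennreal] borel_measurable_divide qm borel_measurable_const)
  also have "\<dots> = (\<integral>\<^sup>+\<omega>. F \<omega> * ennreal (p (\<omega> s) (t - s) y / p x t y) \<partial>P x)"
  proof (intro nn_integral_cong)
    fix \<omega>
    have pos: "0 < p (\<omega> s) (t - s) y" "0 < p x t y" "0 < \<psi> (\<omega> s)" "0 < \<psi> x" "0 < \<psi>' y"
      by (simp_all only: P.p_pos[OF s'(2)] P.p_pos[OF t] \<psi>_pos \<psi>'_pos)
    have ex: "exp (- c * t) = exp (- c * s) * exp (- c * (t - s))"
      by (simp add: exp_add[symmetric] algebra_simps)
    have "exp (- c * s) * (\<psi> (\<omega> s) / \<psi> x) * (q (\<omega> s) (t - s) y / q x t y) = p (\<omega> s) (t - s) y / p x t y"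
      unfolding q_eq[OF t] q_eq[OF s'(2)] ex using pos by (simp add: field_simps)
    then show "ennreal (exp (- c * s) * (\<psi> (\<omega> s) / \<psi> x)) * (F \<omega> *
        ennreal (q (\<omega> s) (t - s) y / q x t y)) =
        F \<omega> * ennreal (p (\<omega> s) (t - s) y / p x t y)"
      using pos by (simp only: mult.left_commute[of "ennreal _" "F \<omega>"] ennreal_mult'[symmetric]
          mult_nonneg_nonneg exp_ge_zero divide_nonneg_nonneg less_imp_le)
  qed
  also have "\<dots> = (\<integral>\<^sup>+\<omega>. F \<omega> \<partial>\<mu>)" using \<mu> s F by (simp add: bridge_law_def)
  finally show "(\<integral>\<^sup>+\<omega>. F \<omega> \<partial>\<mu>) = (\<integral>\<^sup>+\<omega>. F \<omega> * ennreal (q (\<omega> s) (t - s) y / q x t y) \<partial>Q x)" by simp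
qed

end

section \<open>Embedding into a metric space and conclusion\<close>

lemma homeomorphic_metrized:
  fixes S :: "'a::topological_space set" and B :: "'b::metric_space set"
  assumes "S homeomorphic B" and S: "S = UNIV"
  obtains h :: "'a \<Rightarrow> 'b" where "metrized h"
proof -
  obtain h :: "'a \<Rightarrow> 'b" and g where hg: "homeomorphism UNIV B h g"
    using assms unfolding homeomorphic_def by blast
  have "\<exists>V. open V \<and> U = h -` V" if "open U" for U
  proof -
    have "openin (top_of_set UNIV) U" using that by simp
    then have "openin (top_of_set B) (h ` U)" by (rule homeomorphism_imp_open_map[OF hg])
    then obtain V where V: "open V" "h ` U = B \<inter> V" by (auto simp: openin_open)
    have "inj h" using hg by (metis UNIV_I homeomorphism_apply1 injI)
    have "h -` V = h -` (h ` U)" unfolding V(2) using homeomorphism_image1[OF hg] by auto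
    also have "\<dots> = U" using \<open>inj h\<close> by (rule inj_vimage_image_eq)
    finally show ?thesis using V(1) by blast
  qed
  moreover have "continuous_on UNIV h" using hg by (simp add: homeomorphism_def)
  ultimately have "metrized h" by unfold_locales
  then show thesis by (rule that)
qed

theorem mainTheorem1:
  fixes K B :: "'b::metric_space set"
    and P P' Q Q' :: "'a::topological_space \<Rightarrow> (real \<Rightarrow> 'a) measure"
    and mX mY :: "'a measure"
    and p q :: "'a \<Rightarrow> real \<Rightarrow> 'a \<Rightarrow> real"
    and PB QB :: "'a \<Rightarrow> real \<Rightarrow> 'a \<Rightarrow> (real \<Rightarrow> 'a) measure"
    and t0 :: real
  assumes "compact K" and "B \<in> sets (restrict_space borel K)"
    and "(UNIV :: 'a set) homeomorphic B"
    and "borel_right_process P" and "duality_hypothesis P P' mX"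
    and "transition_density_hypothesis P P' mX p"
    and "borel_right_process Q" and "duality_hypothesis Q Q' mY"
    and "transition_density_hypothesis Q Q' mY q"
    and "\<And>x t y. t > 0 \<Longrightarrow> bridge_law P p x t y (PB x t y)"
    and "\<And>x t y. t > 0 \<Longrightarrow> bridge_law Q q x t y (QB x t y)"
    and "t0 > 0" and "\<And>x. QB x t0 x = PB x t0 x"
  shows
    "(\<forall>t>0.
        (\<forall>x. equivalent_measures (restr_to_subalg (P x) (path_sigma {0..t}))
                                 (restr_to_subalg (Q x) (path_sigma {0..t}))) \<and>
        (\<forall>y. equivalent_measures (restr_to_subalg (P' y) (path_sigma {0..t}))
                                 (restr_to_subalg (Q' y) (path_sigma {0..t})))) \<and>
     (\<exists>(c::real) (\<psi>::'a \<Rightarrow> real) (\<psi>'::'a \<Rightarrow> real).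
        \<psi> \<in> borel_measurable borel \<and> (\<forall>x. \<psi> x > 0) \<and> finely_continuous P \<psi> \<and>
        \<psi>' \<in> borel_measurable borel \<and> (\<forall>x. \<psi>' x > 0) \<and> finely_continuous P' \<psi>' \<and>
        (\<forall>t>0. \<forall>x.
           transition_semigroup P t (\<lambda>z. ennreal (\<psi> z)) x = ennreal (exp (c * t) * \<psi> x) \<and>
           transition_semigroup P' t (\<lambda>z. ennreal (\<psi>' z)) x = ennreal (exp (c * t) * \<psi>' x) \<and>
           restr_to_subalg (Q x) (path_sigma {0..t}) =
             density (restr_to_subalg (P x) (path_sigma {0..t}))
               (\<lambda>\<omega>. ennreal (exp (- c * t) * (\<psi> (\<omega> t) / \<psi> (\<omega> 0)))) \<and>
           restr_to_subalg (Q' x) (path_sigma {0..t}) =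
             density (restr_to_subalg (P' x) (path_sigma {0..t}))
               (\<lambda>\<omega>. ennreal (exp (- c * t) * (\<psi>' (\<omega> t) / \<psi>' (\<omega> 0))))) \<and>
        mY = density mX (\<lambda>x. ennreal (\<psi> x * \<psi>' x))) \<and>
     (\<forall>x t y. t > 0 \<longrightarrow> QB x t y = PB x t y)"
proof -
  note PB = assms(10) and QB = assms(11) and t0 = assms(12) and eq = assms(13)
  obtain h :: "'a \<Rightarrow> 'b" where "metrized h"
    using homeomorphic_metrized[OF assms(3) refl] by blast
  then interpret metrized h .
  interpret bridged h P P' mX p Q Q' mY q t0
  proof
    fix x s and F :: "(real \<Rightarrow> 'a) \<Rightarrow> ennreal"
    assume s: "0 \<le> s" "s < t0" and F: "F \<in> borel_measurable (path_sigma {0..s})"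
    have "(\<integral>\<^sup>+\<omega>. F \<omega> \<partial>PB x t0 x) = (\<integral>\<^sup>+\<omega>. F \<omega> * ennreal (p (\<omega> s) (t0 - s) x / p x t0 x) \<partial>P x)"
      using PB[OF t0, of x x] s F by (simp add: bridge_law_def)
    moreover have "(\<integral>\<^sup>+\<omega>. F \<omega> \<partial>QB x t0 x) = (\<integral>\<^sup>+\<omega>. F \<omega> * ennreal (q (\<omega> s) (t0 - s) x / q x t0 x) \<partial>Q x)"
      using QB[OF t0, of x x] s F by (simp add: bridge_law_def)
    ultimately show "(\<integral>\<^sup>+\<omega>. F \<omega> * ennreal (p (\<omega> s) (t0 - s) x / p x t0 x) \<partial>P x) =
        (\<integral>\<^sup>+\<omega>. F \<omega> * ennreal (q (\<omega> s) (t0 - s) x / q x t0 x) \<partial>Q x)"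
      by (simp add: eq)
  qed (fact assms)+
  \<comment> \<open>Both measures are bridge laws for Q, so uniqueness identifies them.\<close>
  have bridges: "QB x t y = PB x t y" if "t > 0" for x t y
    using bridge_law_unique[OF QB[OF that] bridge_law_transfer[OF that PB[OF that]] that] .
  have laws: "equivalent_measures (restr_to_subalg (P x) (path_sigma {0..t})) (restr_to_subalg (Q x) (path_sigma {0..t}))"
    "equivalent_measures (restr_to_subalg (P' x) (path_sigma {0..t})) (restr_to_subalg (Q' x) (path_sigma {0..t}))"
    if "t > 0" for t x
    using that by (auto intro: forward.equivalent_path_laws dual.equivalent_path_laws)
  have transforms: "transition_semigroup P t (\<lambda>z. ennreal (\<psi> z)) x = ennreal (exp (c * t) * \<psi> x) \<and>
      transition_semigroup P' t (\<lambda>z. ennreal (\<psi>' z)) x = ennreal (exp (c * t) * \<psi>' x) \<and>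
      restr_to_subalg (Q x) (path_sigma {0..t}) = density (restr_to_subalg (P x) (path_sigma {0..t}))
        (\<lambda>\<omega>. ennreal (exp (- c * t) * (\<psi> (\<omega> t) / \<psi> (\<omega> 0)))) \<and>
      restr_to_subalg (Q' x) (path_sigma {0..t}) = density (restr_to_subalg (P' x) (path_sigma {0..t}))
        (\<lambda>\<omega>. ennreal (exp (- c * t) * (\<psi>' (\<omega> t) / \<psi>' (\<omega> 0))))"
    if "t > 0" for t x
    unfolding transition_semigroup_def
    using that by (intro conjI forward.harmonic_psi dual.harmonic_psi forward.path_density dual.path_density) auto
  show ?thesis
    by (rule conjI[OF _ conjI[OF exI[where x=c, OF exI[where x=\<psi>, OF exI[where x=\<psi>']]]]],
        intro allI impI conjI laws, assumption+,
        intro conjI allI impI measurable_\<psi> measurable_\<psi>' \<psi>_pos \<psi>'_pos n_eq_psi transforms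
          forward.harmonic_finely_continuous dual.harmonic_finely_continuous, assumption+,
        intro allI impI bridges)
qed

end
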